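(* Let $(R,\mathfrak{m},\Bbbk)$ be a (commutative Noetherian) regular local ring with a locally contracting endomorphism $\phi:R\to R$, and let $M$ be an $R$-module. Assume that $R$ is $\mathrm{F}^{\phi}$-finite. Then $\mathrm{Coass}_R(\widetilde{\mathrm{F}}^{\phi}(M))=\mathrm{Coass}_R(M)$.
   Context: All rings are commutative Noetherian with identity. A ring endomorphism $\psi$ of a local ring $(A,\mathfrak{n})$ is contracting if $\psi^i(\mathfrak{n})\subseteq\mathfrak{n}^2$ for some positive integer $i$. A ring endomorphism $\phi:R\to R$ is locally contracting if for every prime ideal $\mathfrak{p}$ of $R$ the induced map $\phi_{\mathfrak{p}}:R_{\mathfrak{p}}\to R_{\mathfrak{p}}$, $\phi_{\mathfrak{p}}(r/s)=\phi(r)/\phi(s)$, is a (well-defined) contracting endomorphism. ${}^{\phi}R$ is the Abelian group $R$ with left $R$-module structure $r\cdot s=\phi(r)s$; $R$ is $\mathrm{F}^{\phi}$-finite if ${}^{\phi}R$ is a finitely generated $R$-module. For an $R$-module $M$, $\widetilde{\mathrm{F}}^{\phi}(M)=\mathrm{Hom}_R({}^{\phi}R,M)$, regarded as an $R$-module via $(\theta\cdot r)(s)=\theta(sr)$ (so $r\theta(s)=\theta(\phi(r)s)$). A prime ideal $\mathfrak{p}$ of $R$ is a coassociated prime of an $R$-module $X$ if $\mathfrak{p}=\mathrm{Ann}_R(L)$ for some Artinian quotient $L$ of $X$; $\mathrm{Coass}_R(X)$ is the set of coassociated primes of $X$. *)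

theory Defs
  imports "HOL-Algebra.Algebra" "HOL-Library.Extended_Nat"
begin

section \<open>Regular local rings\<close>

locale noetherian_local_ring = cring R + noetherian_ring R + maximalideal \<mm> R
  for \<mm> and R (structure) +
  assumes unique_maximalideal: "maximalideal I R \<Longrightarrow> I = \<mm>"

definition krull_dim :: "('a, 'r) ring_scheme \<Rightarrow> enat"
  where "krull_dim R = Sup {enat n | n. \<exists>P :: nat \<Rightarrow> 'a set.
           (\<forall>i\<le>n. primeideal (P i) R) \<and> (\<forall>i<n. P i \<subset> P (Suc i))}"

definition min_generators :: "('a, 'r) ring_scheme \<Rightarrow> 'a set \<Rightarrow> nat"
  where "min_generators R I =
           (LEAST n. \<exists>A \<subseteq> carrier R. finite A \<and> card A = n \<and> I = Idl\<^bsub>R\<^esub> A)"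

locale regular_local_ring = noetherian_local_ring +
  assumes regular: "enat (min_generators R \<mm>) = krull_dim R"


section \<open>Localization\<close>

text \<open>
  The fraction \<open>r/s\<close> is the class of \<open>(r, s)\<close> under
  \<open>(r, s) \<sim> (r', s') \<longleftrightarrow> (\<exists>u \<in> S. u (r s' - r' s) = 0)\<close>.
  The ring operations are written as unions over representatives; the lemmas
  \<open>localization_mult_frac\<close> and \<open>localization_add_frac\<close> below show that they are
  the usual operations on fractions.
\<close>

definition frac_class :: "('a, 'r) ring_scheme \<Rightarrow> 'a set \<Rightarrow> 'a \<Rightarrow> 'a \<Rightarrow> ('a \<times> 'a) set"
  where "frac_class R S r s = {(r', s'). r' \<in> carrier R \<and> s' \<in> S \<and>
           (\<exists>u\<in>S. u \<otimes>\<^bsub>R\<^esub> (r \<otimes>\<^bsub>R\<^esub> s' \<ominus>\<^bsub>R\<^esub> r' \<otimes>\<^bsub>R\<^esub> s) = \<zero>\<^bsub>R\<^esub>)}"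

definition localization :: "('a, 'r) ring_scheme \<Rightarrow> 'a set \<Rightarrow> ('a \<times> 'a) set ring"
  where "localization R S =
    \<lparr>carrier = {frac_class R S r s | r s. r \<in> carrier R \<and> s \<in> S},
     monoid.mult = (\<lambda>A B. \<Union>(r, s)\<in>A. \<Union>(r', s')\<in>B. frac_class R S (r \<otimes>\<^bsub>R\<^esub> r') (s \<otimes>\<^bsub>R\<^esub> s')),
     one = frac_class R S \<one>\<^bsub>R\<^esub> \<one>\<^bsub>R\<^esub>,
     ring.zero = frac_class R S \<zero>\<^bsub>R\<^esub> \<one>\<^bsub>R\<^esub>,
     add = (\<lambda>A B. \<Union>(r, s)\<in>A. \<Union>(r', s')\<in>B.
              frac_class R S (r \<otimes>\<^bsub>R\<^esub> s' \<oplus>\<^bsub>R\<^esub> r' \<otimes>\<^bsub>R\<^esub> s) (s \<otimes>\<^bsub>R\<^esub> s'))\<rparr>"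

definition localization_at :: "('a, 'r) ring_scheme \<Rightarrow> 'a set \<Rightarrow> ('a \<times> 'a) set ring"
  where "localization_at R \<pp> = localization R (carrier R - \<pp>)"

definition localized_ideal :: "('a, 'r) ring_scheme \<Rightarrow> 'a set \<Rightarrow> ('a \<times> 'a) set set"
  where "localized_ideal R \<pp> =
           {frac_class R (carrier R - \<pp>) r s | r s. r \<in> \<pp> \<and> s \<in> carrier R - \<pp>}"

locale mult_subset = cring R for R (structure) and S +
  assumes S_subset: "S \<subseteq> carrier R"
    and S_one: "\<one> \<in> S"
    and S_mult: "\<lbrakk>s \<in> S; t \<in> S\<rbrakk> \<Longrightarrow> s \<otimes> t \<in> S"
begin

lemma S_carrier [simp]: "s \<in> S \<Longrightarrow> s \<in> carrier R"
  using S_subset by blast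

lemma frac_class_refl:
  assumes "r \<in> carrier R" "s \<in> S"
  shows "(r, s) \<in> frac_class R S r s"
  using assms S_one by (auto simp: frac_class_def r_right_minus_eq intro!: bexI[of _ \<one>])

lemma frac_class_eqI:
  assumes "(r', s') \<in> frac_class R S r s" "r \<in> carrier R" "s \<in> S"
  shows "frac_class R S r' s' = frac_class R S r s"
proof -
  have sub: "frac_class R S b t \<subseteq> frac_class R S a s"
    if ab: "a \<in> carrier R" "s \<in> S" "b \<in> carrier R" "t \<in> S" "u \<in> S"
      "u \<otimes> (a \<otimes> t \<ominus> b \<otimes> s) = \<zero>" for a b s t u
  proof (clarsimp simp: frac_class_def)
    fix c v w
    assume c: "c \<in> carrier R" "v \<in> S" "w \<in> S" "w \<otimes> (b \<otimes> v \<ominus> c \<otimes> t) = \<zero>"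
    note [simp] = ab(1-5) c(1-3)
    have "u \<otimes> w \<otimes> t \<otimes> (a \<otimes> v \<ominus> c \<otimes> s)
        = w \<otimes> v \<otimes> (u \<otimes> (a \<otimes> t \<ominus> b \<otimes> s)) \<oplus> u \<otimes> s \<otimes> (w \<otimes> (b \<otimes> v \<ominus> c \<otimes> t))"
    proof -
      have mem [simp]: "u \<in> carrier R" "w \<in> carrier R" "t \<in> carrier R" "a \<in> carrier R"
        "v \<in> carrier R" "c \<in> carrier R" "s \<in> carrier R" "b \<in> carrier R" by auto
      show ?thesis using mem by algebra
    qed
    also have "\<dots> = \<zero>" using that(6) c(4) by simp
    finally show "\<exists>u\<in>S. u \<otimes> (a \<otimes> v \<ominus> c \<otimes> s) = \<zero>"
      by (meson S_mult ab(4,5) c(3))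
  qed
  from assms obtain u where u: "r' \<in> carrier R" "s' \<in> S" "u \<in> S"
    "u \<otimes> (r \<otimes> s' \<ominus> r' \<otimes> s) = \<zero>" by (auto simp: frac_class_def)
  have mem [simp]: "r \<in> carrier R" "s \<in> carrier R" "r' \<in> carrier R" "s' \<in> carrier R" "u \<in> carrier R"
    using assms u by auto
  have "u \<otimes> (r' \<otimes> s \<ominus> r \<otimes> s') = \<ominus> (u \<otimes> (r \<otimes> s' \<ominus> r' \<otimes> s))" using mem by algebra
  then have "u \<otimes> (r' \<otimes> s \<ominus> r \<otimes> s') = \<zero>" using u by simp
  with sub u assms show ?thesis by (intro equalityI sub) auto
qed

lemma UN_frac_class:
  assumes "r \<in> carrier R" "s \<in> S" "r' \<in> carrier R" "s' \<in> S"
    and "\<And>a t a' t'. \<lbrakk>(a, t) \<in> frac_class R S r s; (a', t') \<in> frac_class R S r' s'\<rbrakk>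
           \<Longrightarrow> F a t a' t' = F r s r' s'"
  shows "(\<Union>(a, t)\<in>frac_class R S r s. \<Union>(a', t')\<in>frac_class R S r' s'. F a t a' t')
           = F r s r' s'"
proof (intro equalityI subsetI)
  fix x assume "x \<in> F r s r' s'"
  then show "x \<in> (\<Union>(a, t)\<in>frac_class R S r s. \<Union>(a', t')\<in>frac_class R S r' s'. F a t a' t')"
    using frac_class_refl[OF assms(1,2)] frac_class_refl[OF assms(3,4)] by fast
qed (use assms(5) in fastforce)

lemma localization_mult_frac:
  assumes "r \<in> carrier R" "s \<in> S" "r' \<in> carrier R" "s' \<in> S"
  shows "frac_class R S r s \<otimes>\<^bsub>localization R S\<^esub> frac_class R S r' s'
           = frac_class R S (r \<otimes> r') (s \<otimes> s')"
proof -
  have "frac_class R S (a \<otimes> a') (t \<otimes> t') = frac_class R S (r \<otimes> r') (s \<otimes> s')"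
    if at: "(a, t) \<in> frac_class R S r s" "(a', t') \<in> frac_class R S r' s'" for a t a' t'
  proof (rule frac_class_eqI)
    from at obtain u u' where u: "a \<in> carrier R" "t \<in> S" "u \<in> S" "u \<otimes> (r \<otimes> t \<ominus> a \<otimes> s) = \<zero>"
      "a' \<in> carrier R" "t' \<in> S" "u' \<in> S" "u' \<otimes> (r' \<otimes> t' \<ominus> a' \<otimes> s') = \<zero>"
      by (auto simp: frac_class_def)
    have mem [simp]: "r \<in> carrier R" "s \<in> carrier R" "r' \<in> carrier R" "s' \<in> carrier R"
      "u \<in> carrier R" "u' \<in> carrier R" "a \<in> carrier R" "t \<in> carrier R"
      "a' \<in> carrier R" "t' \<in> carrier R"
      using assms u by auto
    have "(u \<otimes> u') \<otimes> (r \<otimes> r' \<otimes> (t \<otimes> t') \<ominus> a \<otimes> a' \<otimes> (s \<otimes> s'))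
      = u' \<otimes> r' \<otimes> t' \<otimes> (u \<otimes> (r \<otimes> t \<ominus> a \<otimes> s)) \<oplus> u \<otimes> a \<otimes> s \<otimes> (u' \<otimes> (r' \<otimes> t' \<ominus> a' \<otimes> s'))"
      using mem by algebra
    also have "\<dots> = \<zero>" using u by simp
    finally show "(a \<otimes> a', t \<otimes> t') \<in> frac_class R S (r \<otimes> r') (s \<otimes> s')"
      using u S_mult by (auto simp: frac_class_def)
  qed (use assms S_mult in auto)
  then show ?thesis
    using UN_frac_class[OF assms, of "\<lambda>r s r' s'. frac_class R S (r \<otimes> r') (s \<otimes> s')"]
    by (simp add: localization_def)
qed

lemma localization_add_frac:
  assumes "r \<in> carrier R" "s \<in> S" "r' \<in> carrier R" "s' \<in> S"
  shows "frac_class R S r s \<oplus>\<^bsub>localization R S\<^esub> frac_class R S r' s'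
           = frac_class R S (r \<otimes> s' \<oplus> r' \<otimes> s) (s \<otimes> s')"
proof -
  have "frac_class R S (a \<otimes> t' \<oplus> a' \<otimes> t) (t \<otimes> t')
          = frac_class R S (r \<otimes> s' \<oplus> r' \<otimes> s) (s \<otimes> s')"
    if at: "(a, t) \<in> frac_class R S r s" "(a', t') \<in> frac_class R S r' s'" for a t a' t'
  proof (rule frac_class_eqI)
    from at obtain u u' where u: "a \<in> carrier R" "t \<in> S" "u \<in> S" "u \<otimes> (r \<otimes> t \<ominus> a \<otimes> s) = \<zero>"
      "a' \<in> carrier R" "t' \<in> S" "u' \<in> S" "u' \<otimes> (r' \<otimes> t' \<ominus> a' \<otimes> s') = \<zero>"
      by (auto simp: frac_class_def)
    have mem [simp]: "r \<in> carrier R" "s \<in> carrier R" "r' \<in> carrier R" "s' \<in> carrier R"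
      "u \<in> carrier R" "u' \<in> carrier R" "a \<in> carrier R" "t \<in> carrier R"
      "a' \<in> carrier R" "t' \<in> carrier R"
      using assms u by auto
    have "(u \<otimes> u') \<otimes> ((r \<otimes> s' \<oplus> r' \<otimes> s) \<otimes> (t \<otimes> t') \<ominus> (a \<otimes> t' \<oplus> a' \<otimes> t) \<otimes> (s \<otimes> s'))
      = u' \<otimes> s' \<otimes> t' \<otimes> (u \<otimes> (r \<otimes> t \<ominus> a \<otimes> s)) \<oplus> u \<otimes> s \<otimes> t \<otimes> (u' \<otimes> (r' \<otimes> t' \<ominus> a' \<otimes> s'))"
      using mem by algebra
    also have "\<dots> = \<zero>" using u by simp
    finally show "(a \<otimes> t' \<oplus> a' \<otimes> t, t \<otimes> t') \<in> frac_class R S (r \<otimes> s' \<oplus> r' \<otimes> s) (s \<otimes> s')"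
      using u S_mult by (auto simp: frac_class_def)
  qed (use assms S_mult in auto)
  then show ?thesis
    using UN_frac_class[OF assms,
        of "\<lambda>r s r' s'. frac_class R S (r \<otimes> s' \<oplus> r' \<otimes> s) (s \<otimes> s')"]
    by (simp add: localization_def)
qed

end


section \<open>Locally contracting endomorphisms\<close>

definition contracting :: "('a, 'r) ring_scheme \<Rightarrow> 'a set \<Rightarrow> ('a \<Rightarrow> 'a) \<Rightarrow> bool"
  where "contracting A \<nn> \<psi> \<longleftrightarrow>
           \<psi> \<in> ring_hom A A \<and> (\<exists>i>0. (\<psi> ^^ i) ` \<nn> \<subseteq> ideal_prod A \<nn> \<nn>)"

text \<open>
  The first conjunct under the quantifier says that \<open>\<phi>(r)/\<phi>(s)\<close> is a fraction of
  \<open>R\<^sub>\<pp>\<close> for every fraction \<open>r/s\<close>; together with the existence of \<open>\<psi>\<close> it expresses that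
  the induced map is well defined. On the carrier, \<open>\<psi>\<close> is determined by the fraction
  equation. The maximal ideal of \<open>R\<^sub>\<pp>\<close> is \<open>\<pp>R\<^sub>\<pp>\<close>.
\<close>

definition locally_contracting :: "('a, 'r) ring_scheme \<Rightarrow> ('a \<Rightarrow> 'a) \<Rightarrow> bool"
  where "locally_contracting R \<phi> \<longleftrightarrow>
    \<phi> \<in> ring_hom R R \<and>
    (\<forall>\<pp>. primeideal \<pp> R \<longrightarrow>
       (\<forall>s \<in> carrier R - \<pp>. \<phi> s \<in> carrier R - \<pp>) \<and>
       (\<exists>\<psi>. (\<forall>r \<in> carrier R. \<forall>s \<in> carrier R - \<pp>.
                \<psi> (frac_class R (carrier R - \<pp>) r s)
                  = frac_class R (carrier R - \<pp>) (\<phi> r) (\<phi> s)) \<and>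
             contracting (localization_at R \<pp>) (localized_ideal R \<pp>) \<psi>))"


section \<open>Modules\<close>

definition gen_submodule ::
    "('a, 'r) ring_scheme \<Rightarrow> ('a, 'b, 'm) module_scheme \<Rightarrow> 'b set \<Rightarrow> 'b set"
  where "gen_submodule R M A = \<Inter>{N. submodule N R M \<and> A \<subseteq> N}"

definition finitely_generated ::
    "('a, 'r) ring_scheme \<Rightarrow> ('a, 'b, 'm) module_scheme \<Rightarrow> bool"
  where "finitely_generated R M \<longleftrightarrow>
           (\<exists>A \<subseteq> carrier M. finite A \<and> gen_submodule R M A = carrier M)"

text \<open>
  The ring fields \<open>mult\<close> and \<open>one\<close> of a module record carry no meaning for modules, so they
  are left \<open>undefined\<close> where no ring structure is at hand. The class of \<open>r \<odot> x\<close> does not depend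
  on the representative, so the union in \<open>smult\<close> below is a single coset.
\<close>

definition quotient_module ::
    "('a, 'b, 'm) module_scheme \<Rightarrow> 'b set \<Rightarrow> ('a, 'b set) module"
  where "quotient_module M N =
    \<lparr>carrier = a_rcosets\<^bsub>M\<^esub> N, monoid.mult = undefined, one = undefined,
     ring.zero = N, add = set_add M,
     smult = (\<lambda>r A. \<Union>x\<in>A. N +>\<^bsub>M\<^esub> (r \<odot>\<^bsub>M\<^esub> x))\<rparr>"

definition module_hom ::
    "('a, 'r) ring_scheme \<Rightarrow> ('a, 'b, 'm) module_scheme \<Rightarrow> ('a, 'c, 'n) module_scheme
       \<Rightarrow> ('b \<Rightarrow> 'c) set"
  where "module_hom R M N = {\<theta> \<in> carrier M \<rightarrow>\<^sub>E carrier N.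
           (\<forall>x \<in> carrier M. \<forall>y \<in> carrier M. \<theta> (x \<oplus>\<^bsub>M\<^esub> y) = \<theta> x \<oplus>\<^bsub>N\<^esub> \<theta> y) \<and>
           (\<forall>r \<in> carrier R. \<forall>x \<in> carrier M. \<theta> (r \<odot>\<^bsub>M\<^esub> x) = r \<odot>\<^bsub>N\<^esub> \<theta> x)}"

definition artinian_module ::
    "('a, 'r) ring_scheme \<Rightarrow> ('a, 'b, 'm) module_scheme \<Rightarrow> bool"
  where "artinian_module R M \<longleftrightarrow>
    module R M \<and>
    (\<forall>N :: nat \<Rightarrow> 'b set. (\<forall>i. submodule (N i) R M) \<and> (\<forall>i. N (Suc i) \<subseteq> N i)
       \<longrightarrow> (\<exists>n. \<forall>i\<ge>n. N i = N n))"

definition annihilator ::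
    "('a, 'r) ring_scheme \<Rightarrow> ('a, 'b, 'm) module_scheme \<Rightarrow> 'a set"
  where "annihilator R M = {r \<in> carrier R. \<forall>x \<in> carrier M. r \<odot>\<^bsub>M\<^esub> x = \<zero>\<^bsub>M\<^esub>}"

definition Coass ::
    "('a, 'r) ring_scheme \<Rightarrow> ('a, 'b, 'm) module_scheme \<Rightarrow> 'a set set"
  where "Coass R M = {\<pp>. primeideal \<pp> R \<and>
           (\<exists>N. submodule N R M \<and> artinian_module R (quotient_module M N) \<and>
                \<pp> = annihilator R (quotient_module M N))}"


section \<open>The functor \<open>Hom\<^sub>R(\<^sup>\<phi>R, -)\<close>\<close>

definition twisted_module ::
    "('a, 'r) ring_scheme \<Rightarrow> ('a \<Rightarrow> 'a) \<Rightarrow> ('a, 'a) module"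
  where "twisted_module R \<phi> =
    \<lparr>carrier = carrier R, monoid.mult = monoid.mult R, one = one R, ring.zero = ring.zero R, add = add R,
     smult = (\<lambda>r s. \<phi> r \<otimes>\<^bsub>R\<^esub> s)\<rparr>"

definition F_finite :: "('a, 'r) ring_scheme \<Rightarrow> ('a \<Rightarrow> 'a) \<Rightarrow> bool"
  where "F_finite R \<phi> \<longleftrightarrow> finitely_generated R (twisted_module R \<phi>)"

definition F_tilde ::
    "('a, 'r) ring_scheme \<Rightarrow> ('a \<Rightarrow> 'a) \<Rightarrow> ('a, 'b, 'm) module_scheme
       \<Rightarrow> ('a, 'a \<Rightarrow> 'b) module"
  where "F_tilde R \<phi> M =
    \<lparr>carrier = module_hom R (twisted_module R \<phi>) M,
     monoid.mult = undefined, one = undefined,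
     ring.zero = (\<lambda>s\<in>carrier R. \<zero>\<^bsub>M\<^esub>),
     add = (\<lambda>\<theta> \<eta>. \<lambda>s\<in>carrier R. \<theta> s \<oplus>\<^bsub>M\<^esub> \<eta> s),
     smult = (\<lambda>r \<theta>. \<lambda>s\<in>carrier R. \<theta> (s \<otimes>\<^bsub>R\<^esub> r))\<rparr>"

end

theory Submission
  imports Defs
begin

text \<open>
  Since \<open>\<phi>\<close> is contracting at every prime, \<open>\<phi>\<^sup>-\<^sup>1(\<pp>) = \<pp>\<close> for all primes \<open>\<pp>\<close>; nothing else about
  \<open>\<phi>\<close> is used besides finiteness. Let \<open>x\<^sub>1, \<dots>, x\<^sub>d\<close> be a regular system of parameters and
  \<open>P\<^sub>j = (x\<^sub>1, \<dots>, x\<^sub>j)\<close>, which is prime. Every prime containing \<open>P\<^sub>j\<close> and \<open>\<phi>(x\<^sub>j\<^sub>+\<^sub>1)\<close> contains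
  \<open>x\<^sub>j\<^sub>+\<^sub>1\<close>, so \<open>\<phi>(x\<^sub>j\<^sub>+\<^sub>1)\<close> is a unit times a power of \<open>x\<^sub>j\<^sub>+\<^sub>1\<close> modulo \<open>P\<^sub>j\<close>. Hence
  \<open>\<phi>(x\<^sub>1), \<dots>, \<phi>(x\<^sub>d)\<close> is a regular sequence, and by Nakayama a minimal generating set of the
  module \<open>\<^sup>\<phi>R\<close> is a basis. With the dual basis \<open>\<alpha>\<^sub>a\<close>, each element of \<open>Hom(\<^sup>\<phi>R, M)\<close> is
  \<open>\<theta> = \<Sum> \<alpha>\<^sub>a(\<cdot>) \<theta>(a)\<close>.

  If \<open>L\<close> is an Artinian quotient of \<open>M\<close> with annihilator \<open>\<pp>\<close>, then \<open>Hom(\<^sup>\<phi>R, L)\<close> is an Artinian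
  quotient of \<open>Hom(\<^sup>\<phi>R, M)\<close> whose annihilator contracts to \<open>\<pp>\<close> along \<open>\<phi>\<close> and so has radical \<open>\<pp>\<close>;
  a further quotient has annihilator \<open>\<pp>\<close>. Conversely, an Artinian quotient \<open>L\<close> of
  \<open>Hom(\<^sup>\<phi>R, M)\<close> with annihilator \<open>\<pp>\<close> stays Artinian after restriction along \<open>\<phi>\<close>, where it is the
  sum of the images of the maps \<open>M \<rightarrow> L\<close> given by \<open>y \<mapsto> [\<alpha>\<^sub>a(\<cdot>) y]\<close>; as \<open>\<pp>\<close> is prime, one of these
  images already has annihilator \<open>\<pp>\<close>.
\<close>

section \<open>Ideals, saturations and Nakayama's lemma\<close>

text \<open>Two facts that are usually quoted shape the proof. Regularity compares a number of
  generators with the length of chains of primes, so primality of the \<open>P\<^sub>j\<close> rests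
  on Krull's principal ideal theorem: it reroutes a longest chain through one generator after
  another, and each generator then accounts for exactly one step. Freeness of R over itself through
  \<open>\<phi>\<close> is proved by descent along the flag of the \<open>P\<^sub>j\<close>: modulo
  \<mm>, independence of a minimal generating set is minimality, and regularity of the images of the
  parameters carries it down to the zero ideal. The commutative algebra stays inside R: membership
  in I replaces R/I, and ideals saturated by the complement of P replace those of the localization
  at P. Nakayama's lemma therefore reads: \<open>J \<subseteq> K + x J\<close> locally implies
  \<open>J \<subseteq> K\<close> locally, for a mere set J, with the ascending chain condition in
  place of finite generation.\<close>

locale noetherian_cring = cring R + noetherian_ring R for R (structure)

context cring
begin

lemma ideal_closed:
  assumes "ideal I R"
  shows "\<And>a. a \<in> I \<Longrightarrow> a \<in> carrier R"
    and "\<zero> \<in> I"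
    and "\<And>a b. \<lbrakk>a \<in> I; b \<in> I\<rbrakk> \<Longrightarrow> a \<oplus> b \<in> I"
    and "\<And>a. a \<in> I \<Longrightarrow> \<ominus> a \<in> I"
    and "\<And>a b. \<lbrakk>a \<in> I; b \<in> I\<rbrakk> \<Longrightarrow> a \<ominus> b \<in> I"
    and "\<And>a r. \<lbrakk>a \<in> I; r \<in> carrier R\<rbrakk> \<Longrightarrow> r \<otimes> a \<in> I"
    and "\<And>a r. \<lbrakk>a \<in> I; r \<in> carrier R\<rbrakk> \<Longrightarrow> a \<otimes> r \<in> I"
proof -
  interpret ideal I R by fact
  show "\<And>a. a \<in> I \<Longrightarrow> a \<in> carrier R" "\<zero> \<in> I" "\<And>a b. \<lbrakk>a \<in> I; b \<in> I\<rbrakk> \<Longrightarrow> a \<oplus> b \<in> I"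
    "\<And>a. a \<in> I \<Longrightarrow> \<ominus> a \<in> I"  "\<And>a b. \<lbrakk>a \<in> I; b \<in> I\<rbrakk> \<Longrightarrow> a \<ominus> b \<in> I"
    "\<And>a r. \<lbrakk>a \<in> I; r \<in> carrier R\<rbrakk> \<Longrightarrow> r \<otimes> a \<in> I"
    "\<And>a r. \<lbrakk>a \<in> I; r \<in> carrier R\<rbrakk> \<Longrightarrow> a \<otimes> r \<in> I"
    by (auto simp: a_minus_def I_l_closed I_r_closed)
qed

lemma idealI':
  assumes "I \<subseteq> carrier R" "\<zero> \<in> I"
    and add: "\<And>a b. \<lbrakk>a \<in> I; b \<in> I\<rbrakk> \<Longrightarrow> a \<oplus> b \<in> I"
    and mult: "\<And>a r. \<lbrakk>a \<in> I; r \<in> carrier R\<rbrakk> \<Longrightarrow> r \<otimes> a \<in> I"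
  shows "ideal I R"
proof (rule idealI)
  show "ring R" by (rule ring_axioms)
  have "\<ominus> a \<in> I" if "a \<in> I" for a
  proof -
    have "a \<in> carrier R" using that assms(1) by blast
    then have "\<ominus> a = (\<ominus> \<one>) \<otimes> a" by algebra
    then show ?thesis using mult[OF that, of "\<ominus> \<one>"] by simp
  qed
  then show "subgroup I (add_monoid R)"
    using assms by (intro add.subgroupI) auto
  show "x \<otimes> a \<in> I" if "a \<in> I" "x \<in> carrier R" for a x by (rule mult[OF that])
  show "a \<otimes> x \<in> I" if "a \<in> I" "x \<in> carrier R" for a x
    using mult[OF that] m_comm[of a x] that assms(1) by auto
qed

text \<open>Passing from R/I to R/(I + (x)) takes place inside R through this ideal, so iterated
  quotients become iterated uses of \<open>adjoin\<close>.\<close>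

definition adjoin :: "'a set \<Rightarrow> 'a \<Rightarrow> 'a set"
  where "adjoin I x = {i \<oplus> r \<otimes> x | i r. i \<in> I \<and> r \<in> carrier R}"

lemma adjoinI:
  assumes "i \<in> I" "r \<in> carrier R"
  shows "i \<oplus> r \<otimes> x \<in> adjoin I x"
  using assms unfolding adjoin_def by blast

lemma adjoinE:
  assumes "a \<in> adjoin I x"
  obtains i r where "i \<in> I" "r \<in> carrier R" "a = i \<oplus> r \<otimes> x"
  using assms unfolding adjoin_def by blast

lemma ideal_adjoin:
  assumes "ideal I R" "x \<in> carrier R"
  shows "ideal (adjoin I x) R"
proof (rule idealI')
  note I = ideal_closed[OF assms(1)] and [simp] = assms(2)
  show "adjoin I x \<subseteq> carrier R" using I(1) by (auto simp: adjoin_def)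
  have "\<zero> = \<zero> \<oplus> \<zero> \<otimes> x" by simp
  then show "\<zero> \<in> adjoin I x" using I(2) unfolding adjoin_def by blast
  show "a \<oplus> b \<in> adjoin I x" if ab: "a \<in> adjoin I x" "b \<in> adjoin I x" for a b
  proof -
    obtain i r j s where e: "a = i \<oplus> r \<otimes> x" "b = j \<oplus> s \<otimes> x" "i \<in> I" "j \<in> I"
      "r \<in> carrier R" "s \<in> carrier R" using ab unfolding adjoin_def by blast
    note [simp] = e(5,6) I(1)[OF e(3)] I(1)[OF e(4)]
    have "i \<oplus> r \<otimes> x \<oplus> (j \<oplus> s \<otimes> x) = (i \<oplus> j) \<oplus> (r \<oplus> s) \<otimes> x"
      by (simp add: l_distr a_ac)
    then show ?thesis using adjoinI[OF I(3)[OF e(3,4)], of "r \<oplus> s" x] e(1,2) by simp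
  qed
  show "s \<otimes> a \<in> adjoin I x" if as: "a \<in> adjoin I x" "s \<in> carrier R" for a s
  proof -
    obtain i r where e: "a = i \<oplus> r \<otimes> x" "i \<in> I" "r \<in> carrier R"
      using as unfolding adjoin_def by blast
    note [simp] = e(3) I(1)[OF e(2)] as(2)
    have "s \<otimes> (i \<oplus> r \<otimes> x) = s \<otimes> i \<oplus> (s \<otimes> r) \<otimes> x"
      by (simp add: r_distr m_ac)
    then show ?thesis using adjoinI[OF I(6)[OF e(2) as(2)], of "s \<otimes> r" x] e(1) by simp
  qed
qed

lemma adjoin_superset:
  assumes "ideal I R" "x \<in> carrier R"
  shows "I \<subseteq> adjoin I x" "x \<in> adjoin I x"
proof -
  note I = ideal_closed[OF assms(1)] and [simp] = assms(2)
  show "I \<subseteq> adjoin I x"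
  proof
    fix i assume "i \<in> I"
    then show "i \<in> adjoin I x" using adjoinI[of i I \<zero> x] I(1) by simp
  qed
  show "x \<in> adjoin I x" using adjoinI[OF I(2), of \<one> x] by simp
qed

lemma adjoin_subset:
  assumes "ideal K R" "I \<subseteq> K" "x \<in> K"
  shows "adjoin I x \<subseteq> K"
  using assms ideal_closed[OF assms(1)] by (auto elim!: adjoinE)

lemma adjoin_mono: "I \<subseteq> K \<Longrightarrow> adjoin I x \<subseteq> adjoin K x"
  unfolding adjoin_def by blast

lemma primeideal_closed:
  assumes "primeideal P R"
  shows "ideal P R" "\<one> \<notin> P"
    and "\<And>a b. \<lbrakk>a \<in> carrier R; b \<in> carrier R; a \<otimes> b \<in> P\<rbrakk> \<Longrightarrow> a \<in> P \<or> b \<in> P"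
proof -
  interpret primeideal P R by fact
  show "ideal P R" by (rule is_ideal)
  show "\<one> \<notin> P" using I_notcarr one_imp_carrier by blast
  show "\<And>a b. \<lbrakk>a \<in> carrier R; b \<in> carrier R; a \<otimes> b \<in> P\<rbrakk> \<Longrightarrow> a \<in> P \<or> b \<in> P"
    by (rule I_prime)
qed

lemma primeideal_pow:
  assumes "primeideal P R" "a \<in> carrier R" "a [^] (n::nat) \<in> P"
  shows "a \<in> P"
  using assms(3)
proof (induction n)
  case 0
  then show ?case using primeideal_closed(2)[OF assms(1)] by simp
next
  case (Suc n)
  then show ?case using primeideal_closed(3)[OF assms(1), of "a [^] n" a] assms(2) by auto
qed

lemma mult_subset_compl:
  assumes "primeideal P R"
  shows "mult_subset R (carrier R - P)"
  using primeideal_closed[OF assms] by unfold_locales auto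

text \<open>For \<open>S\<close> the complement of a prime P this set inverts x on top of localizing
  at P; for \<open>S = {\<one>}\<close> it is the set of powers of x.\<close>

definition with_powers :: "'a set \<Rightarrow> 'a \<Rightarrow> 'a set"
  where "with_powers S x = (\<lambda>(s, n::nat). s \<otimes> x [^] n) ` (S \<times> UNIV)"

lemma with_powersI: "s \<in> S \<Longrightarrow> s \<otimes> x [^] (n::nat) \<in> with_powers S x"
  unfolding with_powers_def by force

lemma with_powersE:
  assumes "a \<in> with_powers S x"
  obtains s and n :: nat where "s \<in> S" "a = s \<otimes> x [^] n"
  using assms unfolding with_powers_def by auto

lemma mult_subset_with_powers:
  assumes "mult_subset R S" "x \<in> carrier R"
  shows "mult_subset R (with_powers S x)" "S \<subseteq> with_powers S x" "x \<in> with_powers S x"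
proof -
  interpret S: mult_subset R S by fact
  note [simp] = assms(2)
  show sub: "S \<subseteq> with_powers S x"
    using with_powersI[where n = 0 and x = x and S = S] by fastforce
  show "x \<in> with_powers S x"
    using with_powersI[OF S.S_one, of x 1] by simp
  show "mult_subset R (with_powers S x)"
  proof
    show "with_powers S x \<subseteq> carrier R" by (auto elim!: with_powersE)
    show "\<one> \<in> with_powers S x" using S.S_one sub by blast
    fix a b assume ab: "a \<in> with_powers S x" "b \<in> with_powers S x"
    obtain s and n :: nat where a: "s \<in> S" "a = s \<otimes> x [^] n" using ab(1) by (rule with_powersE)
    obtain t and m :: nat where b: "t \<in> S" "b = t \<otimes> x [^] m" using ab(2) by (rule with_powersE)
    have "a \<otimes> b = (s \<otimes> t) \<otimes> x [^] (n + m)"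
      using a b by (simp add: m_ac nat_pow_mult[symmetric])
    then show "a \<otimes> b \<in> with_powers S x" using with_powersI[OF S.S_mult[OF a(1) b(1)]] by simp
  qed
qed

text \<open>The contraction to R of the extension of \<open>I\<close> to the localization at
  \<open>S\<close>. Ideals with \<open>saturation S I \<subseteq> I\<close> stand for the ideals of
  that localization.\<close>

definition saturation :: "'a set \<Rightarrow> 'a set \<Rightarrow> 'a set"
  where "saturation S I = {a \<in> carrier R. \<exists>s\<in>S. s \<otimes> a \<in> I}"

lemma saturation_mono: "I \<subseteq> K \<Longrightarrow> saturation S I \<subseteq> saturation S K"
  unfolding saturation_def by blast

lemma saturation_superset:
  assumes "mult_subset R S" "ideal I R"
  shows "I \<subseteq> saturation S I"
  using ideal_closed(1)[OF assms(2)] mult_subset.S_one[OF assms(1)]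
  by (force simp: saturation_def)

lemma ideal_saturation:
  assumes "mult_subset R S" "ideal I R"
  shows "ideal (saturation S I) R"
proof (rule idealI')
  interpret S: mult_subset R S by fact
  note I = ideal_closed[OF assms(2)]
  show "saturation S I \<subseteq> carrier R" by (auto simp: saturation_def)
  show "\<zero> \<in> saturation S I" using saturation_superset[OF assms] I by blast
  show "a \<oplus> b \<in> saturation S I" if ab: "a \<in> saturation S I" "b \<in> saturation S I" for a b
  proof -
    obtain s t where st: "s \<in> S" "t \<in> S" "s \<otimes> a \<in> I" "t \<otimes> b \<in> I" and [simp]: "a \<in> carrier R" "b \<in> carrier R"
      using ab unfolding saturation_def by blast
    note [simp] = S.S_carrier[OF st(1)] S.S_carrier[OF st(2)]
    have "(s \<otimes> t) \<otimes> (a \<oplus> b) = t \<otimes> (s \<otimes> a) \<oplus> s \<otimes> (t \<otimes> b)"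
      by (simp add: r_distr m_ac)
    then have "(s \<otimes> t) \<otimes> (a \<oplus> b) \<in> I" using I st by simp
    then show ?thesis using S.S_mult[OF st(1,2)] by (auto simp: saturation_def)
  qed
  show "r \<otimes> a \<in> saturation S I" if ar: "a \<in> saturation S I" "r \<in> carrier R" for a r
  proof -
    obtain s where st: "s \<in> S" "s \<otimes> a \<in> I" and [simp]: "a \<in> carrier R"
      using ar unfolding saturation_def by blast
    note [simp] = S.S_carrier[OF st(1)] ar(2)
    have "s \<otimes> (r \<otimes> a) = r \<otimes> (s \<otimes> a)" by (simp add: m_ac)
    then have "s \<otimes> (r \<otimes> a) \<in> I" using I st by simp
    then show ?thesis using st by (auto simp: saturation_def)
  qed
qed

lemma saturation_idem:
  assumes "mult_subset R S"
  shows "saturation S (saturation S I) \<subseteq> saturation S I"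
proof
  interpret S: mult_subset R S by fact
  fix a assume "a \<in> saturation S (saturation S I)"
  then obtain s t where st: "s \<in> S" "t \<in> S" "t \<otimes> (s \<otimes> a) \<in> I" and [simp]: "a \<in> carrier R"
    unfolding saturation_def by blast
  have "(t \<otimes> s) \<otimes> a \<in> I" using st by (simp add: m_assoc)
  then show "a \<in> saturation S I" using S.S_mult[OF st(2,1)] by (auto simp: saturation_def)
qed

lemma saturationD:
  assumes "saturation S I \<subseteq> I" "s \<in> S" "a \<in> carrier R" "s \<otimes> a \<in> I"
  shows "a \<in> I"
  using assms unfolding saturation_def by blast

end

section \<open>Existence of primes and Nakayama's lemma in a Noetherian ring\<close>

context noetherian_cring
begin

lemma exists_maximal_ideal_in:
  assumes "F \<noteq> {}" "\<And>I. I \<in> F \<Longrightarrow> ideal I R"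
  shows "\<exists>M\<in>F. \<forall>I\<in>F. M \<subseteq> I \<longrightarrow> I = M"
proof (rule subset_Zorn_nonempty[OF assms(1)])
  fix C assume C: "C \<noteq> {}" "subset.chain F C"
  then have "subset.chain {I. ideal I R} C" using assms(2) by (auto simp: subset_chain_def)
  then have "\<Union>C \<in> C" using ideal_chain_is_trivial C(1) by blast
  then show "\<Union>C \<in> F" using C(2) by (auto simp: subset_chain_def)
qed

text \<open>An ideal maximal among those that contain \<open>I\<close> and miss \<open>S\<close> is
  prime: two elements outside it whose product lies inside would yield two elements of
  \<open>S\<close> whose product lies in the ideal.\<close>

lemma exists_primeideal_disjoint:
  assumes "mult_subset R S" "ideal I R" "I \<inter> S = {}"
  obtains q where "primeideal q R" "I \<subseteq> q" "q \<inter> S = {}"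
proof -
  interpret S: mult_subset R S by fact
  let ?F = "{q. ideal q R \<and> I \<subseteq> q \<and> q \<inter> S = {}}"
  have "?F \<noteq> {}" using assms by blast
  then have "\<exists>q\<in>?F. \<forall>J\<in>?F. q \<subseteq> J \<longrightarrow> J = q"
    by (rule exists_maximal_ideal_in) simp
  then obtain q where q: "q \<in> ?F" "\<forall>J\<in>?F. q \<subseteq> J \<longrightarrow> J = q"
    by (rule bexE)
  have iq: "ideal q R" and Iq: "I \<subseteq> q" and qS: "q \<inter> S = {}" using q(1) by auto
  note qc = ideal_closed[OF iq]
  have meet: "\<exists>s\<in>S. \<exists>i\<in>q. \<exists>r\<in>carrier R. s = i \<oplus> r \<otimes> a" if "a \<in> carrier R" "a \<notin> q" for a
  proof (rule ccontr)
    assume neg: "\<not> ?thesis"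
    then have "adjoin q a \<inter> S = {}" unfolding adjoin_def by blast
    then have "adjoin q a \<in> ?F"
      using ideal_adjoin[OF iq that(1)] adjoin_superset[OF iq that(1)] Iq by blast
    then have "adjoin q a = q" using q(2) adjoin_superset[OF iq that(1)] by blast
    then show False using adjoin_superset[OF iq that(1)] that(2) by blast
  qed
  have "primeideal q R"
  proof (rule primeidealI[OF iq is_cring])
    show "carrier R \<noteq> q" using qS S.S_one by blast
    fix a b assume ab: "a \<in> carrier R" "b \<in> carrier R" "a \<otimes> b \<in> q"
    show "a \<in> q \<or> b \<in> q"
    proof (rule ccontr)
      assume neg: "\<not> ?thesis"
      then obtain s i r where s: "s \<in> S" "i \<in> q" "r \<in> carrier R" "s = i \<oplus> r \<otimes> a"
        using meet[of a] ab by blast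
      obtain t j u where t: "t \<in> S" "j \<in> q" "u \<in> carrier R" "t = j \<oplus> u \<otimes> b"
        using meet[of b] ab neg by blast
      note [simp] = ab(1,2) s(3) t(3) qc(1)[OF s(2)] qc(1)[OF t(2)]
      have "s \<otimes> t = (j \<oplus> u \<otimes> b) \<otimes> i \<oplus> (r \<otimes> a) \<otimes> j \<oplus> (r \<otimes> u) \<otimes> (a \<otimes> b)"
        unfolding s(4) t(4) by (simp add: l_distr r_distr a_ac m_ac)
      also have "\<dots> \<in> q" using qc s t ab by simp
      finally show False using S.S_mult[OF s(1) t(1)] qS by blast
    qed
  qed
  then show ?thesis using that Iq qS by blast
qed

text \<open>If no power of x lay in \<open>I\<close>, some prime over \<open>I\<close> would avoid
  all powers of x.\<close>

lemma pow_mem_if_in_primes: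
  assumes "ideal I R" "x \<in> carrier R" "\<And>q. \<lbrakk>primeideal q R; I \<subseteq> q\<rbrakk> \<Longrightarrow> x \<in> q"
  shows "\<exists>n::nat. x [^] n \<in> I"
proof (rule ccontr)
  assume neg: "\<not> (\<exists>n::nat. x [^] n \<in> I)"
  have "mult_subset R {\<one>}" by unfold_locales auto
  note S = mult_subset_with_powers[OF this assms(2)]
  have "t \<notin> I" if t: "t \<in> with_powers {\<one>} x" for t
    using t neg assms(2) by (auto elim!: with_powersE)
  then have "I \<inter> with_powers {\<one>} x = {}" by blast
  then obtain q where q: "primeideal q R" "I \<subseteq> q" "q \<inter> with_powers {\<one>} x = {}"
    by (rule exists_primeideal_disjoint[OF S(1) assms(1)])
  then show False using assms(3)[OF q(1,2)] S(3) by blast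
qed

text \<open>The ascending chain condition supplies a maximal saturated ideal \<open>L\<close> over
  \<open>K\<close> that fails to contain \<open>J\<close>, and an element of \<open>J\<close>
  outside \<open>L\<close> is then shown to be in \<open>L\<close>. As \<open>J\<close> is a mere
  set, sets of coefficients qualify directly.\<close>

lemma nakayama:
  assumes P: "primeideal P R" and x: "x \<in> P" and K: "ideal K R" and J: "J \<subseteq> carrier R"
    and step: "\<And>a. a \<in> J \<Longrightarrow> \<exists>s\<in>carrier R - P. \<exists>k\<in>K. \<exists>j\<in>J. s \<otimes> a = k \<oplus> x \<otimes> j"
  shows "J \<subseteq> saturation (carrier R - P) K"
proof (rule ccontr)
  let ?S = "carrier R - P"
  assume neg: "\<not> ?thesis"
  note S = mult_subset_compl[OF P]
  interpret S: mult_subset R ?S by fact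
  let ?F = "{L. ideal L R \<and> saturation ?S L \<subseteq> L \<and> K \<subseteq> L \<and> \<not> J \<subseteq> L}"
  have "saturation ?S K \<in> ?F"
    using ideal_saturation[OF S K] saturation_idem[OF S] saturation_superset[OF S K] neg by blast
  then have "?F \<noteq> {}" by blast
  then have "\<exists>L\<in>?F. \<forall>I\<in>?F. L \<subseteq> I \<longrightarrow> I = L"
    by (rule exists_maximal_ideal_in) simp
  then obtain L where L: "L \<in> ?F" "\<forall>I\<in>?F. L \<subseteq> I \<longrightarrow> I = L"
    by (rule bexE)
  then have iL: "ideal L R" "saturation ?S L \<subseteq> L" "K \<subseteq> L" "\<not> J \<subseteq> L" by auto
  note Lc = ideal_closed[OF iL(1)]
  note Pi = primeideal_closed(1)[OF P]
  note Pc = ideal_closed[OF Pi]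
  obtain a where a: "a \<in> J" "a \<notin> L" using iL(4) by blast
  have [simp]: "a \<in> carrier R" "x \<in> carrier R" using a J x Pc by auto
  let ?L' = "saturation ?S (adjoin L a)"
  have id: "ideal (adjoin L a) R" by (rule ideal_adjoin[OF iL(1)]) simp
  have sub: "adjoin L a \<subseteq> ?L'" by (rule saturation_superset[OF S id])
  have LL': "L \<subseteq> ?L'" "a \<in> ?L'" using sub adjoin_superset[OF iL(1), of a] by auto
  \<comment> \<open>\<open>?L'\<close> is saturated and strictly larger than \<open>L\<close>, so
    maximality of \<open>L\<close> forces it to contain \<open>J\<close>.\<close>
  have "J \<subseteq> ?L'"
  proof (rule ccontr)
    assume "\<not> J \<subseteq> ?L'"
    then have "?L' \<in> ?F" using ideal_saturation[OF S id] saturation_idem[OF S] LL' iL(3) by blast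
    then have "?L' = L" using L(2) LL'(1) by blast
    then show False using LL'(2) a(2) by simp
  qed
  obtain s k j where s: "s \<in> ?S" "k \<in> K" "j \<in> J" "s \<otimes> a = k \<oplus> x \<otimes> j" using step[OF a(1)] by blast
  obtain t where t: "t \<in> ?S" "t \<otimes> j \<in> adjoin L a" using \<open>J \<subseteq> ?L'\<close> s(3) unfolding saturation_def by blast
  obtain l r where l: "l \<in> L" "r \<in> carrier R" "t \<otimes> j = l \<oplus> r \<otimes> a" using adjoinE[OF t(2)] by metis
  have kL: "k \<in> L" using s iL by blast
  have mem [simp]: "a \<in> carrier R" "x \<in> carrier R" "s \<in> carrier R" "t \<in> carrier R" "k \<in> carrier R" "j \<in> carrier R" "l \<in> carrier R" "r \<in> carrier R"
    using s t l J Lc(1) kL by auto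
  \<comment> \<open>The determinant trick with one generator: modulo \<open>L\<close>,
    \<open>t s a = x t j = x r a\<close>, and \<open>t s - x r\<close> is outside P because x is in
    P.\<close>
  have "(t \<otimes> s \<ominus> x \<otimes> r) \<otimes> a = t \<otimes> (s \<otimes> a) \<ominus> x \<otimes> (r \<otimes> a)"
    using mem by algebra
  also have "\<dots> = t \<otimes> k \<oplus> x \<otimes> (t \<otimes> j) \<ominus> x \<otimes> (r \<otimes> a)"
    unfolding s(4) using mem by algebra
  also have "\<dots> = t \<otimes> k \<oplus> x \<otimes> l"
    unfolding l(3) using mem by algebra
  also have "\<dots> \<in> L" using Lc kL l by simp
  finally have m: "(t \<otimes> s \<ominus> x \<otimes> r) \<otimes> a \<in> L" .
  have "t \<otimes> s \<ominus> x \<otimes> r \<notin> P"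
  proof
    assume "t \<otimes> s \<ominus> x \<otimes> r \<in> P"
    then have "(t \<otimes> s \<ominus> x \<otimes> r) \<oplus> x \<otimes> r \<in> P" using Pc x l by simp
    moreover have "(t \<otimes> s \<ominus> x \<otimes> r) \<oplus> x \<otimes> r = t \<otimes> s" using mem by algebra
    ultimately show False using S.S_mult[OF t(1) s(1)] by simp
  qed
  then have "a \<in> L" using saturationD[OF iL(2) _ _ m] by simp
  then show False using a(2) by simp
qed

end

section \<open>Krull's principal ideal theorem\<close>

context noetherian_cring
begin

text \<open>The localization of R/I0 at P has a single prime, hence is Artinian. The proof is a
  Noetherian induction on the lower bound of the chain: \<open>I\<close> is maximal among the
  saturated ideals over \<open>I0\<close> that have an unstable chain above them.\<close>

lemma saturated_chain_stable:
  assumes P: "primeideal P R" and I0: "ideal I0 R"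
    and only: "\<And>q. \<lbrakk>primeideal q R; I0 \<subseteq> q; q \<subseteq> P\<rbrakk> \<Longrightarrow> q = P"
    and F: "\<And>n::nat. ideal (F n) R" "\<And>n. saturation (carrier R - P) (F n) \<subseteq> F n"
      "\<And>n. I0 \<subseteq> F n" "\<And>n. F (Suc n) \<subseteq> F n"
  shows "\<exists>N. \<forall>n\<ge>N. F n = F N"
proof (rule ccontr)
  let ?S = "carrier R - P"
  define stable :: "(nat \<Rightarrow> 'a set) \<Rightarrow> bool" where "stable F \<longleftrightarrow> (\<exists>N. \<forall>n\<ge>N. F n = F N)" for F
  define chain where "chain I F \<longleftrightarrow> (\<forall>n::nat. ideal (F n) R \<and> saturation ?S (F n) \<subseteq> F n \<and>
    I \<subseteq> F n \<and> F (Suc n) \<subseteq> F n)" for I F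
  let ?B = "{I. ideal I R \<and> saturation ?S I \<subseteq> I \<and> I0 \<subseteq> I \<and> (\<exists>F. chain I F \<and> \<not> stable F)}"
  assume neg: "\<not> ?thesis"
  note S = mult_subset_compl[OF P]
  interpret S: mult_subset R ?S by fact
  have "saturation ?S I0 \<subseteq> F n" for n
    using saturation_mono[OF F(3)] F(2) by blast
  then have "chain (saturation ?S I0) F" "\<not> stable F"
    using F neg by (auto simp: chain_def stable_def)
  then have "saturation ?S I0 \<in> ?B"
    using ideal_saturation[OF S I0] saturation_idem[OF S] saturation_superset[OF S I0] by blast
  then have "\<exists>I\<in>?B. \<forall>L\<in>?B. I \<subseteq> L \<longrightarrow> L = I"
    by (intro exists_maximal_ideal_in) auto
  then obtain I where I: "I \<in> ?B" and Imax: "\<forall>L\<in>?B. I \<subseteq> L \<longrightarrow> L = I"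
    by (rule bexE)
  have iI: "ideal I R" and sI: "saturation ?S I \<subseteq> I" and I0I: "I0 \<subseteq> I" using I by auto
  obtain F where cF: "chain I F" and nF: "\<not> stable F" using I by auto
  have G: "ideal (F n) R" "saturation ?S (F n) \<subseteq> F n" "I \<subseteq> F n" "F (Suc n) \<subseteq> F n" for n
    using cF by (auto simp: chain_def)
  have anti: "F n \<subseteq> F k" if "k \<le> n" for k n
    using lift_Suc_antimono_le[of F, OF G(4) that] by blast
  note Ic = ideal_closed[OF iI]
  have one: "\<one> \<notin> I"
  proof
    assume "\<one> \<in> I"
    then have "F n = carrier R" for n
      using G(3)[of n] ideal.one_imp_carrier[OF G(1)] by blast
    then show False using nF by (simp add: stable_def)
  qed
  \<comment> \<open>A maximal \<open>(I : z)\<close> with z outside \<open>I\<close> is prime, an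
    associated prime of R/I. As it contains \<open>I0\<close> and lies in P, it can only be
    P.\<close>
  define colon where "colon z = {r \<in> carrier R. r \<otimes> z \<in> I}" for z
  have colon_ideal: "ideal (colon z) R" if "z \<in> carrier R" for z
    using that Ic by (intro idealI') (auto simp: colon_def l_distr m_assoc)
  have "\<exists>C\<in>colon ` (carrier R - I). \<forall>L\<in>colon ` (carrier R - I). C \<subseteq> L \<longrightarrow> L = C"
    by (rule exists_maximal_ideal_in) (use one colon_ideal in auto)
  then obtain C where C: "C \<in> colon ` (carrier R - I)"
    and Cmax: "\<forall>L\<in>colon ` (carrier R - I). C \<subseteq> L \<longrightarrow> L = C"
    by (rule bexE)
  obtain z where z: "z \<in> carrier R" "z \<notin> I" "C = colon z" using C by blast
  note [simp] = z(1)
  have "primeideal C R"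
  proof (rule primeidealI)
    show "ideal C R" unfolding z(3) by (rule colon_ideal) simp
    show "cring R" by (rule is_cring)
    have "\<one> \<notin> C" using z by (simp add: colon_def)
    then show "carrier R \<noteq> C" by blast
    fix a b assume ab: "a \<in> carrier R" "b \<in> carrier R" "a \<otimes> b \<in> C"
    note [simp] = ab(1,2)
    show "a \<in> C \<or> b \<in> C"
    proof (cases "b \<in> C")
      case False
      then have bz: "b \<otimes> z \<in> carrier R - I" by (simp add: z(3) colon_def)
      have "C \<subseteq> colon (b \<otimes> z)"
      proof
        fix c assume "c \<in> C"
        then have c: "c \<in> carrier R" "c \<otimes> z \<in> I" by (auto simp: z(3) colon_def)
        have "c \<otimes> (b \<otimes> z) = b \<otimes> (c \<otimes> z)" using c(1) by (simp add: m_ac)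
        then show "c \<in> colon (b \<otimes> z)" using Ic(6)[OF c(2), of b] c(1) by (simp add: colon_def)
      qed
      then have "colon (b \<otimes> z) = C" using bspec[OF Cmax imageI[OF bz]] by simp
      moreover have "a \<in> colon (b \<otimes> z)" using ab(3) by (simp add: z(3) colon_def m_assoc)
      ultimately show ?thesis by blast
    qed simp
  qed
  moreover have "I0 \<subseteq> C" using I0I Ic by (auto simp: z(3) colon_def)
  moreover have "C \<subseteq> P"
  proof
    fix s assume "s \<in> C"
    then have s: "s \<in> carrier R" "s \<otimes> z \<in> I" by (auto simp: z(3) colon_def)
    show "s \<in> P"
    proof (rule ccontr)
      assume "s \<notin> P"
      then have "z \<in> I" using saturationD[OF sI _ z(1) s(2)] s(1) by blast
      then show False using z(2) by simp
    qed
  qed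
  ultimately have CP: "C = P" using only by blast
  have iA: "ideal (adjoin I z) R" by (rule ideal_adjoin[OF iI]) simp
  let ?I' = "saturation ?S (adjoin I z)"
  have AI': "adjoin I z \<subseteq> ?I'" by (rule saturation_superset[OF S iA])
  have II': "I \<subseteq> ?I'" "z \<in> ?I'" using AI' adjoin_superset[OF iI, of z] by auto
  have stab: "stable L" if "chain ?I' L" for L
  proof (rule ccontr)
    assume "\<not> stable L"
    then have "\<exists>F. chain ?I' F \<and> \<not> stable F" using that by blast
    moreover have "I0 \<subseteq> ?I'" using I0I II'(1) by simp
    ultimately have "?I' \<in> ?B"
      using ideal_saturation[OF S iA] saturation_idem[OF S, of "adjoin I z"] by simp
    then have "?I' = I" using bspec[OF Imax] II'(1) by simp
    then show False using II'(2) z(2) by simp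
  qed
  \<comment> \<open>If z were in every member, the chain would live above \<open>?I'\<close>, where
    all chains are stable.\<close>
  have "\<exists>k. z \<notin> F k"
  proof (rule ccontr)
    assume "\<not> (\<exists>k. z \<notin> F k)"
    then have "adjoin I z \<subseteq> F n" for n using adjoin_subset[OF G(1) G(3)] by blast
    then have "?I' \<subseteq> F n" for n using saturation_mono[of "adjoin I z" "F n" ?S] G(2)[of n] by blast
    then have "chain ?I' F" using G by (simp add: chain_def)
    then show False using stab nF by blast
  qed
  then obtain k where k: "z \<notin> F k" by blast
  \<comment> \<open>The chain taken modulo z lives above \<open>?I'\<close> and is stable. What it
    fails to see is \<open>(I + (z)) / I\<close>, which is killed by P.\<close>
  define E where "E n = saturation ?S (adjoin (F n) z)" for n
  have "chain ?I' E"
    unfolding chain_def E_def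
    using ideal_saturation[OF S ideal_adjoin[OF G(1) z(1)]] saturation_idem[OF S]
      saturation_mono[OF adjoin_mono[OF G(3)]] saturation_mono[OF adjoin_mono[OF G(4)]]
    by blast
  then obtain m where m: "\<And>n. n \<ge> m \<Longrightarrow> E n = E m" using stab unfolding stable_def by blast
  let ?N = "max k m"
  have "F n = F ?N" if n: "n \<ge> ?N" for n
  proof
    show "F n \<subseteq> F ?N" by (rule anti[OF n])
    show "F ?N \<subseteq> F n"
    proof
      note Fc = ideal_closed[OF G(1)[of n]] and Nc = ideal_closed[OF G(1)[of ?N]]
      fix w assume w: "w \<in> F ?N"
      have "w \<in> adjoin (F ?N) z" using adjoin_superset(1)[OF G(1), of z ?N] w by auto
      then have "w \<in> E ?N"
        unfolding E_def using saturation_superset[OF S ideal_adjoin[OF G(1)[of ?N]], of z] by auto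
      also have "E ?N = E n" using m[of n] m[of ?N] n by simp
      finally obtain s where s: "s \<in> ?S" "s \<otimes> w \<in> adjoin (F n) z"
        unfolding E_def saturation_def by blast
      obtain f r where f: "f \<in> F n" "r \<in> carrier R" "s \<otimes> w = f \<oplus> r \<otimes> z"
        using s(2) by (rule adjoinE)
      have mem: "s \<in> carrier R" "w \<in> carrier R" "f \<in> carrier R" "r \<in> carrier R" "z \<in> carrier R"
        using s f w Nc(1) Fc(1) z by auto
      have fN: "f \<in> F ?N" using anti[OF n] f(1) by blast
      have "r \<otimes> z = (f \<oplus> r \<otimes> z) \<ominus> f" using mem by algebra
      also have "\<dots> = s \<otimes> w \<ominus> f" by (simp add: f(3))
      also have "\<dots> \<in> F ?N" using Nc w fN mem by simp
      finally have rz: "r \<otimes> z \<in> F ?N" .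
      \<comment> \<open>By stage \<open>?N\<close> the element z has left the chain, and
        \<open>F ?N\<close> is saturated; so whatever multiplies z into it lies in P, which is
        \<open>(I : z)\<close>.\<close>
      have "r \<in> P"
      proof (rule ccontr)
        assume "r \<notin> P"
        then have "z \<in> F ?N" using saturationD[OF G(2) _ z(1) rz] mem by blast
        then show False using anti[of k ?N] k by auto
      qed
      then have "r \<otimes> z \<in> I" using CP z(3) by (auto simp: colon_def)
      then have "s \<otimes> w \<in> F n" unfolding f(3) using Fc(3)[OF f(1)] G(3) by blast
      then show "w \<in> F n" using saturationD[OF G(2)[of n] s(1)] mem by blast
    qed
  qed
  then show False using nF unfolding stable_def by blast
qed

text \<open>Krull's principal ideal theorem. The ideals \<open>J n\<close> below are the saturations of
  \<open>P0 + (y\<^sup>n)\<close> with respect to \<open>P\<close> and \<open>x\<close>; since \<open>x\<close> is a nonzerodivisor modulo each of them,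
  stability of \<open>J n + (x)\<close> gives \<open>J n = J (n + 1)\<close> by Nakayama, hence \<open>x \<in> \<surd>(P0 + (y))\<close> locally at \<open>P\<close>.\<close>

lemma exists_primeideal_between:
  assumes pr: "primeideal P0 R" "primeideal Q R" "primeideal P R" and sub: "P0 \<subset> Q" "Q \<subset> P"
    and x: "x \<in> P"
  obtains P' where "primeideal P' R" "P0 \<subset> P'" "P' \<subset> P" "x \<in> P'"
proof (rule ccontr)
  assume "\<not> thesis"
  then have none: False if "primeideal q R" "P0 \<subset> q" "q \<subset> P" "x \<in> q" for q
    using that \<open>\<And>P'. \<lbrakk>primeideal P' R; P0 \<subset> P'; P' \<subset> P; x \<in> P'\<rbrakk> \<Longrightarrow> thesis\<close> by blast
  have xQ: "x \<notin> Q" using none[OF pr(2) sub] by blast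
  let ?S = "carrier R - P"
  note S = mult_subset_compl[OF pr(3)]
  interpret S: mult_subset R ?S by fact
  note i0 = primeideal_closed(1)[OF pr(1)] and iQ = primeideal_closed(1)[OF pr(2)]
    and iP = primeideal_closed(1)[OF pr(3)]
  note c0 = ideal_closed[OF i0] and cQ = ideal_closed[OF iQ] and cP = ideal_closed[OF iP]
  have [simp]: "x \<in> carrier R" using x cP by simp
  \<comment> \<open>With the claim negated, P is minimal over \<open>P0 + (x)\<close>, the setting
    of the principal ideal theorem.\<close>
  have only: "q = P" if "primeideal q R" "adjoin P0 x \<subseteq> q" "q \<subseteq> P" for q
  proof -
    have "P0 \<subseteq> q" "x \<in> q" using that(2) adjoin_superset[OF i0, of x] by auto
    then show ?thesis using none[OF that(1)] that(3) xQ sub by blast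
  qed
  obtain y where y: "y \<in> Q" "y \<notin> P0" using sub by blast
  have [simp]: "y \<in> carrier R" using y cQ by simp
  let ?T = "with_powers ?S x"
  have T: "mult_subset R ?T" and ST: "?S \<subseteq> ?T" and xT: "x \<in> ?T"
    by (simp_all add: mult_subset_with_powers[OF S])
  interpret T: mult_subset R ?T by fact
  \<comment> \<open>\<open>Q\<close> survives when x is inverted on top of localizing at P; the
    final contradiction is with this.\<close>
  have disj: "t \<notin> Q" if t: "t \<in> ?T" for t
  proof
    assume "t \<in> Q"
    moreover obtain s and n :: nat where s: "s \<in> ?S" "t = s \<otimes> x [^] n" using t by (rule with_powersE)
    ultimately have "s \<otimes> x [^] n \<in> Q" by simp
    then have "s \<in> Q \<or> x [^] n \<in> Q" using primeideal_closed(3)[OF pr(2), of s "x [^] n"] s(1) by simp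
    moreover have "x [^] n \<notin> Q" using primeideal_pow[OF pr(2), of x n] xQ by auto
    moreover have "s \<notin> Q" using s(1) sub by blast
    ultimately show False by blast
  qed
  define J where "J n = saturation ?T (adjoin P0 (y [^] n))" for n :: nat
  have iA: "ideal (adjoin P0 (y [^] n)) R" for n :: nat by (rule ideal_adjoin[OF i0]) simp
  have iJ: "ideal (J n) R" for n unfolding J_def by (rule ideal_saturation[OF T iA])
  have sJ: "saturation ?T (J n) \<subseteq> J n" for n unfolding J_def by (rule saturation_idem[OF T])
  have AJ: "adjoin P0 (y [^] n) \<subseteq> J n" for n unfolding J_def by (rule saturation_superset[OF T iA])
  have JJ: "J (Suc n) \<subseteq> J n" for n
  proof -
    have "y [^] Suc n \<in> adjoin P0 (y [^] n)"
      using ideal_closed(7)[OF iA adjoin_superset(2)[OF i0], of n y] by simp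
    then have "adjoin P0 (y [^] Suc n) \<subseteq> adjoin P0 (y [^] n)"
      using adjoin_subset[OF iA] adjoin_superset(1)[OF i0, of "y [^] n"] by simp
    then show ?thesis unfolding J_def by (rule saturation_mono)
  qed
  \<comment> \<open>Modulo \<open>P0 + (x)\<close> the localization at P is Artinian, so the images
    of the \<open>J n\<close> there become constant.\<close>
  define F where "F n = saturation ?S (adjoin (J n) x)" for n
  have iF: "ideal (adjoin (J n) x) R" for n by (rule ideal_adjoin[OF iJ]) simp
  have P0J: "P0 \<subseteq> J n" for n using AJ adjoin_superset(1)[OF i0, of "y [^] n"] by auto
  have "\<exists>N. \<forall>n\<ge>N. F n = F N"
  proof (rule saturated_chain_stable[OF pr(3) ideal_adjoin[OF i0] only])
    show "x \<in> carrier R" by simp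
    show "ideal (F n) R" for n unfolding F_def by (rule ideal_saturation[OF S iF])
    show "saturation ?S (F n) \<subseteq> F n" for n unfolding F_def by (rule saturation_idem[OF S])
    show "adjoin P0 x \<subseteq> F n" for n
      unfolding F_def using saturation_superset[OF S iF[of n]] adjoin_mono[OF P0J[of n], of x] by blast
    show "F (Suc n) \<subseteq> F n" for n
      unfolding F_def by (intro saturation_mono adjoin_mono JJ)
  qed
  then obtain N where "F (Suc N) = F N" by (metis le_Suc_eq order_refl)
  then have FN: "J N \<subseteq> F (Suc N)"
    unfolding F_def using saturation_superset[OF S iF[of N]] adjoin_superset(1)[OF iJ, of x N] by auto
  have "J N \<subseteq> saturation ?S (J (Suc N))"
  proof (rule nakayama[OF pr(3) x iJ])
    note cJ = ideal_closed[OF iJ[of N]] and cJ' = ideal_closed[OF iJ[of "Suc N"]]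
    show "J N \<subseteq> carrier R" using cJ by blast
    fix a assume a: "a \<in> J N"
    then obtain s where s: "s \<in> ?S" "s \<otimes> a \<in> adjoin (J (Suc N)) x"
      using FN unfolding F_def saturation_def by blast
    obtain b c where b: "b \<in> J (Suc N)" "c \<in> carrier R" "s \<otimes> a = b \<oplus> c \<otimes> x"
      using s(2) by (rule adjoinE)
    have mem: "s \<in> carrier R" "a \<in> carrier R" "b \<in> carrier R" "c \<in> carrier R" "x \<in> carrier R"
      using s a b cJ cJ' by auto
    have "x \<otimes> c = (b \<oplus> c \<otimes> x) \<ominus> b" using mem by algebra
    also have "\<dots> = s \<otimes> a \<ominus> b" by (simp add: b(3))
    also have "\<dots> \<in> J N" using cJ a mem b(1) JJ[of N] by auto
    finally have "c \<in> J N" using saturationD[OF sJ xT] mem by blast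
    moreover have "s \<otimes> a = b \<oplus> x \<otimes> c" using b(3) mem by (simp add: m_comm)
    ultimately show "\<exists>s\<in>carrier R - P. \<exists>k\<in>J (Suc N). \<exists>j\<in>J N. s \<otimes> a = k \<oplus> x \<otimes> j"
      using s(1) b(1) by blast
  qed
  also have "saturation ?S (J (Suc N)) \<subseteq> saturation ?T (J (Suc N))"
    using ST unfolding saturation_def by blast
  also have "\<dots> \<subseteq> J (Suc N)" by (rule sJ)
  finally have "y [^] N \<in> saturation ?T (adjoin P0 (y [^] Suc N))"
    using AJ[of N] adjoin_superset(2)[OF i0, of "y [^] N"] unfolding J_def by auto
  then obtain t where t: "t \<in> ?T" "t \<otimes> y [^] N \<in> adjoin P0 (y [^] Suc N)"
    unfolding saturation_def by blast
  obtain p c where p: "p \<in> P0" "c \<in> carrier R" "t \<otimes> y [^] N = p \<oplus> c \<otimes> y [^] Suc N"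
    using t(2) by (rule adjoinE)
  have mem: "t \<in> carrier R" "p \<in> carrier R" "c \<in> carrier R" "y \<in> carrier R" "y [^] N \<in> carrier R"
    using T.S_carrier[OF t(1)] p c0 by auto
  \<comment> \<open>Modulo the prime \<open>P0\<close>, which misses y, the factor
    \<open>y^N\<close> cancels from \<open>t y^N = c y^(N+1)\<close>. So t is a multiple of y modulo
    \<open>P0\<close> and falls into \<open>Q\<close>.\<close>
  have "(t \<ominus> c \<otimes> y) \<otimes> y [^] N = t \<otimes> y [^] N \<ominus> c \<otimes> (y [^] N \<otimes> y)"
    using mem by algebra
  also have "\<dots> = (p \<oplus> c \<otimes> (y [^] N \<otimes> y)) \<ominus> c \<otimes> (y [^] N \<otimes> y)" using p(3) by simp
  also have "\<dots> = p" using mem by algebra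
  finally have "(t \<ominus> c \<otimes> y) \<otimes> y [^] N \<in> P0" using p(1) by simp
  then have "t \<ominus> c \<otimes> y \<in> P0"
    using primeideal_closed(3)[OF pr(1), of "t \<ominus> c \<otimes> y" "y [^] N"] primeideal_pow[OF pr(1), of y N] y mem
    by (metis minus_closed m_closed)
  then have "t \<ominus> c \<otimes> y \<in> Q" using sub by blast
  then have "(t \<ominus> c \<otimes> y) \<oplus> c \<otimes> y \<in> Q" using cQ y p by simp
  also have "(t \<ominus> c \<otimes> y) \<oplus> c \<otimes> y = t" using mem by algebra
  finally show False using disj t(1) by blast
qed

end

section \<open>Regular local rings and regular sequences\<close>

sublocale noetherian_local_ring \<subseteq> noetherian_cring R by unfold_locales

section \<open>Regular sequences modulo an ideal\<close>

context cring
begin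

definition prime_chain :: "(nat \<Rightarrow> 'a set) \<Rightarrow> nat \<Rightarrow> bool"
  where "prime_chain P n \<longleftrightarrow> (\<forall>i\<le>n. primeideal (P i) R) \<and> (\<forall>i<n. P i \<subset> P (Suc i))"

lemma adjoin_swap_subset:
  assumes "ideal I R" "x \<in> carrier R" "y \<in> carrier R"
  shows "adjoin (adjoin I x) y \<subseteq> adjoin (adjoin I y) x"
proof -
  note Ix = ideal_adjoin[OF assms(1,2)] and Iy = ideal_adjoin[OF assms(1,3)]
  note Iyx = ideal_adjoin[OF Iy assms(2)]
  have "adjoin I x \<subseteq> adjoin (adjoin I y) x"
    by (intro adjoin_mono adjoin_superset assms)
  moreover have "y \<in> adjoin (adjoin I y) x"
    using adjoin_superset(1)[OF Iy assms(2)] adjoin_superset(2)[OF assms(1,3)] by blast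
  ultimately show ?thesis by (rule adjoin_subset[OF Iyx])
qed

lemma adjoin_swap:
  assumes "ideal I R" "x \<in> carrier R" "y \<in> carrier R"
  shows "adjoin (adjoin I x) y = adjoin (adjoin I y) x"
  using adjoin_swap_subset assms by blast

definition nonzerodivisor_mod :: "'a set \<Rightarrow> 'a \<Rightarrow> bool"
  where "nonzerodivisor_mod I x \<longleftrightarrow> (\<forall>a\<in>carrier R. x \<otimes> a \<in> I \<longrightarrow> a \<in> I)"

lemma nonzerodivisorD:
  "\<lbrakk>nonzerodivisor_mod I x; x \<otimes> a \<in> I; a \<in> carrier R\<rbrakk> \<Longrightarrow> a \<in> I"
  unfolding nonzerodivisor_mod_def by blast

text \<open>Weakly regular on R/I: the generated ideal may be all of R, which admits the exponent 0
  in \<open>regular_sequence_power\<close>.\<close>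

primrec regular_sequence :: "'a set \<Rightarrow> 'a list \<Rightarrow> bool"
  where "regular_sequence I [] \<longleftrightarrow> True"
  | "regular_sequence I (y # ys) \<longleftrightarrow> nonzerodivisor_mod I y \<and> regular_sequence (adjoin I y) ys"

text \<open>Since x is a nonzerodivisor modulo \<open>I\<close>, the powers of x filter R/(I +
  (x^n)) with steps that are copies of R/(I + (x)), and on each step y is a nonzerodivisor.\<close>

lemma nonzerodivisor_mod_power:
  assumes I: "ideal I R" and [simp]: "x \<in> carrier R" "y \<in> carrier R"
    and x: "nonzerodivisor_mod I x" and y: "nonzerodivisor_mod (adjoin I x) y"
  shows "nonzerodivisor_mod (adjoin I (x [^] (n::nat))) y"
proof (induction n)
  case 0
  have "adjoin I \<one> = carrier R"
    using ideal.one_imp_carrier[OF ideal_adjoin[OF I]] adjoin_superset(2)[OF I] by simp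
  then show ?case by (simp add: nonzerodivisor_mod_def)
next
  case (Suc n)
  note Ic = ideal_closed[OF I]
  show ?case unfolding nonzerodivisor_mod_def
  proof (intro ballI impI)
    fix c assume c: "c \<in> carrier R" "y \<otimes> c \<in> adjoin I (x [^] Suc n)"
    note ix = ideal_adjoin[OF I \<open>x \<in> carrier R\<close>] and in' = ideal_adjoin[OF I, of "x [^] n"]
    obtain i r where i: "i \<in> I" "r \<in> carrier R" "y \<otimes> c = i \<oplus> r \<otimes> x [^] Suc n"
      using c(2) by (rule adjoinE)
    have "i \<oplus> (r \<otimes> x [^] n) \<otimes> x \<in> adjoin I x" using i by (intro adjoinI) auto
    then have "y \<otimes> c \<in> adjoin I x" using i by (simp add: m_assoc)
    then have "c \<in> adjoin I x" using nonzerodivisorD[OF y] c(1) by blast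
    then obtain j d where j: "j \<in> I" "d \<in> carrier R" "c = j \<oplus> d \<otimes> x" by (rule adjoinE)
    have mem: "i \<in> carrier R" "j \<in> carrier R" "r \<in> carrier R" "d \<in> carrier R" "x \<in> carrier R"
      "y \<in> carrier R" "x [^] n \<in> carrier R"
      using i j Ic by auto
    \<comment> \<open>One factor x is cancelled: with \<open>c = j + d x\<close>, the claim for c
      and n + 1 becomes the claim for d and n.\<close>
    have "x \<otimes> (y \<otimes> d \<ominus> r \<otimes> x [^] n) = y \<otimes> (j \<oplus> d \<otimes> x) \<ominus> y \<otimes> j \<ominus> r \<otimes> (x [^] n \<otimes> x)"
      using mem by algebra
    also have "\<dots> = (i \<oplus> r \<otimes> (x [^] n \<otimes> x)) \<ominus> y \<otimes> j \<ominus> r \<otimes> (x [^] n \<otimes> x)"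
      using i(3) j(3) by simp
    also have "\<dots> = i \<ominus> y \<otimes> j" using mem by algebra
    also have "\<dots> \<in> I" using Ic i j by simp
    finally have "x \<otimes> (y \<otimes> d \<ominus> r \<otimes> x [^] n) \<in> I" .
    then have k: "y \<otimes> d \<ominus> r \<otimes> x [^] n \<in> I"
      by (rule nonzerodivisorD[OF x]) (simp add: mem)
    have "y \<otimes> d = (y \<otimes> d \<ominus> r \<otimes> x [^] n) \<oplus> r \<otimes> x [^] n" using mem by algebra
    then have "y \<otimes> d \<in> adjoin I (x [^] n)" using adjoinI[OF k, of r "x [^] n"] mem by simp
    then have "d \<in> adjoin I (x [^] n)" by (rule nonzerodivisorD[OF Suc.IH]) (rule mem)
    then obtain l e where l: "l \<in> I" "e \<in> carrier R" "d = l \<oplus> e \<otimes> x [^] n" by (rule adjoinE)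
    have "l \<in> carrier R" using l Ic by simp
    then have "c = (j \<oplus> x \<otimes> l) \<oplus> e \<otimes> (x [^] n \<otimes> x)"
      unfolding j(3) l(3) using mem l(2) by algebra
    then show "c \<in> adjoin I (x [^] Suc n)"
      using adjoinI[of "j \<oplus> x \<otimes> l" I e "x [^] Suc n"] Ic j l mem by simp
  qed
qed

text \<open>This half of the exchange of x and y holds over every ring; it is the half that lets y
  move in front of x in \<open>regular_sequence_power\<close>.\<close>

lemma nonzerodivisor_mod_adjoin:
  assumes I: "ideal I R" and [simp]: "x \<in> carrier R" "y \<in> carrier R"
    and x: "nonzerodivisor_mod I x" and y: "nonzerodivisor_mod (adjoin I x) y"
  shows "nonzerodivisor_mod (adjoin I y) x"
  unfolding nonzerodivisor_mod_def
proof (intro ballI impI)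
  note Ic = ideal_closed[OF I]
  fix t assume t: "t \<in> carrier R" "x \<otimes> t \<in> adjoin I y"
  obtain i g where i: "i \<in> I" "g \<in> carrier R" "x \<otimes> t = i \<oplus> g \<otimes> y" using t(2) by (rule adjoinE)
  have mem: "i \<in> carrier R" "g \<in> carrier R" "t \<in> carrier R" "x \<in> carrier R" "y \<in> carrier R"
    using i t Ic by auto
  have "y \<otimes> g = (\<ominus> i) \<oplus> ((i \<oplus> g \<otimes> y))" using mem by algebra
  also have "\<dots> = (\<ominus> i) \<oplus> t \<otimes> x" using i(3) mem by (simp add: m_comm)
  also have "\<dots> \<in> adjoin I x" using Ic i mem by (intro adjoinI) auto
  finally have "y \<otimes> g \<in> adjoin I x" .
  then have "g \<in> adjoin I x" by (rule nonzerodivisorD[OF y]) (rule mem)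
  then obtain j h where j: "j \<in> I" "h \<in> carrier R" "g = j \<oplus> h \<otimes> x" by (rule adjoinE)
  have mem': "j \<in> carrier R" "h \<in> carrier R" using j Ic by auto
  have "x \<otimes> (t \<ominus> h \<otimes> y) = x \<otimes> t \<ominus> (j \<oplus> h \<otimes> x) \<otimes> y \<oplus> j \<otimes> y" using mem mem' by algebra
  also have "\<dots> = (i \<oplus> g \<otimes> y) \<ominus> g \<otimes> y \<oplus> j \<otimes> y" using i(3) j(3) by simp
  also have "\<dots> = i \<oplus> j \<otimes> y" using mem mem' by algebra
  also have "\<dots> \<in> I" using Ic i j mem by simp
  finally have "x \<otimes> (t \<ominus> h \<otimes> y) \<in> I" .
  then have k: "t \<ominus> h \<otimes> y \<in> I" by (rule nonzerodivisorD[OF x]) (simp add: mem mem')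
  have "t = (t \<ominus> h \<otimes> y) \<oplus> h \<otimes> y" using mem mem' by algebra
  then show "t \<in> adjoin I y" using adjoinI[OF k mem'(2), of y] by simp
qed

text \<open>The power can be adjoined last: \<open>adjoin_swap\<close> moves y in front of x, where
  x remains a nonzerodivisor modulo \<open>I + (y)\<close>, and the induction continues over that
  ideal.\<close>

lemma regular_sequence_power:
  assumes "ideal I R" "x \<in> carrier R" "set ys \<subseteq> carrier R"
    and "nonzerodivisor_mod I x" "regular_sequence (adjoin I x) ys"
  shows "regular_sequence (adjoin I (x [^] (n::nat))) ys"
  using assms
proof (induction ys arbitrary: I)
  case (Cons y ys)
  note I = Cons.prems(1) and [simp] = Cons.prems(2)
  have [simp]: "y \<in> carrier R" using Cons.prems by simp
  have y: "nonzerodivisor_mod (adjoin I x) y" using Cons.prems by simp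
  have "regular_sequence (adjoin (adjoin I y) (x [^] n)) ys"
  proof (rule Cons.IH)
    show "nonzerodivisor_mod (adjoin I y) x"
      using nonzerodivisor_mod_adjoin[OF I _ _ Cons.prems(4) y] by simp
    show "regular_sequence (adjoin (adjoin I y) x) ys"
      using Cons.prems(5) adjoin_swap[OF I, of x y] by simp
  qed (use Cons.prems ideal_adjoin[OF I] in auto)
  moreover have "nonzerodivisor_mod (adjoin I (x [^] n)) y"
    by (rule nonzerodivisor_mod_power[OF I _ _ Cons.prems(4) y]) simp_all
  ultimately show ?case using adjoin_swap[OF I, of y "x [^] n"] by simp
qed simp

lemma nonzerodivisor_mod_prime:
  assumes "primeideal P R" "x \<in> carrier R" "x \<notin> P"
  shows "nonzerodivisor_mod P x"
  using primeideal_closed(3)[OF assms(1), of x] assms(2,3) by (auto simp: nonzerodivisor_mod_def)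

end

section \<open>Rerouting chains of primes\<close>

context noetherian_cring
begin

text \<open>The chain is corrected from the top down: once x lies in one member, the principal ideal
  theorem replaces the member below it by a prime that contains x and still fits above the next one.
  The bottom \<open>P 0\<close> stays as it is.\<close>

lemma prime_chain_through:
  assumes "prime_chain P (Suc n)" "x \<in> P (Suc n)"
  shows "\<exists>P'. prime_chain P' (Suc n) \<and> P' 0 = P 0 \<and> P' (Suc n) = P (Suc n) \<and> (\<forall>i. 1 \<le> i \<and> i \<le> Suc n \<longrightarrow> x \<in> P' i)"
  using assms
proof (induction n arbitrary: P)
  case 0
  then show ?case by (intro exI[of _ P]) (auto simp: le_Suc_eq)
next
  case (Suc n)
  have "primeideal (P n) R" "primeideal (P (Suc n)) R" "primeideal (P (Suc (Suc n))) R"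
    "P n \<subset> P (Suc n)" "P (Suc n) \<subset> P (Suc (Suc n))"
    using Suc.prems(1) by (auto simp: prime_chain_def)
  then obtain q where q: "primeideal q R" "P n \<subset> q" "q \<subset> P (Suc (Suc n))" "x \<in> q"
    using exists_primeideal_between Suc.prems(2) by metis
  have "prime_chain (P(Suc n := q)) (Suc n)"
    using Suc.prems(1) q by (auto simp: prime_chain_def less_Suc_eq)
  then obtain P' where P': "prime_chain P' (Suc n)" "P' 0 = P 0" "P' (Suc n) = q"
    "\<forall>i. 1 \<le> i \<and> i \<le> Suc n \<longrightarrow> x \<in> P' i"
    using Suc.IH[of "P(Suc n := q)", unfolded fun_upd_same] q(4) by fastforce
  let ?Q = "P'(Suc (Suc n) := P (Suc (Suc n)))"
  have "prime_chain ?Q (Suc (Suc n))"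
    using P'(1,3) q(3) Suc.prems(1) by (auto simp: prime_chain_def less_Suc_eq le_Suc_eq)
  moreover have "\<forall>i. 1 \<le> i \<and> i \<le> Suc (Suc n) \<longrightarrow> x \<in> ?Q i"
    using P'(4) Suc.prems(2) by (auto simp: le_Suc_eq)
  moreover have "?Q 0 = P 0" "?Q (Suc (Suc n)) = P (Suc (Suc n))" using P'(2) by simp_all
  ultimately show ?case by blast
qed

end

section \<open>Dimension of a local ring and flags of primes\<close>

context noetherian_local_ring
begin

lemma proper_ideal_subset:
  assumes "ideal I R" "\<one> \<notin> I"
  shows "I \<subseteq> \<mm>"
proof -
  let ?F = "{L. ideal L R \<and> I \<subseteq> L \<and> \<one> \<notin> L}"
  have "?F \<noteq> {}" using assms by blast
  then have "\<exists>M\<in>?F. \<forall>L\<in>?F. M \<subseteq> L \<longrightarrow> L = M" by (rule exists_maximal_ideal_in) simp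
  then obtain M where M: "M \<in> ?F" "\<forall>L\<in>?F. M \<subseteq> L \<longrightarrow> L = M" by (rule bexE)
  have "maximalideal M R"
  proof (rule maximalidealI)
    show "ideal M R" using M by simp
    show "carrier R \<noteq> M" using M by auto
    fix J assume J: "ideal J R" "M \<subseteq> J" "J \<subseteq> carrier R"
    show "J = M \<or> J = carrier R"
    proof (cases "\<one> \<in> J")
      case True
      then show ?thesis using ideal.one_imp_carrier[OF J(1)] by simp
    next
      case False
      then have "J \<in> ?F" using J M(1) by auto
      then show ?thesis using M(2) J(2) by simp
    qed
  qed
  then have "M = \<mm>" by (rule unique_maximalideal)
  then show ?thesis using M by simp
qed

lemma prime_m: "primeideal \<mm> R"
  by (rule maximalideal_prime) (rule is_maximalideal)

lemma primeideal_subset_m: "primeideal P R \<Longrightarrow> P \<subseteq> \<mm>"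
  using proper_ideal_subset primeideal_closed by blast

lemma invertible_outside:
  assumes "s \<in> carrier R" "s \<notin> \<mm>"
  obtains t where "t \<in> carrier R" "t \<otimes> s = \<one>"
proof -
  have i: "ideal (adjoin {\<zero>} s) R" by (rule ideal_adjoin[OF zeroideal assms(1)])
  have "\<one> \<in> adjoin {\<zero>} s"
    using proper_ideal_subset[OF i] adjoin_superset(2)[OF zeroideal assms(1)] assms(2) by blast
  then obtain i t where it: "i \<in> {\<zero>}" "t \<in> carrier R" "\<one> = i \<oplus> t \<otimes> s" by (rule adjoinE)
  then have "t \<otimes> s = \<one>" using assms(1) by simp
  then show ?thesis using that it(2) by blast
qed

text \<open>Elements outside \<mm> are units, so saturating at \<mm> does not enlarge an
  ideal.\<close>

lemma nakayama_local:
  assumes x: "x \<in> \<mm>" and K: "ideal K R" and J: "J \<subseteq> carrier R"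
    and step: "\<And>a. a \<in> J \<Longrightarrow> \<exists>k\<in>K. \<exists>j\<in>J. a = k \<oplus> x \<otimes> j"
  shows "J \<subseteq> K"
proof -
  have "J \<subseteq> saturation (carrier R - \<mm>) K"
  proof (rule nakayama[OF prime_m x K J])
    fix a assume a: "a \<in> J"
    then obtain k j where kj: "k \<in> K" "j \<in> J" "a = k \<oplus> x \<otimes> j" using step by blast
    have "\<one> \<in> carrier R - \<mm>" using primeideal_closed(2)[OF prime_m] by simp
    moreover have "\<one> \<otimes> a = k \<oplus> x \<otimes> j" using kj(3) a J l_one by auto
    ultimately show "\<exists>s\<in>carrier R - \<mm>. \<exists>k\<in>K. \<exists>j\<in>J. s \<otimes> a = k \<oplus> x \<otimes> j" using kj by blast
  qed
  also have "\<dots> \<subseteq> K"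
  proof
    fix a assume "a \<in> saturation (carrier R - \<mm>) K"
    then obtain s where s: "a \<in> carrier R" "s \<in> carrier R" "s \<notin> \<mm>" "s \<otimes> a \<in> K"
      unfolding saturation_def by blast
    obtain t where t: "t \<in> carrier R" "t \<otimes> s = \<one>" using s(2,3) by (rule invertible_outside)
    have "a = t \<otimes> (s \<otimes> a)" using s t by (simp add: m_assoc[symmetric])
    then show "a \<in> K" using ideal_closed(6)[OF K s(4) t(1)] by simp
  qed
  finally show ?thesis .
qed

text \<open>Generation is stated through the ideals that contain \<open>I \<union> A\<close>, so
  that an element can move from \<open>A\<close> into \<open>I\<close> without rewriting generated
  ideals.\<close>

definition generates_m_over :: "'a set \<Rightarrow> 'a set \<Rightarrow> bool"
  where "generates_m_over I A \<longleftrightarrow> I \<union> A \<subseteq> \<mm> \<and> (\<forall>L. ideal L R \<longrightarrow> I \<union> A \<subseteq> L \<longrightarrow> \<mm> \<subseteq> L)"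

lemma generates_m_over_adjoin:
  assumes "ideal I R" "generates_m_over I A" "x \<in> A"
  shows "generates_m_over (adjoin I x) (A - {x})"
proof -
  have x: "x \<in> \<mm>" "x \<in> carrier R" using assms ideal_closed(1)[OF is_ideal] by (auto simp: generates_m_over_def)
  have "adjoin I x \<subseteq> \<mm>"
    using adjoin_subset[OF is_ideal _ x(1)] assms(2) by (simp add: generates_m_over_def)
  then show ?thesis
    using assms(2) adjoin_superset[OF assms(1) x(2)] unfolding generates_m_over_def by blast
qed

lemma prime_chain_top:
  assumes "prime_chain P (Suc n)"
  shows "prime_chain (P(Suc n := \<mm>)) (Suc n)"
proof -
  have "P n \<subset> P (Suc n)" "P (Suc n) \<subseteq> \<mm>"
    using assms primeideal_subset_m by (auto simp: prime_chain_def)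
  then have "P n \<subset> \<mm>" by blast
  then show ?thesis using assms prime_m by (auto simp: prime_chain_def less_Suc_eq)
qed

text \<open>The chain is rerouted through x and its bottom dropped, so it loses one step while x
  enters the new bottom. The top is first raised to \<mm>, because rerouting starts from a top that
  contains x.\<close>

lemma prime_chain_shift:
  assumes "prime_chain P (Suc n)" "x \<in> \<mm>"
  obtains P' where "prime_chain P' n" "P 0 \<subset> P' 0" "x \<in> P' 0"
proof -
  have "\<exists>P'. prime_chain P' (Suc n) \<and> P' 0 = (P(Suc n := \<mm>)) 0 \<and> P' (Suc n) = (P(Suc n := \<mm>)) (Suc n) \<and>
      (\<forall>i. 1 \<le> i \<and> i \<le> Suc n \<longrightarrow> x \<in> P' i)"
    by (rule prime_chain_through[OF prime_chain_top[OF assms(1)]]) (simp add: assms(2))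
  then obtain P' where P': "prime_chain P' (Suc n)" "P' 0 = P 0" "\<forall>i. 1 \<le> i \<and> i \<le> Suc n \<longrightarrow> x \<in> P' i"
    by auto
  show ?thesis
  proof (rule that[of "\<lambda>i. P' (Suc i)"])
    show "prime_chain (\<lambda>i. P' (Suc i)) n" using P'(1) by (auto simp: prime_chain_def)
    show "P 0 \<subset> P' (Suc 0)" using P'(1,2) by (auto simp: prime_chain_def)
    show "x \<in> P' (Suc 0)" using P'(3) by simp
  qed
qed

text \<open>Krull's height theorem for R/I: each generator moved from \<open>A\<close> into
  \<open>I\<close> costs the chain one step.\<close>

lemma prime_chain_bound:
  assumes "finite A" "ideal I R" "generates_m_over I A" "prime_chain P n" "I \<subseteq> P 0"
  shows "n \<le> card A"
  using assms
proof (induction "card A" arbitrary: I A P n)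
  case 0
  then have "\<mm> \<subseteq> P 0" by (auto simp: generates_m_over_def)
  moreover have "n = 0 \<or> P 0 \<subset> P 1" "n = 0 \<or> P 1 \<subseteq> \<mm>"
    using 0(5) primeideal_subset_m[of "P 1"] by (cases n; auto simp: prime_chain_def)+
  ultimately show ?case by blast
next
  case (Suc d)
  then obtain x where x: "x \<in> A" by fastforce
  have xm: "x \<in> \<mm>" using x Suc.prems(3) by (auto simp: generates_m_over_def)
  show ?case
  proof (cases n)
    case (Suc k)
    then obtain P' where P': "prime_chain P' k" "P 0 \<subset> P' 0" "x \<in> P' 0"
      using prime_chain_shift[OF _ xm] Suc.prems(4) by metis
    have id: "ideal (P' 0) R" using P'(1) primeideal_closed(1) by (auto simp: prime_chain_def)
    have "k \<le> card (A - {x})"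
    proof (rule Suc.hyps(1)[OF _ _ _ _ P'(1)])
      show "d = card (A - {x})" using Suc.hyps(2) Suc.prems(1) x by simp
      show "generates_m_over (adjoin I x) (A - {x})"
        by (rule generates_m_over_adjoin[OF Suc.prems(2,3) x])
      show "ideal (adjoin I x) R"
        using ideal_adjoin[OF Suc.prems(2)] xm ideal_closed(1)[OF is_ideal] by blast
      show "adjoin I x \<subseteq> P' 0" using adjoin_subset[OF id _ P'(3)] P'(2) Suc.prems(5) by blast
    qed (use Suc.prems in auto)
    then show ?thesis using Suc Suc.hyps(2) Suc.prems(1) x by simp
  qed simp
qed

text \<open>For \<open>I = {\<zero>}\<close> the list is a regular system of parameters: each entry
  enlarges one prime to the next, until \<mm> is reached.\<close>

primrec prime_flag :: "'a set \<Rightarrow> 'a list \<Rightarrow> bool"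
  where "prime_flag I [] \<longleftrightarrow> I = \<mm>"
  | "prime_flag I (x # xs) \<longleftrightarrow> primeideal I R \<and> x \<in> carrier R \<and> x \<notin> I \<and> prime_flag (adjoin I x) xs"

lemma prime_flag_prime: "prime_flag I xs \<Longrightarrow> primeideal I R"
  using prime_m by (cases xs) auto

text \<open>The equality case of \<open>prime_chain_bound\<close>: a chain with as many steps as
  there are generators forces \<open>I\<close> to be prime. For \<open>I = {\<zero>}\<close> this
  says that a regular local ring is a domain.\<close>

lemma prime_flag_exists:
  assumes "finite A" "ideal I R" "generates_m_over I A" "prime_chain P (card A)" "I \<subseteq> P 0"
  shows "\<exists>xs. prime_flag I xs"
  using assms
proof (induction "card A" arbitrary: I A P)
  case 0
  then have "I = \<mm>" by (auto simp: generates_m_over_def)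
  then show ?case by (intro exI[of _ "[]"]) simp
next
  case (Suc d)
  have ch: "prime_chain P (Suc d)" using Suc by simp
  have P0: "primeideal (P 0) R" using ch by (simp add: prime_chain_def)
  have "P 0 \<subset> P 1" "P 1 \<subseteq> \<mm>"
    using ch primeideal_subset_m[of "P 1"] by (auto simp: prime_chain_def)
  then have "\<not> A \<subseteq> P 0"
    using Suc.prems(3,5) primeideal_closed(1)[OF P0] unfolding generates_m_over_def by blast
  \<comment> \<open>Choosing x outside \<open>P 0\<close> is what allows x to be cancelled in the
    Nakayama argument below.\<close>
  then obtain x where x: "x \<in> A" "x \<notin> P 0" by blast
  have xm: "x \<in> \<mm>" using x Suc.prems(3) by (auto simp: generates_m_over_def)
  have xc: "x \<in> carrier R" using xm ideal_closed(1)[OF is_ideal] by simp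
  obtain P' where P': "prime_chain P' d" "P 0 \<subset> P' 0" "x \<in> P' 0"
    using prime_chain_shift[OF ch xm] by blast
  have P'0: "primeideal (P' 0) R" using P'(1) by (simp add: prime_chain_def)
  have A': "finite (A - {x})" "d = card (A - {x})" using Suc.hyps(2) Suc.prems(1) x by simp_all
  have ia: "ideal (adjoin I x) R" by (rule ideal_adjoin[OF Suc.prems(2) xc])
  have ga: "generates_m_over (adjoin I x) (A - {x})"
    by (rule generates_m_over_adjoin[OF Suc.prems(2,3) x(1)])
  have aP: "adjoin I x \<subseteq> P' 0"
    using adjoin_subset[OF primeideal_closed(1)[OF P'0] _ P'(3)] P'(2) Suc.prems(5) by blast
  obtain xs where xs: "prime_flag (adjoin I x) xs"
    using Suc.hyps(1)[OF A'(2) A'(1) ia ga P'(1)[unfolded A'(2)] aP] by blast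
  \<comment> \<open>The induction makes \<open>I + (x)\<close> prime; were it smaller than
    \<open>P' 0\<close>, it would prolong the chain beyond the number of remaining
    generators.\<close>
  have "adjoin I x = P' 0"
  proof (rule ccontr)
    assume "adjoin I x \<noteq> P' 0"
    then have "prime_chain (case_nat (adjoin I x) P') (Suc d)"
      using P'(1) prime_flag_prime[OF xs] aP by (auto simp: prime_chain_def split: nat.split)
    then have "Suc d \<le> card (A - {x})"
      by (rule prime_chain_bound[OF A'(1) ia ga]) simp
    then show False using A'(2) by simp
  qed
  note c0 = ideal_closed[OF primeideal_closed(1)[OF P0]] and Ic = ideal_closed[OF Suc.prems(2)]
  \<comment> \<open>\<open>P 0\<close> lies in \<open>I + (x)\<close>, contains \<open>I\<close> and
    misses x, so \<open>P 0 = I + x P 0\<close>.\<close>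
  have "P 0 \<subseteq> I"
  proof (rule nakayama_local[OF xm Suc.prems(2)])
    show "P 0 \<subseteq> carrier R" using c0 by blast
    fix a assume a: "a \<in> P 0"
    then have "a \<in> adjoin I x" using P'(2) \<open>adjoin I x = P' 0\<close> by blast
    then obtain i r where i: "i \<in> I" "r \<in> carrier R" "a = i \<oplus> r \<otimes> x" by (rule adjoinE)
    have mem: "i \<in> carrier R" "r \<in> carrier R" "x \<in> carrier R" using i Ic xc by auto
    have "r \<otimes> x = (i \<oplus> r \<otimes> x) \<ominus> i" using mem by algebra
    also have "\<dots> \<in> P 0" using c0 a i Suc.prems(5) by auto
    finally have "r \<in> P 0" using primeideal_closed(3)[OF P0, of r x] mem x(2) by auto
    moreover have "a = i \<oplus> x \<otimes> r" using i(3) mem by (simp add: m_comm)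
    ultimately show "\<exists>k\<in>I. \<exists>j\<in>P 0. a = k \<oplus> x \<otimes> j" using i(1) by blast
  qed
  then have "I = P 0" using Suc.prems(5) by blast
  then have "prime_flag I (x # xs)" using P0 xc x(2) xs by simp
  then show ?case by blast
qed

end

context regular_local_ring
begin

lemma prime_flag_zero: "\<exists>xs. prime_flag {\<zero>} xs"
proof -
  obtain A where A: "A \<subseteq> carrier R" "finite A" "card A = min_generators R \<mm>" "\<mm> = Idl A"
  proof -
    obtain A where "A \<subseteq> carrier R" "finite A" "\<mm> = Idl A" using finetely_gen[OF is_ideal] by blast
    then have "\<exists>n. \<exists>A\<subseteq>carrier R. finite A \<and> card A = n \<and> \<mm> = Idl A" by blast
    then have "\<exists>A\<subseteq>carrier R. finite A \<and> card A = min_generators R \<mm> \<and> \<mm> = Idl A"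
      unfolding min_generators_def by (rule LeastI_ex)
    then show ?thesis using that by blast
  qed
  \<comment> \<open>A supremum in \<open>enat\<close> that equals a positive number is attained,
    since otherwise the predecessor would bound all lengths. The value 0 has no predecessor and is
    served by the chain consisting of \<mm> alone.\<close>
  have "\<exists>P. prime_chain P (card A)"
  proof (cases "card A")
    case 0
    show ?thesis unfolding 0 using prime_m by (intro exI[of _ "\<lambda>_. \<mm>"]) (simp add: prime_chain_def)
  next
    case (Suc d)
    have kd: "krull_dim R = enat (Suc d)" using regular A(3) Suc by simp
    show ?thesis
    proof (rule ccontr)
      assume neg: "\<nexists>P. prime_chain P (card A)"
      have "krull_dim R \<le> enat d"
        unfolding krull_dim_def
      proof (rule Sup_least)
        fix k assume "k \<in> {enat n | n. \<exists>P :: nat \<Rightarrow> 'a set. (\<forall>i\<le>n. primeideal (P i) R) \<and> (\<forall>i<n. P i \<subset> P (Suc i))}"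
        then obtain n P where n: "k = enat n" "prime_chain P n" by (auto simp: prime_chain_def)
        have "\<not> Suc d \<le> n"
        proof
          assume "Suc d \<le> n"
          then have "prime_chain P (Suc d)" using n(2) by (auto simp: prime_chain_def)
          then show False using neg Suc by auto
        qed
        then show "k \<le> enat d" using n(1) by simp
      qed
      then show False using kd by simp
    qed
  qed
  then obtain P where P: "prime_chain P (card A)" by blast
  have sub: "{\<zero>} \<subseteq> L" if "ideal L R" for L using ideal_closed(2)[OF that] by simp
  have "generates_m_over {\<zero>} A"
    using sub[OF is_ideal] genideal_self[OF A(1)] genideal_minimal A(4) unfolding generates_m_over_def by auto
  moreover have "{\<zero>} \<subseteq> P 0" using P by (intro sub primeideal_closed(1)) (simp add: prime_chain_def)
  ultimately show ?thesis using prime_flag_exists[OF A(2) zeroideal _ P] by blast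
qed

end

section \<open>Images of a regular system of parameters\<close>

locale spec_fixing_endomorphism = noetherian_local_ring +
  fixes \<phi> :: "'a \<Rightarrow> 'a"
  assumes endo: "\<phi> \<in> ring_hom R R"
    and spec_fixed: "\<And>P a. \<lbrakk>primeideal P R; a \<in> carrier R\<rbrakk> \<Longrightarrow> \<phi> a \<in> P \<longleftrightarrow> a \<in> P"
begin

lemma endo_simps [simp]:
  "a \<in> carrier R \<Longrightarrow> \<phi> a \<in> carrier R"
  "\<lbrakk>a \<in> carrier R; b \<in> carrier R\<rbrakk> \<Longrightarrow> \<phi> (a \<oplus> b) = \<phi> a \<oplus> \<phi> b"
  "\<lbrakk>a \<in> carrier R; b \<in> carrier R\<rbrakk> \<Longrightarrow> \<phi> (a \<otimes> b) = \<phi> a \<otimes> \<phi> b"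
  "\<phi> \<one> = \<one>" "\<phi> \<zero> = \<zero>"
  "a \<in> carrier R \<Longrightarrow> \<phi> (\<ominus> a) = \<ominus> \<phi> a"
proof -
  interpret \<phi>: ring_hom_ring R R \<phi> by (rule ring_hom_ringI2[OF ring_axioms ring_axioms endo])
  show "a \<in> carrier R \<Longrightarrow> \<phi> a \<in> carrier R"
    "\<lbrakk>a \<in> carrier R; b \<in> carrier R\<rbrakk> \<Longrightarrow> \<phi> (a \<oplus> b) = \<phi> a \<oplus> \<phi> b"
    "\<lbrakk>a \<in> carrier R; b \<in> carrier R\<rbrakk> \<Longrightarrow> \<phi> (a \<otimes> b) = \<phi> a \<otimes> \<phi> b"
    "\<phi> \<one> = \<one>" "\<phi> \<zero> = \<zero>" "a \<in> carrier R \<Longrightarrow> \<phi> (\<ominus> a) = \<ominus> \<phi> a"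
    by simp_all
qed

text \<open>Take the largest n with \<open>\<phi> x\<close> in \<open>I + (x^n)\<close> and write
  \<open>\<phi> x = i + u x^n\<close>. If u were not a unit, every prime over \<open>I + (u)\<close>
  would contain \<open>\<phi> x\<close> and hence x, so some power of x would lie in
  \<open>I + (u)\<close>. Since u is outside the prime \<open>I + (x)\<close>, the exponent can be
  lowered to 0, a contradiction.\<close>

lemma adjoin_image_eq_adjoin_power:
  assumes I: "primeideal I R" and J: "primeideal (adjoin I x) R" and x: "x \<in> carrier R" "x \<notin> I" "x \<in> \<mm>"
  obtains n :: nat where "adjoin I (\<phi> x) = adjoin I (x [^] n)"
proof -
  let ?y = "\<phi> x"
  note iI = primeideal_closed(1)[OF I] and iJ = primeideal_closed(1)[OF J]
  note Ic = ideal_closed[OF iI] and Jc = ideal_closed[OF iJ]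
  note [simp] = x(1)
  note nz = nonzerodivisor_mod_prime[OF I x(1,2)]
  have yI: "?y \<notin> I" using spec_fixed[OF I] x by simp
  have iA: "ideal (adjoin I (x [^] n)) R" for n :: nat by (rule ideal_adjoin[OF iI]) simp
  \<comment> \<open>Krull's intersection theorem modulo \<open>I\<close>: the intersection
    \<open>N\<close> of all \<open>I + (x^n)\<close> satisfies \<open>N \<subseteq> I + x N\<close>,
    because x can be cancelled modulo \<open>I\<close>.\<close>
  have "\<exists>n::nat. ?y \<notin> adjoin I (x [^] n)"
  proof (rule ccontr)
    assume "\<not> (\<exists>n::nat. ?y \<notin> adjoin I (x [^] n))"
    moreover define N where "N = {z \<in> carrier R. \<forall>n::nat. z \<in> adjoin I (x [^] n)}"
    ultimately have "?y \<in> N" by simp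
    have "N \<subseteq> I"
    proof (rule nakayama_local[OF x(3) iI])
      show "N \<subseteq> carrier R" by (auto simp: N_def)
      fix a assume a: "a \<in> N"
      then have "a \<in> adjoin I (x [^] (1::nat))" unfolding N_def by blast
      then obtain i c where i: "i \<in> I" "c \<in> carrier R" "a = i \<oplus> c \<otimes> x [^] (1::nat)" by (rule adjoinE)
      have "c \<in> adjoin I (x [^] n)" for n :: nat
      proof -
        have "a \<in> adjoin I (x [^] Suc n)" using a unfolding N_def by blast
        then obtain j d where j: "j \<in> I" "d \<in> carrier R" "a = j \<oplus> d \<otimes> x [^] Suc n" by (rule adjoinE)
        have mem: "i \<in> carrier R" "j \<in> carrier R" "c \<in> carrier R" "d \<in> carrier R" "x \<in> carrier R"
          "x [^] n \<in> carrier R" using i j Ic by auto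
        have e: "i \<oplus> c \<otimes> x = j \<oplus> d \<otimes> (x [^] n \<otimes> x)" using i(3) j(3) by simp
        have "x \<otimes> (c \<ominus> d \<otimes> x [^] n) = (i \<oplus> c \<otimes> x) \<ominus> i \<ominus> d \<otimes> (x [^] n \<otimes> x)" using mem by algebra
        also have "\<dots> = j \<ominus> i" unfolding e using mem by algebra
        also have "\<dots> \<in> I" using Ic i j by simp
        finally have "x \<otimes> (c \<ominus> d \<otimes> x [^] n) \<in> I" .
        then have k: "c \<ominus> d \<otimes> x [^] n \<in> I" by (rule nonzerodivisorD[OF nz]) (simp add: mem)
        have "c = (c \<ominus> d \<otimes> x [^] n) \<oplus> d \<otimes> x [^] n" using mem by algebra
        then show ?thesis using adjoinI[OF k mem(4), of "x [^] n"] by simp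
      qed
      then have "c \<in> N" using i(2) by (simp add: N_def)
      moreover have "a = i \<oplus> x \<otimes> c" using i Ic by (simp add: m_comm)
      ultimately show "\<exists>k\<in>I. \<exists>j\<in>N. a = k \<oplus> x \<otimes> j" using i(1) by blast
    qed
    then show False using \<open>?y \<in> N\<close> yI by blast
  qed
  moreover have "adjoin I (x [^] (0::nat)) = carrier R"
    using ideal.one_imp_carrier[OF iA[of 0]] adjoin_superset(2)[OF iI, of "x [^] (0::nat)"] by simp
  \<comment> \<open>Membership holds for exponent 0, where the ideal is all of R, and fails for some
    exponent; n is the last one before a failure.\<close>
  ultimately obtain n :: nat where n: "?y \<in> adjoin I (x [^] n)" "?y \<notin> adjoin I (x [^] Suc n)"
    using nat_induct[of "\<lambda>n. ?y \<in> adjoin I (x [^] (n::nat))"] endo_simps(1)[OF x(1)] by auto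
  obtain i u where i: "i \<in> I" "u \<in> carrier R" "?y = i \<oplus> u \<otimes> x [^] n" using n(1) by (rule adjoinE)
  have mem: "i \<in> carrier R" "u \<in> carrier R" "x \<in> carrier R" "x [^] n \<in> carrier R" "?y \<in> carrier R"
    using i Ic by auto
  have uJ: "u \<notin> adjoin I x"
  proof
    assume "u \<in> adjoin I x"
    then obtain j r where j: "j \<in> I" "r \<in> carrier R" "u = j \<oplus> r \<otimes> x" by (rule adjoinE)
    have "j \<in> carrier R" using j Ic by simp
    then have "?y = (i \<oplus> x [^] n \<otimes> j) \<oplus> r \<otimes> (x [^] n \<otimes> x)"
      unfolding i(3) j(3) using mem j(2) by algebra
    then have "?y \<in> adjoin I (x [^] Suc n)"
      using adjoinI[of "i \<oplus> x [^] n \<otimes> j" I r "x [^] Suc n"] Ic i j mem by simp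
    then show False using n(2) by simp
  qed
  have um: "u \<notin> \<mm>"
  proof
    assume um: "u \<in> \<mm>"
    have iu: "ideal (adjoin I u) R" by (rule ideal_adjoin[OF iI mem(2)])
    have "\<exists>k::nat. x [^] k \<in> adjoin I u"
    proof (rule pow_mem_if_in_primes[OF iu x(1)])
      fix q assume q: "primeideal q R" "adjoin I u \<subseteq> q"
      note qc = ideal_closed[OF primeideal_closed(1)[OF q(1)]]
      have "i \<in> q" "u \<in> q" using q(2) adjoin_superset[OF iI mem(2)] i(1) by auto
      then have "?y \<in> q" unfolding i(3) using qc mem by simp
      then show "x \<in> q" using spec_fixed[OF q(1)] by simp
    qed
    moreover have "x [^] k \<notin> adjoin I u" for k :: nat
    proof (induction k)
      case 0
      have "adjoin I u \<subseteq> \<mm>" by (rule adjoin_subset[OF is_ideal primeideal_subset_m[OF I] um])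
      then show ?case using primeideal_closed(2)[OF prime_m] by auto
    next
      case (Suc k)
      show ?case
      proof
        assume "x [^] Suc k \<in> adjoin I u"
        then obtain j c where j: "j \<in> I" "c \<in> carrier R" "x [^] Suc k = j \<oplus> c \<otimes> u" by (rule adjoinE)
        have mem': "j \<in> carrier R" "c \<in> carrier R" "x [^] k \<in> carrier R" using j Ic by auto
        have "c \<otimes> u = (j \<oplus> c \<otimes> u) \<ominus> j" using mem mem' by algebra
        also have "\<dots> = (\<ominus> j) \<oplus> x [^] k \<otimes> x" unfolding j(3)[symmetric] using mem mem' by (simp add: a_minus_def a_comm)
        also have "\<dots> \<in> adjoin I x" using Ic j mem' by (intro adjoinI) auto
        \<comment> \<open>In \<open>x^(k+1) = j + c u\<close> primality of \<open>I + (x)\<close>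
          puts a factor x into c modulo \<open>I\<close>, and x then cancels modulo
          \<open>I\<close>.\<close>
        finally have "c \<in> adjoin I x" using primeideal_closed(3)[OF J, of c u] mem mem' uJ by blast
        then obtain l d where l: "l \<in> I" "d \<in> carrier R" "c = l \<oplus> d \<otimes> x" by (rule adjoinE)
        have "l \<in> carrier R" using l Ic by simp
        note mem'' = mem mem' this l(2)
        have "x \<otimes> (x [^] k \<ominus> d \<otimes> u) = x [^] k \<otimes> x \<ominus> (l \<oplus> d \<otimes> x) \<otimes> u \<oplus> l \<otimes> u" using mem'' by algebra
        also have "\<dots> = (j \<oplus> c \<otimes> u) \<ominus> c \<otimes> u \<oplus> l \<otimes> u" using j(3) l(3) by simp
        also have "\<dots> = j \<oplus> l \<otimes> u" using mem'' by algebra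
        also have "\<dots> \<in> I" using Ic j l mem by simp
        finally have "x \<otimes> (x [^] k \<ominus> d \<otimes> u) \<in> I" .
        then have k: "x [^] k \<ominus> d \<otimes> u \<in> I" by (rule nonzerodivisorD[OF nz]) (simp add: mem'')
        have "x [^] k = (x [^] k \<ominus> d \<otimes> u) \<oplus> d \<otimes> u" using mem'' by algebra
        then have "x [^] k \<in> adjoin I u" using adjoinI[OF k l(2), of u] by simp
        then show False using Suc.IH by simp
      qed
    qed
    ultimately show False by blast
  qed
  obtain t where t: "t \<in> carrier R" "t \<otimes> u = \<one>" using mem(2) um by (rule invertible_outside)
  have iy: "ideal (adjoin I ?y) R" by (rule ideal_adjoin[OF iI mem(5)])
  have "x [^] n = (t \<otimes> u) \<otimes> x [^] n" using t mem by simp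
  also have "\<dots> = (\<ominus> (t \<otimes> i)) \<oplus> t \<otimes> (i \<oplus> u \<otimes> x [^] n)" using mem t(1) by algebra
  also have "\<dots> = (\<ominus> (t \<otimes> i)) \<oplus> t \<otimes> ?y" using i(3) by simp
  also have "\<dots> \<in> adjoin I ?y" using Ic i t by (intro adjoinI) auto
  finally have "adjoin I (x [^] n) \<subseteq> adjoin I ?y"
    by (rule adjoin_subset[OF iy adjoin_superset(1)[OF iI mem(5)]])
  moreover have "adjoin I ?y \<subseteq> adjoin I (x [^] n)"
    by (rule adjoin_subset[OF iA adjoin_superset(1)[OF iI mem(4)] n(1)])
  ultimately show ?thesis using that[of n] by blast
qed

text \<open>Modulo each prime of the flag, \<open>\<phi> x\<close> generates the same ideal as a
  power of x, and passing to a power keeps the rest of the sequence regular.\<close>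

lemma regular_sequence_image:
  assumes "prime_flag I xs"
  shows "regular_sequence I (map \<phi> xs)"
  using assms
proof (induction xs arbitrary: I)
  case (Cons x xs)
  then have I: "primeideal I R" and x: "x \<in> carrier R" "x \<notin> I" and fl: "prime_flag (adjoin I x) xs"
    by auto
  note iI = primeideal_closed(1)[OF I] and J = prime_flag_prime[OF fl]
  have xm: "x \<in> \<mm>" using primeideal_subset_m[OF J] adjoin_superset(2)[OF iI x(1)] by blast
  obtain n :: nat where n: "adjoin I (\<phi> x) = adjoin I (x [^] n)" by (rule adjoin_image_eq_adjoin_power[OF I J x xm])
  have "set xs \<subseteq> carrier R" using fl
  proof (induction xs arbitrary: I x)
    case (Cons y ys)
    then show ?case by (metis insert_subset list.simps(15) prime_flag.simps(2))
  qed simp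
  then have "regular_sequence (adjoin I (x [^] n)) (map \<phi> xs)"
    by (intro regular_sequence_power[OF iI x(1) _ nonzerodivisor_mod_prime[OF I x]] Cons.IH fl) auto
  moreover have "nonzerodivisor_mod I (\<phi> x)"
    using nonzerodivisor_mod_prime[OF I] spec_fixed[OF I] x by simp
  ultimately show ?case using n by simp
qed simp

end

section \<open>Dual bases over a finite endomorphism fixing the spectrum\<close>

context cring
begin

text \<open>Together with the contraction condition this yields an iterate of the induced map that
  sends the maximal ideal of the localization into itself.\<close>

lemma localized_square_subset:
  assumes P: "primeideal P R"
  shows "ideal_prod (localization_at R P) (localized_ideal R P) (localized_ideal R P) \<subseteq> localized_ideal R P"
proof
  interpret S: mult_subset R "carrier R - P" by (rule mult_subset_compl[OF P])
  note Pc = ideal_closed[OF primeideal_closed(1)[OF P]]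
  fix c assume "c \<in> ideal_prod (localization_at R P) (localized_ideal R P) (localized_ideal R P)"
  then show "c \<in> localized_ideal R P"
  proof (induction rule: ideal_prod.induct)
    case (prod i j)
    then obtain r s r' s' where e: "i = frac_class R (carrier R - P) r s" "j = frac_class R (carrier R - P) r' s'"
      "r \<in> P" "s \<in> carrier R - P" "r' \<in> P" "s' \<in> carrier R - P"
      unfolding localized_ideal_def by blast
    have "i \<otimes>\<^bsub>localization_at R P\<^esub> j = frac_class R (carrier R - P) (r \<otimes> r') (s \<otimes> s')"
      unfolding e(1,2) localization_at_def using e(3-) Pc(1) by (intro S.localization_mult_frac) auto
    moreover have "r \<otimes> r' \<in> P" using Pc e by simp
    ultimately show ?case using S.S_mult[OF e(4,6)] unfolding localized_ideal_def by blast
  next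
    case (sum i j)
    then obtain r s r' s' where e: "i = frac_class R (carrier R - P) r s" "j = frac_class R (carrier R - P) r' s'"
      "r \<in> P" "s \<in> carrier R - P" "r' \<in> P" "s' \<in> carrier R - P"
      unfolding localized_ideal_def by blast
    have "i \<oplus>\<^bsub>localization_at R P\<^esub> j = frac_class R (carrier R - P) (r \<otimes> s' \<oplus> r' \<otimes> s) (s \<otimes> s')"
      unfolding e(1,2) localization_at_def using e(3-) Pc(1) by (intro S.localization_add_frac) auto
    moreover have "r \<otimes> s' \<oplus> r' \<otimes> s \<in> P" using Pc e by simp
    ultimately show ?case using S.S_mult[OF e(4,6)] unfolding localized_ideal_def by blast
  qed
qed

text \<open>Elements outside P stay outside because the induced map is well defined. An element of P
  whose image left P would stay outside forever, yet some positive iterate of \<open>\<phi>\<close>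
  maps P into P.\<close>

lemma locally_contracting_fixes_spec:
  assumes lc: "locally_contracting R \<phi>" and P: "primeideal P R" and a: "a \<in> carrier R"
  shows "\<phi> a \<in> P \<longleftrightarrow> a \<in> P"
proof -
  let ?S = "carrier R - P"
  interpret S: mult_subset R ?S by (rule mult_subset_compl[OF P])
  note Pc = ideal_closed[OF primeideal_closed(1)[OF P]]
  have endo: "\<phi> \<in> ring_hom R R" using lc by (simp add: locally_contracting_def)
  note H = mp[OF spec[OF conjunct2[OF lc[unfolded locally_contracting_def]], of P] P]
  have notin: "\<phi> s \<in> ?S" if "s \<in> ?S" for s
    using conjunct1[OF H] that by blast
  obtain \<psi> where frac: "\<And>r s. r \<in> carrier R \<Longrightarrow> s \<in> ?S \<Longrightarrow> \<psi> (frac_class R ?S r s) = frac_class R ?S (\<phi> r) (\<phi> s)"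
    and contr: "contracting (localization_at R P) (localized_ideal R P) \<psi>"
    using conjunct2[OF H] by blast
  obtain i where i: "i > 0" "(\<psi> ^^ i) ` localized_ideal R P \<subseteq>
      ideal_prod (localization_at R P) (localized_ideal R P) (localized_ideal R P)"
    using contr unfolding contracting_def by blast
  have closed: "(\<phi> ^^ k) b \<in> carrier R" if "b \<in> carrier R" for b k
    using that ring_hom_closed[OF endo] by (induction k) auto
  have iter: "(\<psi> ^^ k) (frac_class R ?S a \<one>) = frac_class R ?S ((\<phi> ^^ k) a) \<one>" for k
    using closed[OF a] frac S.S_one ring_hom_one[OF endo] by (induction k) auto
  have "\<phi> a \<in> P" if aP: "a \<in> P"
  proof (rule ccontr)
    assume neg: "\<phi> a \<notin> P"
    have out: "(\<phi> ^^ Suc k) a \<in> ?S" for k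
      using neg ring_hom_closed[OF endo a] notin by (induction k) auto
    have "frac_class R ?S a \<one> \<in> localized_ideal R P"
      using aP S.S_one unfolding localized_ideal_def by blast
    then have "(\<psi> ^^ i) (frac_class R ?S a \<one>) \<in> localized_ideal R P"
      using i(2) localized_square_subset[OF P] by blast
    then have "frac_class R ?S ((\<phi> ^^ i) a) \<one> \<in> localized_ideal R P" by (simp only: iter)
    then obtain r s where rs: "frac_class R ?S ((\<phi> ^^ i) a) \<one> = frac_class R ?S r s" "r \<in> P" "s \<in> ?S"
      unfolding localized_ideal_def by blast
    let ?b = "(\<phi> ^^ i) a"
    \<comment> \<open>Equality of fractions becomes a relation in R: \<open>u s b = u r\<close> with
      r in P and with u, s outside P, so b is in P.\<close>
    have "(?b, \<one>) \<in> frac_class R ?S r s"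
      using S.frac_class_refl[OF closed[OF a] S.S_one, of i] rs(1) by simp
    then obtain u where u: "u \<in> ?S" "u \<otimes> (r \<otimes> \<one> \<ominus> ?b \<otimes> s) = \<zero>" unfolding frac_class_def by blast
    have mem: "u \<in> carrier R" "r \<in> carrier R" "s \<in> carrier R" "?b \<in> carrier R"
      using u rs Pc closed[OF a] by auto
    have "(u \<otimes> s) \<otimes> ?b = u \<otimes> r \<ominus> u \<otimes> (r \<otimes> \<one> \<ominus> ?b \<otimes> s)" using mem by algebra
    also have "\<dots> \<in> P" unfolding u(2) using mem rs Pc by simp
    finally have "?b \<in> P" using primeideal_closed(3)[OF P, of "u \<otimes> s" ?b] S.S_mult[OF u(1) rs(3)] mem by auto
    moreover obtain k where "i = Suc k" using i(1) gr0_implies_Suc by blast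
    ultimately show False using out[of k] by simp
  qed
  then show ?thesis using notin a by blast
qed

lemma finsum_ideal_closed:
  assumes "ideal J R" "finite A" "f \<in> A \<rightarrow> J"
  shows "finsum R f A \<in> J"
  using assms(2,3)
proof (induction rule: finite_induct)
  case (insert a A)
  note Jc = ideal_closed[OF assms(1)]
  have "f \<in> A \<rightarrow> carrier R" "f a \<in> carrier R" using insert.prems Jc(1) by (auto simp: Pi_iff)
  then show ?case using insert Jc by simp
qed (use ideal_closed(2)[OF assms(1)] in simp)

end

section \<open>Linear independence of a minimal generating set\<close>

context spec_fixing_endomorphism
begin

definition lincomb :: "'a set \<Rightarrow> ('a \<Rightarrow> 'a) \<Rightarrow> 'a"
  where "lincomb A r = (\<Oplus>a\<in>A. \<phi> (r a) \<otimes> a)"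

definition spanning :: "'a set \<Rightarrow> bool"
  where "spanning A \<longleftrightarrow> finite A \<and> A \<subseteq> carrier R \<and>
    (\<forall>s\<in>carrier R. \<exists>r\<in>A \<rightarrow> carrier R. s = lincomb A r)"

lemma lincomb_terms:
  assumes "A \<subseteq> carrier R" "r \<in> A \<rightarrow> carrier R"
  shows "(\<lambda>a. \<phi> (r a) \<otimes> a) \<in> A \<rightarrow> carrier R"
  using assms by (auto simp: Pi_iff subset_iff)

lemma lincomb_closed [intro]:
  "\<lbrakk>A \<subseteq> carrier R; r \<in> A \<rightarrow> carrier R\<rbrakk> \<Longrightarrow> lincomb A r \<in> carrier R"
  unfolding lincomb_def by (rule finsum_closed[OF lincomb_terms])

lemma lincomb_add:
  assumes "A \<subseteq> carrier R" "r \<in> A \<rightarrow> carrier R" "r' \<in> A \<rightarrow> carrier R"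
  shows "lincomb A (\<lambda>a. r a \<oplus> r' a) = lincomb A r \<oplus> lincomb A r'"
proof -
  have "lincomb A (\<lambda>a. r a \<oplus> r' a) = (\<Oplus>a\<in>A. \<phi> (r a) \<otimes> a \<oplus> \<phi> (r' a) \<otimes> a)"
    unfolding lincomb_def using assms by (intro finsum_cong') (auto simp: Pi_iff subset_iff l_distr)
  also have "\<dots> = lincomb A r \<oplus> lincomb A r'"
    unfolding lincomb_def by (rule finsum_addf[OF lincomb_terms lincomb_terms]) fact+
  finally show ?thesis .
qed

lemma lincomb_smult:
  assumes "finite A" "A \<subseteq> carrier R" "r \<in> A \<rightarrow> carrier R" "c \<in> carrier R"
  shows "lincomb A (\<lambda>a. c \<otimes> r a) = \<phi> c \<otimes> lincomb A r"
proof -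
  have "lincomb A (\<lambda>a. c \<otimes> r a) = (\<Oplus>a\<in>A. \<phi> c \<otimes> (\<phi> (r a) \<otimes> a))"
    unfolding lincomb_def using assms by (intro finsum_cong') (auto simp: Pi_iff subset_iff m_assoc)
  also have "\<dots> = \<phi> c \<otimes> lincomb A r"
    unfolding lincomb_def using assms by (intro finsum_rdistr[symmetric] lincomb_terms) auto
  finally show ?thesis .
qed

lemma lincomb_minus:
  assumes "finite A" "A \<subseteq> carrier R" "r \<in> A \<rightarrow> carrier R" "r' \<in> A \<rightarrow> carrier R"
  shows "lincomb A (\<lambda>a. r a \<ominus> r' a) = lincomb A r \<ominus> lincomb A r'"
proof -
  have cl: "(\<lambda>a. (\<ominus> \<one>) \<otimes> r' a) \<in> A \<rightarrow> carrier R" using assms(4) by auto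
  have "lincomb A (\<lambda>a. r a \<ominus> r' a) = lincomb A (\<lambda>a. r a \<oplus> (\<ominus> \<one>) \<otimes> r' a)"
    unfolding lincomb_def
  proof (intro finsum_cong' refl)
    fix a assume a: "a \<in> A"
    have "r a \<in> carrier R" "r' a \<in> carrier R" using a assms(3,4) by auto
    then have "r a \<ominus> r' a = r a \<oplus> (\<ominus> \<one>) \<otimes> r' a" by algebra
    then show "\<phi> (r a \<ominus> r' a) \<otimes> a = \<phi> (r a \<oplus> (\<ominus> \<one>) \<otimes> r' a) \<otimes> a" by simp
  qed (use assms in \<open>auto simp: Pi_iff subset_iff\<close>)
  also have "\<dots> = lincomb A r \<oplus> \<phi> (\<ominus> \<one>) \<otimes> lincomb A r'"
    unfolding lincomb_add[OF assms(2,3) cl] using lincomb_smult[OF assms(1,2,4), of "\<ominus> \<one>"] by simp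
  also have "\<dots> = lincomb A r \<ominus> lincomb A r'"
  proof -
    have "lincomb A r \<in> carrier R" "lincomb A r' \<in> carrier R" using assms by auto
    moreover have "\<phi> (\<ominus> \<one>) = \<ominus> \<one>" by simp
    ultimately show ?thesis by (simp add: l_minus a_minus_def)
  qed
  finally show ?thesis .
qed

lemma lincomb_unit:
  assumes "finite A" "A \<subseteq> carrier R" "a \<in> A"
  shows "lincomb A (\<lambda>b. if b = a then \<one> else \<zero>) = a"
proof -
  have a: "a \<in> carrier R" using assms by auto
  have "lincomb A (\<lambda>b. if b = a then \<one> else \<zero>) = (\<Oplus>b\<in>A. if a = b then b else \<zero>)"
    unfolding lincomb_def using assms by (intro finsum_cong') (auto simp: subset_iff)
  also have "\<dots> = a" using add.finprod_singleton[OF assms(3,1), of "\<lambda>b. b"] assms(2) by auto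
  finally show ?thesis .
qed

lemma spanning_exists:
  assumes "F_finite R \<phi>"
  shows "\<exists>A. spanning A"
proof -
  let ?T = "twisted_module R \<phi>"
  obtain A where A: "A \<subseteq> carrier R" "finite A" "gen_submodule R ?T A = carrier R"
    using assms unfolding F_finite_def finitely_generated_def by (auto simp: twisted_module_def)
  let ?N = "{lincomb A r | r. r \<in> A \<rightarrow> carrier R}"
  have "subgroup ?N (add_monoid R)"
  proof (rule add.subgroupI)
    show "?N \<subseteq> carrier R" using A by auto
    show "?N \<noteq> {}" by auto
  next
    fix x assume "x \<in> ?N"
    then obtain r where r: "x = lincomb A r" "r \<in> A \<rightarrow> carrier R" by blast
    have "\<ominus> x = lincomb A (\<lambda>a. (\<ominus> \<one>) \<otimes> r a)"
      using lincomb_smult[OF A(2,1) r(2), of "\<ominus> \<one>"] lincomb_closed[OF A(1) r(2)]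
      unfolding r(1) by (simp add: l_minus)
    moreover have "(\<lambda>a. (\<ominus> \<one>) \<otimes> r a) \<in> A \<rightarrow> carrier R" using r(2) by auto
    ultimately show "\<ominus> x \<in> ?N" by blast
  next
    fix x y assume "x \<in> ?N" "y \<in> ?N"
    then obtain r r' where r: "x = lincomb A r" "r \<in> A \<rightarrow> carrier R" "y = lincomb A r'" "r' \<in> A \<rightarrow> carrier R" by blast
    have "x \<oplus> y = lincomb A (\<lambda>a. r a \<oplus> r' a)" using lincomb_add[OF A(1) r(2,4)] r(1,3) by simp
    moreover have "(\<lambda>a. r a \<oplus> r' a) \<in> A \<rightarrow> carrier R" using r(2,4) by auto
    ultimately show "x \<oplus> y \<in> ?N" by blast
  qed
  moreover have "\<phi> c \<otimes> x \<in> ?N" if c: "c \<in> carrier R" and x: "x \<in> ?N" for c x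
  proof -
    obtain r where r: "x = lincomb A r" "r \<in> A \<rightarrow> carrier R" using x by blast
    have "\<phi> c \<otimes> x = lincomb A (\<lambda>a. c \<otimes> r a)" using lincomb_smult[OF A(2,1) r(2) c] r(1) by simp
    moreover have "(\<lambda>a. c \<otimes> r a) \<in> A \<rightarrow> carrier R" using r(2) c by auto
    ultimately show ?thesis by blast
  qed
  ultimately have "submodule ?N R ?T"
    by (simp add: submodule_def submodule_axioms_def twisted_module_def subgroup_def m_inv_def)
  moreover have "A \<subseteq> ?N"
  proof
    fix a assume a: "a \<in> A"
    have "(\<lambda>b. if b = a then \<one> else \<zero>) \<in> A \<rightarrow> carrier R" by auto
    then show "a \<in> ?N" using lincomb_unit[OF A(2,1) a] by (smt (verit) mem_Collect_eq)
  qed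
  ultimately have "carrier R \<subseteq> ?N" using A(3) unfolding gen_submodule_def by blast
  then have "spanning A" using A(1,2) unfolding spanning_def by blast
  then show ?thesis by blast
qed

definition minimal_spanning :: "'a set \<Rightarrow> bool"
  where "minimal_spanning A \<longleftrightarrow> spanning A \<and> (\<forall>B. spanning B \<longrightarrow> card A \<le> card B)"

lemma minimal_spanning_exists:
  assumes "F_finite R \<phi>"
  shows "\<exists>A. minimal_spanning A"
  using spanning_exists[OF assms] ex_has_least_nat[of spanning _ card] unfolding minimal_spanning_def by blast

text \<open>A relation with a unit coefficient at b would express b through the other elements,
  against minimality.\<close>

lemma minimal_spanning_relation:
  assumes A: "minimal_spanning A" and r: "r \<in> A \<rightarrow> carrier R" and rel: "lincomb A r = \<zero>" and b: "b \<in> A"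
  shows "r b \<in> \<mm>"
proof (rule ccontr)
  assume neg: "r b \<notin> \<mm>"
  have sp: "spanning A" and fin: "finite A" and sub: "A \<subseteq> carrier R"
    using A by (auto simp: minimal_spanning_def spanning_def)
  have rb: "r b \<in> carrier R" using r b by auto
  obtain t where t: "t \<in> carrier R" "t \<otimes> r b = \<one>" using rb neg by (rule invertible_outside)
  have "spanning (A - {b})"
    unfolding spanning_def
  proof (intro conjI ballI)
    fix s assume s: "s \<in> carrier R"
    then obtain c where c: "c \<in> A \<rightarrow> carrier R" "s = lincomb A c" using sp by (auto simp: spanning_def)
    have cb: "c b \<in> carrier R" using c b by auto
    have cl: "(\<lambda>a. (c b \<otimes> t) \<otimes> r a) \<in> A \<rightarrow> carrier R" using r cb t by auto
    \<comment> \<open>The multiple of the relation that cancels the coefficient at b is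
      subtracted.\<close>
    let ?d = "\<lambda>a. c a \<ominus> (c b \<otimes> t) \<otimes> r a"
    have d: "?d \<in> A \<rightarrow> carrier R" using cl c by auto
    have "lincomb A ?d = s \<ominus> \<phi> (c b \<otimes> t) \<otimes> \<zero>"
      unfolding lincomb_minus[OF fin sub c(1) cl] lincomb_smult[OF fin sub r m_closed[OF cb t(1)]] rel c(2) ..
    then have sd: "s = lincomb A ?d" using s cb t by (simp add: a_minus_def)
    have "?d b = c b \<ominus> c b \<otimes> (t \<otimes> r b)" using cb t(1) rb by (simp add: m_assoc)
    then have "?d b = \<zero>" using t(2) cb by (simp add: r_neg a_minus_def)
    then have "\<phi> (?d b) \<otimes> b = \<zero>" using b sub by auto
    moreover have "lincomb A ?d = \<phi> (?d b) \<otimes> b \<oplus> lincomb (A - {b}) ?d"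
    proof -
      have A': "A = insert b (A - {b})" using b by blast
      show ?thesis
        unfolding lincomb_def
        by (subst A', subst finsum_insert) (use fin sub b d in \<open>auto simp: Pi_iff subset_iff\<close>)
    qed
    moreover have "lincomb (A - {b}) ?d \<in> carrier R" using sub d by (intro lincomb_closed) auto
    ultimately have "s = lincomb (A - {b}) ?d" using sd by simp
    moreover have "?d \<in> A - {b} \<rightarrow> carrier R" using d by auto
    ultimately show "\<exists>r\<in>A - {b} \<rightarrow> carrier R. s = lincomb (A - {b}) r" by (rule bexI[where x = ?d])
  qed (use fin sub in auto)
  then have "card A \<le> card (A - {b})" using A by (auto simp: minimal_spanning_def)
  then show False using fin b by (meson card_Diff1_less not_le)
qed

text \<open>The hypotheses make \<open>J\<close> the extension of \<open>I\<close> along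
  \<open>\<phi>\<close>, and the claim is that \<open>A\<close> is independent modulo
  \<open>I\<close>. For the empty flag this is minimality of \<open>A\<close>. Each parameter x is
  then removed from the ideal by cancelling \<open>\<phi> x\<close>, a nonzerodivisor modulo
  \<open>J\<close>, and applying Nakayama. At \<open>I = {\<zero>}\<close> it is linear
  independence.\<close>

lemma coefficients_in_ideal:
  assumes A: "minimal_spanning A"
    and "prime_flag I xs" "regular_sequence J (map \<phi> xs)" "ideal J R"
    and "\<And>i. i \<in> I \<Longrightarrow> \<phi> i \<in> J"
    and "\<And>j. j \<in> J \<Longrightarrow> \<exists>c\<in>A \<rightarrow> I. j = lincomb A c"
    and "r \<in> A \<rightarrow> carrier R" "lincomb A r \<in> J" "a \<in> A"
  shows "r a \<in> I"
  using assms(2-)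
proof (induction xs arbitrary: I J r a)
  case Nil
  have fin: "finite A" and sub: "A \<subseteq> carrier R"
    using A by (auto simp: minimal_spanning_def spanning_def)
  note mc = ideal_closed[OF is_ideal]
  have I: "I = \<mm>" using Nil by simp
  obtain c where c: "c \<in> A \<rightarrow> \<mm>" "lincomb A r = lincomb A c" using Nil.prems(5,7) I by blast
  have c': "c \<in> A \<rightarrow> carrier R" using c(1) mc(1) by (auto simp: Pi_iff)
  have "lincomb A (\<lambda>a. r a \<ominus> c a) = \<zero>"
    unfolding lincomb_minus[OF fin sub Nil.prems(6) c'] c(2) using lincomb_closed[OF sub c'] by (simp add: a_minus_def r_neg)
  moreover have "(\<lambda>a. r a \<ominus> c a) \<in> A \<rightarrow> carrier R" using Nil.prems(6) c' by auto
  ultimately have "r a \<ominus> c a \<in> \<mm>" by (intro minimal_spanning_relation[OF A _ _ Nil.prems(8)])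
  moreover have "c a \<in> \<mm>" "r a \<in> carrier R" "c a \<in> carrier R" using c c' Nil.prems by auto
  moreover from this have "r a = (r a \<ominus> c a) \<oplus> c a" by algebra
  ultimately show ?case using mc(3) I by metis
next
  case (Cons x xs)
  have fin: "finite A" and sub: "A \<subseteq> carrier R" and sp: "\<And>s. s \<in> carrier R \<Longrightarrow> \<exists>r\<in>A \<rightarrow> carrier R. s = lincomb A r"
    using A by (auto simp: minimal_spanning_def spanning_def)
  have I: "primeideal I R" and x: "x \<in> carrier R" and fl: "prime_flag (adjoin I x) xs"
    using Cons.prems(1) by auto
  note iI = primeideal_closed(1)[OF I]
  note Ic = ideal_closed[OF iI] and Jc = ideal_closed[OF Cons.prems(3)]
  have xm: "x \<in> \<mm>" using primeideal_subset_m[OF prime_flag_prime[OF fl]] adjoin_superset(2)[OF iI x] by blast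
  have nz: "nonzerodivisor_mod J (\<phi> x)" and rs: "regular_sequence (adjoin J (\<phi> x)) (map \<phi> xs)"
    using Cons.prems(2) by auto
  have phx: "\<phi> x \<in> carrier R" using x by simp
  have iJ': "ideal (adjoin J (\<phi> x)) R" by (rule ideal_adjoin[OF Cons.prems(3) phx])
  have I'J': "\<phi> i \<in> adjoin J (\<phi> x)" if i: "i \<in> adjoin I x" for i
  proof -
    obtain j d where j: "j \<in> I" "d \<in> carrier R" "i = j \<oplus> d \<otimes> x" using i by (rule adjoinE)
    then have "\<phi> i = \<phi> j \<oplus> \<phi> d \<otimes> \<phi> x" using x Ic by simp
    then show ?thesis using adjoinI[OF Cons.prems(4)[OF j(1)], of "\<phi> d" "\<phi> x"] j(2) by simp
  qed
  have J'I': "\<exists>c\<in>A \<rightarrow> adjoin I x. j = lincomb A c" if j: "j \<in> adjoin J (\<phi> x)" for j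
  proof -
    obtain k s where k: "k \<in> J" "s \<in> carrier R" "j = k \<oplus> s \<otimes> \<phi> x" using j by (rule adjoinE)
    obtain c where c: "c \<in> A \<rightarrow> I" "k = lincomb A c" using Cons.prems(5)[OF k(1)] by blast
    obtain d where d: "d \<in> A \<rightarrow> carrier R" "s = lincomb A d" using sp[OF k(2)] by blast
    have c': "c \<in> A \<rightarrow> carrier R" using c Ic(1) by (auto simp: Pi_iff)
    have xd: "(\<lambda>a. x \<otimes> d a) \<in> A \<rightarrow> carrier R" using d x by auto
    have "lincomb A (\<lambda>a. c a \<oplus> x \<otimes> d a) = k \<oplus> \<phi> x \<otimes> s"
      unfolding lincomb_add[OF sub c' xd] lincomb_smult[OF fin sub d(1) x] c(2) d(2) ..
    also have "\<dots> = j" using k x by (simp add: m_comm)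
    finally have "j = lincomb A (\<lambda>a. c a \<oplus> x \<otimes> d a)" ..
    moreover have "(\<lambda>a. c a \<oplus> x \<otimes> d a) \<in> A \<rightarrow> adjoin I x"
    proof
      fix a assume a: "a \<in> A"
      have "c a \<in> I" "d a \<in> carrier R" using a c d by auto
      then show "c a \<oplus> x \<otimes> d a \<in> adjoin I x" using adjoinI[of "c a" I "d a" x] x by (simp add: m_comm)
    qed
    ultimately show ?thesis by blast
  qed
  \<comment> \<open>All coefficients that can occur at the place a; the cancellation below gives
    \<open>C \<subseteq> I + x C\<close>.\<close>
  define C where "C = {r a | r. r \<in> A \<rightarrow> carrier R \<and> lincomb A r \<in> J}"
  have "C \<subseteq> I"
  proof (rule nakayama_local[OF xm iI])
    show "C \<subseteq> carrier R" using Cons.prems(8) by (auto simp: C_def)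
    fix z assume "z \<in> C"
    then obtain q where q: "z = q a" "q \<in> A \<rightarrow> carrier R" "lincomb A q \<in> J" unfolding C_def by blast
    have "lincomb A q \<in> adjoin J (\<phi> x)" using q(3) adjoin_superset(1)[OF Cons.prems(3) phx] by blast
    then have "\<forall>b\<in>A. q b \<in> adjoin I x"
      using Cons.IH[OF fl rs iJ' I'J' J'I' q(2)] by blast
    then have "\<forall>b\<in>A. \<exists>i d. i \<in> I \<and> d \<in> carrier R \<and> q b = i \<oplus> d \<otimes> x"
      unfolding adjoin_def by blast
    then obtain i d where id: "\<And>b. b \<in> A \<Longrightarrow> i b \<in> I \<and> d b \<in> carrier R \<and> q b = i b \<oplus> d b \<otimes> x"
      by metis
    have i: "i \<in> A \<rightarrow> carrier R" and d: "d \<in> A \<rightarrow> carrier R" using id Ic by auto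
    have xd: "(\<lambda>a. x \<otimes> d a) \<in> A \<rightarrow> carrier R" using d x by auto
    have qe: "q b = i b \<oplus> x \<otimes> d b" if "b \<in> A" for b using id[OF that] x by (simp add: m_comm)
    have iJ: "lincomb A i \<in> J"
      unfolding lincomb_def
      by (rule finsum_ideal_closed[OF Cons.prems(3) fin]) (use id Cons.prems(4) Jc(7) sub in auto)
    have "lincomb A q = lincomb A (\<lambda>b. i b \<oplus> x \<otimes> d b)"
      unfolding lincomb_def using i xd sub qe by (intro finsum_cong') (auto simp: Pi_iff subset_iff)
    also have "\<dots> = lincomb A i \<oplus> \<phi> x \<otimes> lincomb A d"
      unfolding lincomb_add[OF sub i xd] lincomb_smult[OF fin sub d x] ..
    finally have e: "lincomb A q = lincomb A i \<oplus> \<phi> x \<otimes> lincomb A d" .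
    have mem: "lincomb A i \<in> carrier R" "lincomb A d \<in> carrier R" "\<phi> x \<in> carrier R"
      using sub i d phx by auto
    \<comment> \<open>With \<open>q = i + x d\<close> and the values of i in \<open>I\<close>, both
      \<open>lincomb A q\<close> and \<open>lincomb A i\<close> are in \<open>J\<close>, and
      regularity allows \<open>\<phi> x\<close> to be cancelled from their difference.\<close>
    have "\<phi> x \<otimes> lincomb A d = (lincomb A i \<oplus> \<phi> x \<otimes> lincomb A d) \<ominus> lincomb A i" using mem by algebra
    also have "\<dots> \<in> J" using Jc(5)[OF q(3) iJ] e by simp
    finally have "lincomb A d \<in> J" by (rule nonzerodivisorD[OF nz]) (rule mem)
    then have "d a \<in> C" using d unfolding C_def by blast
    then show "\<exists>k\<in>I. \<exists>j\<in>C. z = k \<oplus> x \<otimes> j" using qe[OF Cons.prems(8)] id[OF Cons.prems(8)] q(1) by blast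
  qed
  then show ?case using Cons.prems(6,7) unfolding C_def by blast
qed

text \<open>The functions \<open>\<alpha> a\<close> are the coordinates with respect to a minimal
  spanning set. The last clause, a coordinate of \<one> that is a unit, later makes it possible to
  read off the annihilator of a module from that of its homomorphisms.\<close>

lemma dual_basis:
  assumes flag: "prime_flag {\<zero>} xs" and fin: "F_finite R \<phi>"
  obtains A and \<alpha> :: "'a \<Rightarrow> 'a \<Rightarrow> 'a" where "finite A" "A \<subseteq> carrier R"
    "\<And>a s. \<lbrakk>a \<in> A; s \<in> carrier R\<rbrakk> \<Longrightarrow> \<alpha> a s \<in> carrier R"
    "\<And>a s t. \<lbrakk>a \<in> A; s \<in> carrier R; t \<in> carrier R\<rbrakk> \<Longrightarrow> \<alpha> a (s \<oplus> t) = \<alpha> a s \<oplus> \<alpha> a t"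
    "\<And>a r s. \<lbrakk>a \<in> A; r \<in> carrier R; s \<in> carrier R\<rbrakk> \<Longrightarrow> \<alpha> a (\<phi> r \<otimes> s) = r \<otimes> \<alpha> a s"
    "\<And>s. s \<in> carrier R \<Longrightarrow> s = (\<Oplus>a\<in>A. \<phi> (\<alpha> a s) \<otimes> a)"
    "\<exists>a\<in>A. \<alpha> a \<one> \<notin> \<mm>"
proof -
  obtain A where A: "minimal_spanning A" using minimal_spanning_exists[OF fin] by blast
  have fA: "finite A" and sub: "A \<subseteq> carrier R" and sp: "\<And>s. s \<in> carrier R \<Longrightarrow> \<exists>r\<in>A \<rightarrow> carrier R. s = lincomb A r"
    using A by (auto simp: minimal_spanning_def spanning_def)
  have zero: "lincomb A (\<lambda>_. \<zero>) = \<zero>"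
    unfolding lincomb_def using sub finsum_ideal_closed[OF zeroideal fA, of "\<lambda>a. \<phi> \<zero> \<otimes> a"]
    by (auto simp: Pi_iff subset_iff)
  have indep: "r a = \<zero>" if "r \<in> A \<rightarrow> carrier R" "lincomb A r = \<zero>" "a \<in> A" for r a
  proof -
    have "r a \<in> {\<zero>}"
    proof (rule coefficients_in_ideal[OF A flag regular_sequence_image[OF flag] zeroideal _ _ that(1) _ that(3)])
      show "\<exists>c\<in>A \<rightarrow> {\<zero>}. j = lincomb A c" if "j \<in> {\<zero>}" for j
        using that zero by (intro bexI[of _ "\<lambda>_. \<zero>"]) auto
    qed (use that in auto)
    then show ?thesis by simp
  qed
  have unique: "r a = r' a" if r: "r \<in> A \<rightarrow> carrier R" "r' \<in> A \<rightarrow> carrier R" "lincomb A r = lincomb A r'" "a \<in> A" for r r' a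
  proof -
    have "lincomb A (\<lambda>a. r a \<ominus> r' a) = \<zero>"
      unfolding lincomb_minus[OF fA sub r(1,2)] r(3) using lincomb_closed[OF sub r(2)] by (simp add: a_minus_def r_neg)
    then have "r a \<ominus> r' a = \<zero>" using r by (intro indep[of "\<lambda>a. r a \<ominus> r' a" a]) auto
    moreover have "r a \<in> carrier R" "r' a \<in> carrier R" using r by auto
    ultimately show ?thesis by simp
  qed
  define \<beta> where "\<beta> s = (SOME r. r \<in> A \<rightarrow> carrier R \<and> s = lincomb A r)" for s
  have \<beta>: "\<beta> s \<in> A \<rightarrow> carrier R \<and> s = lincomb A (\<beta> s)" if "s \<in> carrier R" for s
    unfolding \<beta>_def by (rule someI_ex[of "\<lambda>r. r \<in> A \<rightarrow> carrier R \<and> s = lincomb A r"]) (use sp[OF that] in blast)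
  show ?thesis
  proof (rule that[of A "\<lambda>a s. \<beta> s a"])
    show "finite A" "A \<subseteq> carrier R" by fact+
    show "\<beta> s a \<in> carrier R" if "a \<in> A" "s \<in> carrier R" for a s using \<beta>[OF that(2)] that(1) by auto
    show "\<beta> (s \<oplus> t) a = \<beta> s a \<oplus> \<beta> t a" if "a \<in> A" "s \<in> carrier R" "t \<in> carrier R" for a s t
    proof -
      note bs = \<beta>[OF that(2), THEN conjunct1] and bt = \<beta>[OF that(3), THEN conjunct1]
      have st: "s \<oplus> t \<in> carrier R" using that by simp
      have "lincomb A (\<lambda>a. \<beta> s a \<oplus> \<beta> t a) = s \<oplus> t"
        unfolding lincomb_add[OF sub bs bt] using \<beta>[OF that(2)] \<beta>[OF that(3)] by simp
      then have "lincomb A (\<beta> (s \<oplus> t)) = lincomb A (\<lambda>a. \<beta> s a \<oplus> \<beta> t a)" using \<beta>[OF st] by simp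
      then show ?thesis using bs bt \<beta>[OF st] that(1) by (intro unique[of _ "\<lambda>a. \<beta> s a \<oplus> \<beta> t a"]) auto
    qed
    show "\<beta> (\<phi> r \<otimes> s) a = r \<otimes> \<beta> s a" if "a \<in> A" "r \<in> carrier R" "s \<in> carrier R" for a r s
    proof -
      note bs = \<beta>[OF that(3), THEN conjunct1]
      have st: "\<phi> r \<otimes> s \<in> carrier R" using that by simp
      have "lincomb A (\<lambda>a. r \<otimes> \<beta> s a) = \<phi> r \<otimes> s"
        unfolding lincomb_smult[OF fA sub bs that(2)] using \<beta>[OF that(3)] by simp
      then have "lincomb A (\<beta> (\<phi> r \<otimes> s)) = lincomb A (\<lambda>a. r \<otimes> \<beta> s a)" using \<beta>[OF st] by simp
      then show ?thesis using bs \<beta>[OF st] that(1,2) by (intro unique[of _ "\<lambda>a. r \<otimes> \<beta> s a"]) auto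
    qed
    show "s = (\<Oplus>a\<in>A. \<phi> (\<beta> s a) \<otimes> a)" if "s \<in> carrier R" for s
      using \<beta>[OF that] unfolding lincomb_def by simp
    \<comment> \<open>If all coordinates of \<one> were in \<mm>, so would be their images under
      \<open>\<phi>\<close>, and with them \<one>.\<close>
    show "\<exists>a\<in>A. \<beta> \<one> a \<notin> \<mm>"
    proof (rule ccontr)
      assume "\<not> ?thesis"
      then have "\<phi> (\<beta> \<one> a) \<otimes> a \<in> \<mm>" if "a \<in> A" for a
      proof -
        have "\<beta> \<one> a \<in> carrier R" "\<beta> \<one> a \<in> \<mm>" "a \<in> carrier R"
          using that \<beta>[OF one_closed] sub \<open>\<not> (\<exists>a\<in>A. \<beta> \<one> a \<notin> \<mm>)\<close> by auto
        then show ?thesis using spec_fixed[OF prime_m] ideal_closed(7)[OF is_ideal] by blast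
      qed
      then have "lincomb A (\<beta> \<one>) \<in> \<mm>"
        unfolding lincomb_def by (intro finsum_ideal_closed[OF is_ideal fA]) auto
      then show False using \<beta>[OF one_closed] primeideal_closed(2)[OF prime_m] by simp
    qed
  qed
qed

end

section \<open>Descending chains of submodules\<close>

text \<open>Unlike \<open>module_hom\<close> it demands no extensionality, so scalar
  multiplications, coset maps and evaluations qualify as written.\<close>

definition linear_map ::
    "('a, 'r) ring_scheme \<Rightarrow> ('a, 'b, 'm) module_scheme \<Rightarrow> ('a, 'c, 'n) module_scheme \<Rightarrow> ('b \<Rightarrow> 'c) \<Rightarrow> bool"
  where "linear_map R M N f \<longleftrightarrow> f \<in> carrier M \<rightarrow> carrier N \<and>
    (\<forall>x\<in>carrier M. \<forall>y\<in>carrier M. f (x \<oplus>\<^bsub>M\<^esub> y) = f x \<oplus>\<^bsub>N\<^esub> f y) \<and>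
    (\<forall>r\<in>carrier R. \<forall>x\<in>carrier M. f (r \<odot>\<^bsub>M\<^esub> x) = r \<odot>\<^bsub>N\<^esub> f x)"

text \<open>The chain condition is relative to a subset \<open>T\<close> of a fixed module, so that
  kernels and images are treated without turning them into modules of their own.\<close>

definition dcc_below ::
    "('a, 'r) ring_scheme \<Rightarrow> ('a, 'b, 'm) module_scheme \<Rightarrow> 'b set \<Rightarrow> bool"
  where "dcc_below R M T \<longleftrightarrow> (\<forall>N :: nat \<Rightarrow> 'b set.
    (\<forall>i. submodule (N i) R M \<and> N i \<subseteq> T \<and> N (Suc i) \<subseteq> N i) \<longrightarrow> (\<exists>n. \<forall>i\<ge>n. N i = N n))"

lemma dcc_belowI:
  assumes "\<And>N :: nat \<Rightarrow> 'b set. \<lbrakk>\<And>i. submodule (N i) R M; \<And>i. N i \<subseteq> T; \<And>i. N (Suc i) \<subseteq> N i;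
      \<And>i k. i \<le> k \<Longrightarrow> N k \<subseteq> N i\<rbrakk> \<Longrightarrow> \<exists>n. \<forall>i\<ge>n. N i = N n"
  shows "dcc_below R M (T :: 'b set)"
  unfolding dcc_below_def
proof (intro allI impI)
  fix N :: "nat \<Rightarrow> 'b set" assume N: "\<forall>i. submodule (N i) R M \<and> N i \<subseteq> T \<and> N (Suc i) \<subseteq> N i"
  show "\<exists>n. \<forall>i\<ge>n. N i = N n"
    by (rule assms) (use N lift_Suc_antimono_le[of N] in auto)
qed

lemma dcc_belowD:
  fixes N :: "nat \<Rightarrow> 'b set"
  assumes "dcc_below R M T" "\<And>i. submodule (N i) R M" "\<And>i. N i \<subseteq> T" "\<And>i. N (Suc i) \<subseteq> N i"
  shows "\<exists>n. \<forall>i\<ge>n. N i = N n"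
  using assms unfolding dcc_below_def by simp

lemma dcc_below_mono: "\<lbrakk>dcc_below R M T; T' \<subseteq> T\<rbrakk> \<Longrightarrow> dcc_below R M T'"
  unfolding dcc_below_def by (meson order_trans)

lemma artinian_module_iff:
  "artinian_module R M \<longleftrightarrow> module R M \<and> dcc_below R M (carrier M)"
proof -
  have "N \<subseteq> carrier M" if "submodule N R M" for N
    using subgroup.subset[OF submodule.axioms(1)[OF that]] by simp
  then show ?thesis unfolding artinian_module_def dcc_below_def by blast
qed

section \<open>Submodules, linear maps and stability of the chain condition\<close>

context module
begin

lemma submodule_closed:
  assumes "submodule N R M"
  shows "N \<subseteq> carrier M" "\<zero>\<^bsub>M\<^esub> \<in> N"
    and "\<And>a b. \<lbrakk>a \<in> N; b \<in> N\<rbrakk> \<Longrightarrow> a \<oplus>\<^bsub>M\<^esub> b \<in> N"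
    and "\<And>a. a \<in> N \<Longrightarrow> \<ominus>\<^bsub>M\<^esub> a \<in> N"
    and "\<And>a b. \<lbrakk>a \<in> N; b \<in> N\<rbrakk> \<Longrightarrow> a \<ominus>\<^bsub>M\<^esub> b \<in> N"
    and "\<And>r a. \<lbrakk>r \<in> carrier R; a \<in> N\<rbrakk> \<Longrightarrow> r \<odot>\<^bsub>M\<^esub> a \<in> N"
  using submoduleE[OF assms] subgroup.one_closed[OF submodule.axioms(1)[OF assms]]
  by (auto simp: a_minus_def)

lemma submoduleI':
  assumes "H \<subseteq> carrier M" "\<zero>\<^bsub>M\<^esub> \<in> H"
    and "\<And>a b. \<lbrakk>a \<in> H; b \<in> H\<rbrakk> \<Longrightarrow> a \<oplus>\<^bsub>M\<^esub> b \<in> H"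
    and smult: "\<And>a x. \<lbrakk>a \<in> carrier R; x \<in> H\<rbrakk> \<Longrightarrow> a \<odot>\<^bsub>M\<^esub> x \<in> H"
  shows "submodule H R M"
proof (rule submoduleI)
  fix a assume a: "a \<in> H"
  have "\<ominus>\<^bsub>M\<^esub> a = (\<ominus> \<one>) \<odot>\<^bsub>M\<^esub> a"
    using a assms(1) smult_l_minus[of \<one> a] by auto
  then show "\<ominus>\<^bsub>M\<^esub> a \<in> H" using smult[OF _ a, of "\<ominus> \<one>"] by simp
qed (use assms in auto)

lemma submodule_zero: "submodule {\<zero>\<^bsub>M\<^esub>} R M"
  by (rule submoduleI') auto

lemma submodule_Int:
  assumes "submodule N R M" "submodule K R M"
  shows "submodule (N \<inter> K) R M"
  using submodule_closed[OF assms(1)] submodule_closed[OF assms(2)] by (intro submoduleI') auto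

lemma submodule_sum:
  assumes "submodule N R M" "submodule K R M"
  shows "submodule (N <+>\<^bsub>M\<^esub> K) R M"
proof (rule submoduleI')
  note Nc = submodule_closed[OF assms(1)] and Kc = submodule_closed[OF assms(2)]
  show "N <+>\<^bsub>M\<^esub> K \<subseteq> carrier M" using Nc(1) Kc(1) by (auto simp: set_add_def')
  have "\<zero>\<^bsub>M\<^esub> = \<zero>\<^bsub>M\<^esub> \<oplus>\<^bsub>M\<^esub> \<zero>\<^bsub>M\<^esub>" by simp
  then show "\<zero>\<^bsub>M\<^esub> \<in> N <+>\<^bsub>M\<^esub> K" using Nc(2) Kc(2) unfolding set_add_def' by blast
  fix a b assume "a \<in> N <+>\<^bsub>M\<^esub> K" "b \<in> N <+>\<^bsub>M\<^esub> K"
  then obtain n k n' k' where e: "a = n \<oplus>\<^bsub>M\<^esub> k" "b = n' \<oplus>\<^bsub>M\<^esub> k'" "n \<in> N" "k \<in> K" "n' \<in> N" "k' \<in> K"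
    unfolding set_add_def' by blast
  have "a \<oplus>\<^bsub>M\<^esub> b = (n \<oplus>\<^bsub>M\<^esub> n') \<oplus>\<^bsub>M\<^esub> (k \<oplus>\<^bsub>M\<^esub> k')"
    using e Nc(1) Kc(1) M.add.m_assoc M.add.m_comm M.add.m_lcomm by (auto simp: subset_iff)
  then show "a \<oplus>\<^bsub>M\<^esub> b \<in> N <+>\<^bsub>M\<^esub> K" using Nc(3)[OF e(3,5)] Kc(3)[OF e(4,6)] unfolding set_add_def' by blast
next
  note Nc = submodule_closed[OF assms(1)] and Kc = submodule_closed[OF assms(2)]
  fix r a assume r: "r \<in> carrier R" and "a \<in> N <+>\<^bsub>M\<^esub> K"
  then obtain n k where e: "a = n \<oplus>\<^bsub>M\<^esub> k" "n \<in> N" "k \<in> K" unfolding set_add_def' by blast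
  have "r \<odot>\<^bsub>M\<^esub> a = r \<odot>\<^bsub>M\<^esub> n \<oplus>\<^bsub>M\<^esub> r \<odot>\<^bsub>M\<^esub> k"
    using e Nc(1) Kc(1) r by (auto simp: subset_iff smult_r_distr)
  then show "r \<odot>\<^bsub>M\<^esub> a \<in> N <+>\<^bsub>M\<^esub> K" using Nc(6)[OF r e(2)] Kc(6)[OF r e(3)] unfolding set_add_def' by blast
qed

lemma submodule_sum_superset:
  assumes "submodule N R M" "submodule K R M"
  shows "N \<subseteq> N <+>\<^bsub>M\<^esub> K" "K \<subseteq> N <+>\<^bsub>M\<^esub> K"
proof -
  note Nc = submodule_closed[OF assms(1)] and Kc = submodule_closed[OF assms(2)]
  show "N \<subseteq> N <+>\<^bsub>M\<^esub> K"
  proof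
    fix n assume n: "n \<in> N"
    then have "n = n \<oplus>\<^bsub>M\<^esub> \<zero>\<^bsub>M\<^esub>" using Nc(1) by auto
    then show "n \<in> N <+>\<^bsub>M\<^esub> K" using n Kc(2) unfolding set_add_def' by blast
  qed
  show "K \<subseteq> N <+>\<^bsub>M\<^esub> K"
  proof
    fix n assume n: "n \<in> K"
    then have "n = \<zero>\<^bsub>M\<^esub> \<oplus>\<^bsub>M\<^esub> n" using Kc(1) by auto
    then show "n \<in> N <+>\<^bsub>M\<^esub> K" using n Nc(2) unfolding set_add_def' by blast
  qed
qed

lemma submodule_cyclic:
  assumes v: "v \<in> carrier M"
  shows "submodule ((\<lambda>r. r \<odot>\<^bsub>M\<^esub> v) ` carrier R) R M" "v \<in> (\<lambda>r. r \<odot>\<^bsub>M\<^esub> v) ` carrier R"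
proof -
  show "submodule ((\<lambda>r. r \<odot>\<^bsub>M\<^esub> v) ` carrier R) R M"
  proof (rule submoduleI')
    have "\<zero>\<^bsub>M\<^esub> = \<zero> \<odot>\<^bsub>M\<^esub> v" using v by simp
    then show "\<zero>\<^bsub>M\<^esub> \<in> (\<lambda>r. r \<odot>\<^bsub>M\<^esub> v) ` carrier R" by blast
  next
    fix a b assume "a \<in> (\<lambda>r. r \<odot>\<^bsub>M\<^esub> v) ` carrier R" "b \<in> (\<lambda>r. r \<odot>\<^bsub>M\<^esub> v) ` carrier R"
    then obtain r s where "a = r \<odot>\<^bsub>M\<^esub> v" "b = s \<odot>\<^bsub>M\<^esub> v" "r \<in> carrier R" "s \<in> carrier R" by blast
    then have "a \<oplus>\<^bsub>M\<^esub> b = (r \<oplus> s) \<odot>\<^bsub>M\<^esub> v" "r \<oplus> s \<in> carrier R" using v by (auto simp: smult_l_distr)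
    then show "a \<oplus>\<^bsub>M\<^esub> b \<in> (\<lambda>r. r \<odot>\<^bsub>M\<^esub> v) ` carrier R" by blast
  next
    fix s a assume s: "s \<in> carrier R" and "a \<in> (\<lambda>r. r \<odot>\<^bsub>M\<^esub> v) ` carrier R"
    then obtain r where "a = r \<odot>\<^bsub>M\<^esub> v" "r \<in> carrier R" by blast
    then have "s \<odot>\<^bsub>M\<^esub> a = (s \<otimes> r) \<odot>\<^bsub>M\<^esub> v" "s \<otimes> r \<in> carrier R" using v s by (auto simp: smult_assoc1)
    then show "s \<odot>\<^bsub>M\<^esub> a \<in> (\<lambda>r. r \<odot>\<^bsub>M\<^esub> v) ` carrier R" by blast
  qed (use v in auto)
  have "v = \<one> \<odot>\<^bsub>M\<^esub> v" using v by simp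
  then show "v \<in> (\<lambda>r. r \<odot>\<^bsub>M\<^esub> v) ` carrier R" by blast
qed

lemma linear_map_closed:
  assumes "linear_map R M L f" "module R L"
  shows "\<And>x. x \<in> carrier M \<Longrightarrow> f x \<in> carrier L"
    and "\<And>x y. \<lbrakk>x \<in> carrier M; y \<in> carrier M\<rbrakk> \<Longrightarrow> f (x \<oplus>\<^bsub>M\<^esub> y) = f x \<oplus>\<^bsub>L\<^esub> f y"
    and "\<And>r x. \<lbrakk>r \<in> carrier R; x \<in> carrier M\<rbrakk> \<Longrightarrow> f (r \<odot>\<^bsub>M\<^esub> x) = r \<odot>\<^bsub>L\<^esub> f x"
    and "f \<zero>\<^bsub>M\<^esub> = \<zero>\<^bsub>L\<^esub>"
    and "\<And>x y. \<lbrakk>x \<in> carrier M; y \<in> carrier M\<rbrakk> \<Longrightarrow> f (x \<ominus>\<^bsub>M\<^esub> y) = f x \<ominus>\<^bsub>L\<^esub> f y"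
proof -
  interpret L: module R L by fact
  show cl: "\<And>x. x \<in> carrier M \<Longrightarrow> f x \<in> carrier L"
    and add: "\<And>x y. \<lbrakk>x \<in> carrier M; y \<in> carrier M\<rbrakk> \<Longrightarrow> f (x \<oplus>\<^bsub>M\<^esub> y) = f x \<oplus>\<^bsub>L\<^esub> f y"
    and sm: "\<And>r x. \<lbrakk>r \<in> carrier R; x \<in> carrier M\<rbrakk> \<Longrightarrow> f (r \<odot>\<^bsub>M\<^esub> x) = r \<odot>\<^bsub>L\<^esub> f x"
    using assms(1) by (auto simp: linear_map_def)
  show "f \<zero>\<^bsub>M\<^esub> = \<zero>\<^bsub>L\<^esub>"
    using sm[of \<zero> "\<zero>\<^bsub>M\<^esub>"] cl[of "\<zero>\<^bsub>M\<^esub>"] by simp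
  fix x y assume xy: "x \<in> carrier M" "y \<in> carrier M"
  have "x \<ominus>\<^bsub>M\<^esub> y = x \<oplus>\<^bsub>M\<^esub> (\<ominus> \<one>) \<odot>\<^bsub>M\<^esub> y" using xy smult_l_minus[of \<one> y] by (simp add: a_minus_def)
  then show "f (x \<ominus>\<^bsub>M\<^esub> y) = f x \<ominus>\<^bsub>L\<^esub> f y"
    using xy add sm cl L.smult_l_minus[of \<one> "f y"] by (simp add: a_minus_def)
qed

lemma submodule_image:
  assumes f: "linear_map R M L f" and L: "module R L" and N: "submodule N R M"
  shows "submodule (f ` N) R L"
proof -
  interpret L: module R L by fact
  note fc = linear_map_closed[OF f L] and Nc = submodule_closed[OF N]
  show ?thesis
  proof (rule L.submoduleI')
    show "f ` N \<subseteq> carrier L" using fc(1) Nc(1) by blast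
    show "\<zero>\<^bsub>L\<^esub> \<in> f ` N" using fc(4) Nc(2) by (metis imageI)
    fix a b assume "a \<in> f ` N" "b \<in> f ` N"
    then obtain x y where e: "a = f x" "b = f y" "x \<in> N" "y \<in> N" by blast
    then have "a \<oplus>\<^bsub>L\<^esub> b = f (x \<oplus>\<^bsub>M\<^esub> y)" using fc(2) Nc(1) by (simp add: subset_iff)
    then show "a \<oplus>\<^bsub>L\<^esub> b \<in> f ` N" using Nc(3)[OF e(3,4)] by blast
  next
    fix r a assume r: "r \<in> carrier R" and "a \<in> f ` N"
    then obtain x where e: "a = f x" "x \<in> N" by blast
    then have "r \<odot>\<^bsub>L\<^esub> a = f (r \<odot>\<^bsub>M\<^esub> x)" using fc(3) Nc(1) r by (simp add: subset_iff)
    then show "r \<odot>\<^bsub>L\<^esub> a \<in> f ` N" using Nc(6)[OF r e(2)] by blast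
  qed
qed

lemma submodule_preimage:
  assumes f: "linear_map R M L f" and L: "module R L" and V: "submodule V R L"
  shows "submodule {x \<in> carrier M. f x \<in> V} R M"
proof -
  interpret L: module R L by fact
  note fc = linear_map_closed[OF f L] and Vc = L.submodule_closed[OF V]
  show ?thesis by (rule submoduleI') (use fc Vc in auto)
qed

lemma add_diff_cancel:
  assumes "a \<in> carrier M" "b \<in> carrier M"
  shows "(a \<oplus>\<^bsub>M\<^esub> b) \<ominus>\<^bsub>M\<^esub> a = b" "(a \<ominus>\<^bsub>M\<^esub> b) \<oplus>\<^bsub>M\<^esub> b = a"
proof -
  have "(a \<oplus>\<^bsub>M\<^esub> b) \<oplus>\<^bsub>M\<^esub> \<ominus>\<^bsub>M\<^esub> a = b \<oplus>\<^bsub>M\<^esub> (a \<oplus>\<^bsub>M\<^esub> \<ominus>\<^bsub>M\<^esub> a)"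
    using assms M.add.m_comm[of a b] M.add.m_assoc by simp
  then show "(a \<oplus>\<^bsub>M\<^esub> b) \<ominus>\<^bsub>M\<^esub> a = b" using assms by (simp add: a_minus_def M.r_neg)
  show "(a \<ominus>\<^bsub>M\<^esub> b) \<oplus>\<^bsub>M\<^esub> b = a"
    using assms by (simp add: a_minus_def M.add.m_assoc M.l_neg)
qed

text \<open>Comparable submodules with the same trace on the kernel of f and the same image under f
  are equal.\<close>

lemma dcc_below_extension:
  assumes f: "linear_map R M L f" and L: "module R L" and T: "submodule T R M"
    and ker: "dcc_below R M {x \<in> T. f x = \<zero>\<^bsub>L\<^esub>}" and im: "dcc_below R L (f ` T)"
  shows "dcc_below R M T"
proof (rule dcc_belowI)
  interpret L: module R L by fact
  note fc = linear_map_closed[OF f L] and Tc = submodule_closed[OF T]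
  fix N :: "nat \<Rightarrow> 'c set"
  assume N: "\<And>i. submodule (N i) R M" "\<And>i. N i \<subseteq> T" "\<And>i. N (Suc i) \<subseteq> N i" "\<And>i k. i \<le> k \<Longrightarrow> N k \<subseteq> N i"
  have k: "submodule {x \<in> carrier M. f x \<in> {\<zero>\<^bsub>L\<^esub>}} R M"
    by (rule submodule_preimage[OF f L L.submodule_zero])
  have "\<exists>n. \<forall>i\<ge>n. N i \<inter> {x \<in> carrier M. f x \<in> {\<zero>\<^bsub>L\<^esub>}} = N n \<inter> {x \<in> carrier M. f x \<in> {\<zero>\<^bsub>L\<^esub>}}"
    by (rule dcc_belowD[OF ker submodule_Int[OF N(1) k]]) (use N(2,3) in blast)+
  then obtain n1 where n1: "\<And>i. i \<ge> n1 \<Longrightarrow> N i \<inter> {x \<in> carrier M. f x \<in> {\<zero>\<^bsub>L\<^esub>}} = N n1 \<inter> {x \<in> carrier M. f x \<in> {\<zero>\<^bsub>L\<^esub>}}"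
    by blast
  have "\<exists>n. \<forall>i\<ge>n. f ` N i = f ` N n"
    by (rule dcc_belowD[OF im submodule_image[OF f L N(1)]]) (use N(2,3) in blast)+
  then obtain n2 where n2: "\<And>i. i \<ge> n2 \<Longrightarrow> f ` N i = f ` N n2" by blast
  let ?n = "max n1 n2"
  have "N i = N ?n" if i: "i \<ge> ?n" for i
  proof
    note Nc = submodule_closed[OF N(1)[of i]] and Nc' = submodule_closed[OF N(1)[of ?n]]
    show sub: "N i \<subseteq> N ?n" by (rule N(4)[OF i])
    show "N ?n \<subseteq> N i"
    proof
      fix x assume x: "x \<in> N ?n"
      have "f x \<in> f ` N i" using n2[of i] n2[of ?n] i x by auto
      then obtain y where y: "y \<in> N i" "f x = f y" by blast
      have mem: "x \<in> carrier M" "y \<in> carrier M" using x y Nc(1) Nc'(1) by auto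
      have "x \<ominus>\<^bsub>M\<^esub> y \<in> N ?n" using Nc'(5) x y sub by blast
      moreover have "f (x \<ominus>\<^bsub>M\<^esub> y) = \<zero>\<^bsub>L\<^esub>"
        using fc(5)[OF mem] y(2) fc(1)[OF mem(2)] by (simp add: a_minus_def L.M.r_neg)
      ultimately have "x \<ominus>\<^bsub>M\<^esub> y \<in> N ?n \<inter> {x \<in> carrier M. f x \<in> {\<zero>\<^bsub>L\<^esub>}}" using mem by simp
      then have "x \<ominus>\<^bsub>M\<^esub> y \<in> N i" using n1[of i] n1[of ?n] i by auto
      then have "(x \<ominus>\<^bsub>M\<^esub> y) \<oplus>\<^bsub>M\<^esub> y \<in> N i" using Nc(3) y by blast
      then show "x \<in> N i" using add_diff_cancel[OF mem] by simp
    qed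
  qed
  then show "\<exists>n. \<forall>i\<ge>n. N i = N n" by blast
qed

lemma dcc_below_zero: "dcc_below R M {\<zero>\<^bsub>M\<^esub>}"
proof (rule dcc_belowI)
  fix N :: "nat \<Rightarrow> _" assume N: "\<And>i. submodule (N i) R M" "\<And>i. N i \<subseteq> {\<zero>\<^bsub>M\<^esub>}"
  have "N i = {\<zero>\<^bsub>M\<^esub>}" for i using N(2)[of i] submodule_closed(2)[OF N(1)[of i]] by auto
  then show "\<exists>n. \<forall>i\<ge>n. N i = N n" by simp
qed

text \<open>Comparable submodules N of \<open>T + U\<close> agree once \<open>N \<inter> T\<close>
  and \<open>(N + T) \<inter> U\<close> agree; the second is the image of N in
  \<open>(T + U) / T\<close>, pulled back to \<open>U\<close>.\<close>

lemma dcc_below_sum: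
  assumes T: "submodule T R M" "submodule U R M" and dT: "dcc_below R M T" and dU: "dcc_below R M U"
  shows "dcc_below R M (T <+>\<^bsub>M\<^esub> U)"
proof (rule dcc_belowI)
  note Tc = submodule_closed[OF T(1)] and Uc = submodule_closed[OF T(2)]
  fix N :: "nat \<Rightarrow> 'c set"
  assume N: "\<And>i. submodule (N i) R M" "\<And>i. N i \<subseteq> T <+>\<^bsub>M\<^esub> U" "\<And>i. N (Suc i) \<subseteq> N i" "\<And>i k. i \<le> k \<Longrightarrow> N k \<subseteq> N i"
  have "\<exists>n. \<forall>i\<ge>n. N i \<inter> T = N n \<inter> T"
    by (rule dcc_belowD[OF dT submodule_Int[OF N(1) T(1)]]) (use N(3) in blast)+
  then obtain n1 where n1: "\<And>i. i \<ge> n1 \<Longrightarrow> N i \<inter> T = N n1 \<inter> T" by blast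
  have mono: "(N (Suc i) <+>\<^bsub>M\<^esub> T) \<inter> U \<subseteq> (N i <+>\<^bsub>M\<^esub> T) \<inter> U" for i
    using N(3)[of i] unfolding set_add_def' by blast
  have "\<exists>n. \<forall>i\<ge>n. (N i <+>\<^bsub>M\<^esub> T) \<inter> U = (N n <+>\<^bsub>M\<^esub> T) \<inter> U"
    by (rule dcc_belowD[OF dU, of "\<lambda>i. (N i <+>\<^bsub>M\<^esub> T) \<inter> U"])
      (rule submodule_Int[OF submodule_sum[OF N(1) T(1)] T(2)] mono Int_lower2)+
  then obtain n2 where n2: "\<And>i. i \<ge> n2 \<Longrightarrow> (N i <+>\<^bsub>M\<^esub> T) \<inter> U = (N n2 <+>\<^bsub>M\<^esub> T) \<inter> U"
    by blast
  let ?n = "max n1 n2"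
  have "N i = N ?n" if i: "i \<ge> ?n" for i
  proof
    note Nc = submodule_closed[OF N(1)[of i]] and Nc' = submodule_closed[OF N(1)[of ?n]]
    show sub: "N i \<subseteq> N ?n" by (rule N(4)[OF i])
    show "N ?n \<subseteq> N i"
    proof
      fix x assume x: "x \<in> N ?n"
      then obtain t u where tu: "t \<in> T" "u \<in> U" "x = t \<oplus>\<^bsub>M\<^esub> u" using N(2)[of ?n] unfolding set_add_def' by blast
      have mem: "t \<in> carrier M" "u \<in> carrier M" "x \<in> carrier M" using x tu Tc(1) Uc(1) Nc'(1) by auto
      have "u = x \<oplus>\<^bsub>M\<^esub> \<ominus>\<^bsub>M\<^esub> t" using add_diff_cancel(1)[OF mem(1,2)] tu(3) by (simp add: a_minus_def)
      then have "u \<in> (N ?n <+>\<^bsub>M\<^esub> T) \<inter> U" using x Tc(4)[OF tu(1)] tu(2) unfolding set_add_def' by blast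
      then have "u \<in> N i <+>\<^bsub>M\<^esub> T" using n2[of i] n2[of ?n] i by auto
      then obtain y s where ys: "y \<in> N i" "s \<in> T" "u = y \<oplus>\<^bsub>M\<^esub> s" unfolding set_add_def' by blast
      have mem': "y \<in> carrier M" "s \<in> carrier M" using ys Tc(1) Nc(1) by auto
      have xe: "x = y \<oplus>\<^bsub>M\<^esub> (t \<oplus>\<^bsub>M\<^esub> s)"
        unfolding tu(3) ys(3) using mem mem' by (simp add: M.add.m_lcomm)
      have "x \<ominus>\<^bsub>M\<^esub> y = t \<oplus>\<^bsub>M\<^esub> s" unfolding xe using add_diff_cancel(1)[OF mem'(1), of "t \<oplus>\<^bsub>M\<^esub> s"] mem mem' by simp
      moreover have "x \<ominus>\<^bsub>M\<^esub> y \<in> N ?n" using Nc'(5) x ys(1) sub by blast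
      ultimately have "t \<oplus>\<^bsub>M\<^esub> s \<in> N ?n \<inter> T" using Tc(3)[OF tu(1) ys(2)] by simp
      then have "t \<oplus>\<^bsub>M\<^esub> s \<in> N i" using n1[of i] n1[of ?n] i by auto
      then show "x \<in> N i" unfolding xe by (rule Nc(3)[OF ys(1)])
    qed
  qed
  then show "\<exists>n. \<forall>i\<ge>n. N i = N n" by blast
qed

lemma linear_map_smult:
  assumes "x \<in> carrier R"
  shows "linear_map R M M (\<lambda>v. x \<odot>\<^bsub>M\<^esub> v)"
  using assms smult_assoc1[symmetric] by (auto simp: linear_map_def smult_r_distr m_comm)

text \<open>The dual of the argument that \<open>M\<close> is Noetherian when \<open>M / x M\<close> is and \<open>M\<close> is \<open>x\<close>-adically
  separated: for a submodule \<open>N\<close> the submodules \<open>x\<^sup>i N \<inter> ker x\<close> descend in \<open>i\<close> and determine \<open>N\<close>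
  within any larger submodule.\<close>

lemma dcc_below_nilpotent:
  assumes x: "x \<in> carrier R" and T: "submodule T R M"
    and nil: "\<And>v. v \<in> T \<Longrightarrow> \<exists>k::nat. (x [^] k) \<odot>\<^bsub>M\<^esub> v = \<zero>\<^bsub>M\<^esub>"
    and dcc: "dcc_below R M {v \<in> T. x \<odot>\<^bsub>M\<^esub> v = \<zero>\<^bsub>M\<^esub>}"
  shows "dcc_below R M T"
proof (rule dcc_belowI)
  note [simp] = x
  note Tc = submodule_closed[OF T]
  fix N :: "nat \<Rightarrow> 'c set"
  assume N: "\<And>i. submodule (N i) R M" "\<And>i. N i \<subseteq> T" "\<And>i. N (Suc i) \<subseteq> N i" "\<And>i k. i \<le> k \<Longrightarrow> N k \<subseteq> N i"
  note Nc = submodule_closed[OF N(1)]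
  define D where "D j i = (\<lambda>v. (x [^] (i::nat)) \<odot>\<^bsub>M\<^esub> v) ` N j \<inter> {v \<in> carrier M. x \<odot>\<^bsub>M\<^esub> v \<in> {\<zero>\<^bsub>M\<^esub>}}" for j i
  have subD: "submodule (D j i) R M" for j i
    unfolding D_def
    by (intro submodule_Int submodule_image[OF linear_map_smult module_axioms N(1)]
        submodule_preimage[OF linear_map_smult module_axioms submodule_zero]) simp_all
  have DT: "D j i \<subseteq> {v \<in> T. x \<odot>\<^bsub>M\<^esub> v = \<zero>\<^bsub>M\<^esub>}" for j i
    using N(2)[of j] Tc(6) by (auto simp: D_def)
  have D1: "D k i \<subseteq> D j i" if "j \<le> k" for i j k
    using N(4)[OF that] unfolding D_def by blast
  have D2: "D j (Suc i) \<subseteq> D j i" for j i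
  proof
    fix w assume "w \<in> D j (Suc i)"
    then obtain v where v: "v \<in> N j" "w = (x [^] Suc i) \<odot>\<^bsub>M\<^esub> v" "w \<in> carrier M" "x \<odot>\<^bsub>M\<^esub> w = \<zero>\<^bsub>M\<^esub>"
      by (auto simp: D_def)
    have "w = (x [^] i) \<odot>\<^bsub>M\<^esub> (x \<odot>\<^bsub>M\<^esub> v)" using v(1,2) Nc(1) by (simp add: smult_assoc1 subset_iff)
    moreover have "x \<odot>\<^bsub>M\<^esub> v \<in> N j" using Nc(6) v(1) by simp
    ultimately show "w \<in> D j i" using v(3,4) by (auto simp: D_def)
  qed
  have D2': "D j k \<subseteq> D j i" if "i \<le> k" for i j k
    using lift_Suc_antimono_le[of "D j", OF D2 that] by blast
  have D12: "D k l \<subseteq> D j i" if "j \<le> k" "i \<le> l" for i j k l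
    using D1[OF that(1)] D2'[OF that(2)] by blast
  \<comment> \<open>The diagonal is constant from K on. For i beyond K, every \<open>D j i\<close>
    with j at least K is squeezed between diagonal members; for the finitely many other i the
    sequences \<open>D j i\<close> stabilize separately in j, and \<open>?J\<close> is past all of
    these stages.\<close>
  have "\<exists>n. \<forall>k\<ge>n. D k k = D n n"
    by (rule dcc_belowD[OF dcc, of "\<lambda>k. D k k"]) (rule subD DT D12; simp)+
  then obtain K where K: "\<And>k. k \<ge> K \<Longrightarrow> D k k = D K K" by blast
  have "\<exists>n. \<forall>k\<ge>n. D k i = D n i" for i
    by (rule dcc_belowD[OF dcc, of "\<lambda>k. D k i"]) (rule subD DT D12; simp)+
  then obtain n where n: "\<And>i k. k \<ge> n i \<Longrightarrow> D k i = D (n i) i" by metis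
  let ?J = "Max (insert K (n ` {..K}))"
  have J: "K \<le> ?J" by simp
  have nJ: "n i \<le> ?J" if "i \<le> K" for i using that by (intro Max_ge) auto
  have stable: "D j i = D ?J i" if j: "j \<ge> ?J" for i j
  proof (cases "i \<le> K")
    case True
    then show ?thesis using n[of i j] n[of i ?J] nJ[OF True] j by auto
  next
    case False
    have eq: "D l i = D K K" if "l \<ge> K" for l
    proof
      show "D l i \<subseteq> D K K" by (rule D12) (use that False in auto)
      have "D (max l i) (max l i) \<subseteq> D l i" by (rule D12) auto
      then show "D K K \<subseteq> D l i" using K[of "max l i"] that by auto
    qed
    show ?thesis using eq[of j] eq[of ?J] J j by simp
  qed
  have "N j = N ?J" if j: "j \<ge> ?J" for j
  proof
    show sub: "N j \<subseteq> N ?J" by (rule N(4)[OF j])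
    \<comment> \<open>If \<open>x^(i+1)\<close> kills w, then \<open>x^i w\<close> lies in
      \<open>D ?J i = D j i\<close>; subtracting from w a preimage in \<open>N j\<close> leaves an
      element killed by \<open>x^i\<close>.\<close>
    have "\<forall>w\<in>N ?J. (x [^] i) \<odot>\<^bsub>M\<^esub> w = \<zero>\<^bsub>M\<^esub> \<longrightarrow> w \<in> N j" for i :: nat
    proof (induction i)
      case 0
      have "w = \<zero>\<^bsub>M\<^esub>" if "w \<in> N ?J" "(x [^] (0::nat)) \<odot>\<^bsub>M\<^esub> w = \<zero>\<^bsub>M\<^esub>" for w
        using that Nc(1)[of ?J] by auto
      then show ?case using Nc(2)[of j] by blast
    next
      case (Suc i)
      show ?case
      proof (intro ballI impI)
        fix w assume w: "w \<in> N ?J" "(x [^] Suc i) \<odot>\<^bsub>M\<^esub> w = \<zero>\<^bsub>M\<^esub>"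
        have wM: "w \<in> carrier M" using w(1) Nc(1) by blast
        have "x \<odot>\<^bsub>M\<^esub> ((x [^] i) \<odot>\<^bsub>M\<^esub> w) = \<zero>\<^bsub>M\<^esub>"
          using w(2) wM by (simp add: smult_assoc1[symmetric] m_comm)
        then have "(x [^] i) \<odot>\<^bsub>M\<^esub> w \<in> D ?J i" using w(1) wM by (auto simp: D_def)
        then have "(x [^] i) \<odot>\<^bsub>M\<^esub> w \<in> D j i" using stable[OF j] by simp
        then obtain u where u: "u \<in> N j" "(x [^] i) \<odot>\<^bsub>M\<^esub> w = (x [^] i) \<odot>\<^bsub>M\<^esub> u" by (auto simp: D_def)
        have uM: "u \<in> carrier M" using u(1) Nc(1) by blast
        have "(x [^] i) \<odot>\<^bsub>M\<^esub> (w \<ominus>\<^bsub>M\<^esub> u) = \<zero>\<^bsub>M\<^esub>"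
          using linear_map_closed(5)[OF linear_map_smult[of "x [^] i"] module_axioms wM uM] u(2) uM
          by (simp add: a_minus_def M.r_neg)
        moreover have "w \<ominus>\<^bsub>M\<^esub> u \<in> N ?J" using Nc(5) w(1) u(1) sub by blast
        ultimately have "w \<ominus>\<^bsub>M\<^esub> u \<in> N j" using Suc.IH by blast
        then have "(w \<ominus>\<^bsub>M\<^esub> u) \<oplus>\<^bsub>M\<^esub> u \<in> N j" using Nc(3) u(1) by blast
        then show "w \<in> N j" using add_diff_cancel(2)[OF wM uM] by simp
      qed
    qed
    then show "N ?J \<subseteq> N j" using nil N(2)[of ?J] by blast
  qed
  then show "\<exists>n. \<forall>i\<ge>n. N i = N n" by blast
qed

text \<open>The descending chain condition makes strict inclusion of submodules
  well-founded.\<close>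

lemma exists_minimal_submodule:
  assumes dcc: "dcc_below R M (carrier M)" and "\<exists>T. submodule T R M \<and> Q T"
  obtains T where "submodule T R M" "Q T" "\<And>U. \<lbrakk>submodule U R M; U \<subset> T\<rbrakk> \<Longrightarrow> \<not> Q U"
proof -
  let ?r = "{(U, T). submodule U R M \<and> submodule T R M \<and> U \<subset> T}"
  let ?Q = "{T. submodule T R M \<and> Q T}"
  have wf: "wf ?r"
    unfolding wf_iff_no_infinite_down_chain
  proof
    assume "\<exists>f. \<forall>i. (f (Suc i), f i) \<in> ?r"
    then obtain f where f: "\<And>i. submodule (f i) R M" "\<And>i. f (Suc i) \<subset> f i" by blast
    have "\<exists>n. \<forall>i\<ge>n. f i = f n"
      by (rule dcc_belowD[OF dcc f(1) submodule_closed(1)[OF f(1)]]) (use f(2) in blast)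
    then obtain n where n: "\<forall>i\<ge>n. f i = f n" by (rule exE)
    have "f (Suc n) = f n" by (rule mp[OF spec[OF n]]) simp
    then show False using f(2)[of n] by simp
  qed
  obtain T0 where "T0 \<in> ?Q" using assms(2) by blast
  then have "\<exists>T\<in>?Q. \<forall>U. (U, T) \<in> ?r \<longrightarrow> U \<notin> ?Q"
    by (rule mp[OF spec[OF spec[OF iffD1[OF wf_eq_minimal wf]]]])
  then obtain T where T: "T \<in> ?Q" "\<forall>U. (U, T) \<in> ?r \<longrightarrow> U \<notin> ?Q" by (rule bexE)
  show ?thesis by (rule that[of T]) (use T in auto)
qed

end

section \<open>Restriction of scalars along an endomorphism\<close>

definition restrict_scalars ::
    "('a \<Rightarrow> 'a) \<Rightarrow> ('a, 'b, 'm) module_scheme \<Rightarrow> ('a, 'b, 'm) module_scheme"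
  where "restrict_scalars \<phi> M = M\<lparr>smult := \<lambda>r v. \<phi> r \<odot>\<^bsub>M\<^esub> v\<rparr>"

lemma restrict_scalars_simps [simp]:
  "carrier (restrict_scalars \<phi> M) = carrier M"
  "ring.add (restrict_scalars \<phi> M) = ring.add M"
  "\<zero>\<^bsub>restrict_scalars \<phi> M\<^esub> = \<zero>\<^bsub>M\<^esub>"
  "r \<odot>\<^bsub>restrict_scalars \<phi> M\<^esub> v = \<phi> r \<odot>\<^bsub>M\<^esub> v"
  by (simp_all add: restrict_scalars_def)

lemma module_restrict_scalars:
  assumes "module R M" "\<phi> \<in> ring_hom R R"
  shows "module R (restrict_scalars \<phi> M)"
proof -
  interpret module R M by fact
  show ?thesis
  proof (rule moduleI)
    show "cring R" by (rule R.is_cring)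
    have "comm_group (add_monoid (restrict_scalars \<phi> M))" using M.a_comm_group by simp
    then show "abelian_group (restrict_scalars \<phi> M)" by (rule comm_group_abelian_groupI)
  qed (use ring_hom_memE[OF assms(2)] in \<open>auto simp: smult_l_distr smult_r_distr smult_assoc1\<close>)
qed

lemma submodule_restrict_scalars:
  assumes "module R M" "\<phi> \<in> ring_hom R R" "submodule N R M"
  shows "submodule N R (restrict_scalars \<phi> M)"
proof -
  interpret M: module R M by fact
  interpret r: module R "restrict_scalars \<phi> M" by (rule module_restrict_scalars) fact+
  show ?thesis
    by (rule r.submoduleI') (use M.submodule_closed[OF assms(3)] ring_hom_memE(1)[OF assms(2)] in auto)
qed

section \<open>Quotients and coassociated primes\<close>

context module
begin

lemma coset_abelian_subgroup:
  assumes "submodule N R M"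
  shows "abelian_subgroup N M"
  by (rule abelian_subgroupI3[OF additive_subgroup.intro[OF submodule.axioms(1)[OF assms]] M.abelian_group_axioms])

lemma coset_eq_iff:
  assumes N: "submodule N R M" and xy: "x \<in> carrier M" "y \<in> carrier M"
  shows "N +>\<^bsub>M\<^esub> x = N +>\<^bsub>M\<^esub> y \<longleftrightarrow> x \<ominus>\<^bsub>M\<^esub> y \<in> N"
proof -
  interpret N: abelian_subgroup N M by (rule coset_abelian_subgroup[OF N])
  have "N +>\<^bsub>M\<^esub> x = N +>\<^bsub>M\<^esub> y \<longleftrightarrow> x \<in> N +>\<^bsub>M\<^esub> y"
    using N.a_repr_independence'[of x y] N.a_repr_independenceD[of x y] xy by auto
  also have "\<dots> \<longleftrightarrow> x \<ominus>\<^bsub>M\<^esub> y \<in> N"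
    using N.a_rcos_module[OF xy(2,1)] by (simp add: a_minus_def)
  finally show ?thesis .
qed

lemma coset_eq_self_iff:
  assumes N: "submodule N R M" and x: "x \<in> carrier M"
  shows "N +>\<^bsub>M\<^esub> x = N \<longleftrightarrow> x \<in> N"
proof -
  interpret N: abelian_subgroup N M by (rule coset_abelian_subgroup[OF N])
  have "N +>\<^bsub>M\<^esub> \<zero>\<^bsub>M\<^esub> = N" by (rule N.a_rcos_const) (rule submodule_closed(2)[OF N])
  moreover have "x \<ominus>\<^bsub>M\<^esub> \<zero>\<^bsub>M\<^esub> = x" using add_diff_cancel(2)[OF x M.zero_closed] x by simp
  ultimately show ?thesis using coset_eq_iff[OF N x M.zero_closed] by simp
qed

lemma quotient_module_simps:
  assumes N: "submodule N R M"
  shows "carrier (quotient_module M N) = (\<lambda>x. N +>\<^bsub>M\<^esub> x) ` carrier M"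
    and "\<zero>\<^bsub>quotient_module M N\<^esub> = N"
    and "\<And>x y. \<lbrakk>x \<in> carrier M; y \<in> carrier M\<rbrakk> \<Longrightarrow>
      (N +>\<^bsub>M\<^esub> x) \<oplus>\<^bsub>quotient_module M N\<^esub> (N +>\<^bsub>M\<^esub> y) = N +>\<^bsub>M\<^esub> (x \<oplus>\<^bsub>M\<^esub> y)"
    and "\<And>r x. \<lbrakk>r \<in> carrier R; x \<in> carrier M\<rbrakk> \<Longrightarrow>
      r \<odot>\<^bsub>quotient_module M N\<^esub> (N +>\<^bsub>M\<^esub> x) = N +>\<^bsub>M\<^esub> (r \<odot>\<^bsub>M\<^esub> x)"
proof -
  interpret N: abelian_subgroup N M by (rule coset_abelian_subgroup[OF N])
  show "carrier (quotient_module M N) = (\<lambda>x. N +>\<^bsub>M\<^esub> x) ` carrier M"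
    by (auto simp: quotient_module_def A_RCOSETS_def' a_r_coset_def')
  show "\<zero>\<^bsub>quotient_module M N\<^esub> = N" by (simp add: quotient_module_def)
  show "(N +>\<^bsub>M\<^esub> x) \<oplus>\<^bsub>quotient_module M N\<^esub> (N +>\<^bsub>M\<^esub> y) = N +>\<^bsub>M\<^esub> (x \<oplus>\<^bsub>M\<^esub> y)"
    if "x \<in> carrier M" "y \<in> carrier M" for x y
    using N.a_rcos_sum[OF that] by (simp add: quotient_module_def)
  fix r x assume r: "r \<in> carrier R" and x: "x \<in> carrier M"
  have "N +>\<^bsub>M\<^esub> (r \<odot>\<^bsub>M\<^esub> y) = N +>\<^bsub>M\<^esub> (r \<odot>\<^bsub>M\<^esub> x)" if "y \<in> N +>\<^bsub>M\<^esub> x" for y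
  proof -
    have y: "y \<in> carrier M" using N.a_elemrcos_carrier[OF x that] .
    have "y \<ominus>\<^bsub>M\<^esub> x \<in> N" using N.a_rcos_module[OF x y] that by (simp add: a_minus_def)
    then have "r \<odot>\<^bsub>M\<^esub> (y \<ominus>\<^bsub>M\<^esub> x) \<in> N" using submodule_closed(6)[OF N r] by blast
    then have "r \<odot>\<^bsub>M\<^esub> y \<ominus>\<^bsub>M\<^esub> r \<odot>\<^bsub>M\<^esub> x \<in> N"
      using linear_map_closed(5)[OF linear_map_smult[OF r] module_axioms y x] by simp
    then show ?thesis using coset_eq_iff[OF N] r x y by simp
  qed
  moreover have "x \<in> N +>\<^bsub>M\<^esub> x" using N.a_rcos_self[OF x] .
  ultimately have "(\<Union>y\<in>N +>\<^bsub>M\<^esub> x. N +>\<^bsub>M\<^esub> (r \<odot>\<^bsub>M\<^esub> y)) = N +>\<^bsub>M\<^esub> (r \<odot>\<^bsub>M\<^esub> x)" by blast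
  then show "r \<odot>\<^bsub>quotient_module M N\<^esub> (N +>\<^bsub>M\<^esub> x) = N +>\<^bsub>M\<^esub> (r \<odot>\<^bsub>M\<^esub> x)"
    by (simp add: quotient_module_def)
qed

lemma module_quotient:
  assumes N: "submodule N R M"
  shows "module R (quotient_module M N)"
proof (rule moduleI)
  let ?Q = "quotient_module M N"
  note q = quotient_module_simps[OF N]
  show "cring R" by (rule R.is_cring)
  show "abelian_group ?Q"
  proof (rule abelian_groupI)
    show "\<zero>\<^bsub>?Q\<^esub> \<in> carrier ?Q"
      using coset_eq_self_iff[OF N M.zero_closed] submodule_closed(2)[OF N] unfolding q(1,2) by blast
    show "\<exists>y\<in>carrier ?Q. y \<oplus>\<^bsub>?Q\<^esub> x = \<zero>\<^bsub>?Q\<^esub>" if "x \<in> carrier ?Q" for x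
    proof -
      obtain v where v: "x = N +>\<^bsub>M\<^esub> v" "v \<in> carrier M" using \<open>x \<in> carrier ?Q\<close> unfolding q(1) by blast
      have "(N +>\<^bsub>M\<^esub> (\<ominus>\<^bsub>M\<^esub> v)) \<oplus>\<^bsub>?Q\<^esub> x = \<zero>\<^bsub>?Q\<^esub>"
        using q(3)[of "\<ominus>\<^bsub>M\<^esub> v" v] v coset_eq_self_iff[OF N M.zero_closed] submodule_closed(2)[OF N]
        by (simp add: M.l_neg q(2))
      then show ?thesis using v(2) unfolding q(1) by blast
    qed
    show "\<zero>\<^bsub>?Q\<^esub> \<oplus>\<^bsub>?Q\<^esub> x = x" if "x \<in> carrier ?Q" for x
    proof -
      obtain v where v: "x = N +>\<^bsub>M\<^esub> v" "v \<in> carrier M" using \<open>x \<in> carrier ?Q\<close> unfolding q(1) by blast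
      have "N +>\<^bsub>M\<^esub> \<zero>\<^bsub>M\<^esub> = N" using coset_eq_self_iff[OF N M.zero_closed] submodule_closed(2)[OF N] by simp
      then show ?thesis using q(3)[of "\<zero>\<^bsub>M\<^esub>" v] v by (simp add: q(2))
    qed
  qed (auto simp: q(1,3) M.a_ac)
qed (use quotient_module_simps[OF N] in \<open>auto simp: smult_l_distr smult_r_distr smult_assoc1\<close>)

lemma linear_map_coset:
  assumes N: "submodule N R M"
  shows "linear_map R M (quotient_module M N) (\<lambda>x. N +>\<^bsub>M\<^esub> x)"
  using quotient_module_simps[OF N] by (auto simp: linear_map_def)

lemma annihilator_quotient:
  assumes N: "submodule N R M"
  shows "annihilator R (quotient_module M N) = {r \<in> carrier R. \<forall>x\<in>carrier M. r \<odot>\<^bsub>M\<^esub> x \<in> N}"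
proof -
  have "(\<forall>A\<in>carrier (quotient_module M N). r \<odot>\<^bsub>quotient_module M N\<^esub> A = \<zero>\<^bsub>quotient_module M N\<^esub>) \<longleftrightarrow>
      (\<forall>x\<in>carrier M. r \<odot>\<^bsub>M\<^esub> x \<in> N)" if r: "r \<in> carrier R" for r
  proof -
    have "N +>\<^bsub>M\<^esub> (r \<odot>\<^bsub>M\<^esub> x) = N \<longleftrightarrow> r \<odot>\<^bsub>M\<^esub> x \<in> N" if "x \<in> carrier M" for x
      by (rule coset_eq_self_iff[OF N smult_closed[OF r that]])
    then show ?thesis
      unfolding quotient_module_simps(1,2)[OF N] ball_simps(9) using quotient_module_simps(4)[OF N r] by simp
  qed
  then show ?thesis unfolding annihilator_def by blast
qed

lemma artinian_quotient:
  assumes N: "submodule N R M"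
    and dcc: "\<And>V :: nat \<Rightarrow> 'c set. \<lbrakk>\<And>i. submodule (V i) R M; \<And>i. N \<subseteq> V i; \<And>i. V (Suc i) \<subseteq> V i\<rbrakk>
      \<Longrightarrow> \<exists>n. \<forall>i\<ge>n. V i = V n"
  shows "artinian_module R (quotient_module M N)"
  unfolding artinian_module_iff
proof
  let ?Q = "quotient_module M N"
  show Q: "module R ?Q" by (rule module_quotient[OF N])
  interpret Q: module R ?Q by (rule Q)
  note q = quotient_module_simps[OF N]
  show "dcc_below R ?Q (carrier ?Q)"
  proof (rule dcc_belowI)
    fix W :: "nat \<Rightarrow> 'c set set"
    assume W: "\<And>i. submodule (W i) R ?Q" "\<And>i. W i \<subseteq> carrier ?Q" "\<And>i. W (Suc i) \<subseteq> W i"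
    define V where "V i = {x \<in> carrier M. N +>\<^bsub>M\<^esub> x \<in> W i}" for i
    have "\<exists>n. \<forall>i\<ge>n. V i = V n"
    proof (rule dcc)
      show "submodule (V i) R M" for i
        unfolding V_def by (rule submodule_preimage[OF linear_map_coset[OF N] Q W(1)])
      show "V (Suc i) \<subseteq> V i" for i using W(3) by (auto simp: V_def)
      show "N \<subseteq> V i" for i
      proof
        fix x assume x: "x \<in> N"
        then have "x \<in> carrier M" "N +>\<^bsub>M\<^esub> x = N" using submodule_closed(1)[OF N] coset_eq_self_iff[OF N] by auto
        then show "x \<in> V i" using Q.submodule_closed(2)[OF W(1)[of i]] q(2) by (simp add: V_def)
      qed
    qed
    moreover have "W i = (\<lambda>x. N +>\<^bsub>M\<^esub> x) ` V i" for i
      using W(2)[of i] unfolding q(1) V_def by auto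
    ultimately show "\<exists>n. \<forall>i\<ge>n. W i = W n" by metis
  qed
qed

text \<open>\<open>M\<close> modulo the kernel of f is isomorphic to the image of f, so a map whose
  image satisfies the chain condition can take the place of an Artinian quotient.\<close>

lemma coassociated_via_linear_map:
  assumes L: "module R L" and f: "linear_map R M L f" and dcc: "dcc_below R L (f ` carrier M)"
    and p: "primeideal p R" "p = {r \<in> carrier R. \<forall>x\<in>carrier M. r \<odot>\<^bsub>L\<^esub> f x = \<zero>\<^bsub>L\<^esub>}"
  shows "p \<in> Coass R M"
proof -
  interpret L: module R L by fact
  note fc = linear_map_closed[OF f L]
  let ?N = "{x \<in> carrier M. f x \<in> {\<zero>\<^bsub>L\<^esub>}}"
  have N: "submodule ?N R M" by (rule submodule_preimage[OF f L L.submodule_zero])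
  have "artinian_module R (quotient_module M ?N)"
  proof (rule artinian_quotient[OF N])
    fix V :: "nat \<Rightarrow> 'c set"
    assume V: "\<And>i. submodule (V i) R M" "\<And>i. ?N \<subseteq> V i" "\<And>i. V (Suc i) \<subseteq> V i"
    have "\<exists>n. \<forall>i\<ge>n. f ` V i = f ` V n"
      by (rule dcc_belowD[OF dcc, of "\<lambda>i. f ` V i"])
        (rule submodule_image[OF f L V(1)] image_mono submodule_closed(1)[OF V(1)] V(3))+
    \<comment> \<open>\<open>V i\<close> contains the kernel of f, so it is recovered from its
      image.\<close>
    moreover have "V i = {x \<in> carrier M. f x \<in> f ` V i}" for i
    proof
      note Vc = submodule_closed[OF V(1)[of i]]
      show "V i \<subseteq> {x \<in> carrier M. f x \<in> f ` V i}" using Vc(1) by auto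
      show "{x \<in> carrier M. f x \<in> f ` V i} \<subseteq> V i"
      proof
        fix x assume "x \<in> {x \<in> carrier M. f x \<in> f ` V i}"
        then obtain y where xy: "x \<in> carrier M" "y \<in> V i" "f x = f y" by blast
        have y: "y \<in> carrier M" using xy(2) Vc(1) by blast
        have "f (x \<ominus>\<^bsub>M\<^esub> y) = \<zero>\<^bsub>L\<^esub>"
          using fc(5)[OF xy(1) y] xy(3) fc(1)[OF y] by (simp add: a_minus_def L.M.r_neg)
        then have "x \<ominus>\<^bsub>M\<^esub> y \<in> V i" using V(2)[of i] xy(1) y by auto
        then have "(x \<ominus>\<^bsub>M\<^esub> y) \<oplus>\<^bsub>M\<^esub> y \<in> V i" using Vc(3) xy(2) by blast
        then show "x \<in> V i" using add_diff_cancel(2)[OF xy(1) y] by simp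
      qed
    qed
    ultimately show "\<exists>n. \<forall>i\<ge>n. V i = V n" by metis
  qed
  moreover have "p = annihilator R (quotient_module M ?N)"
    unfolding annihilator_quotient[OF N] p(2) using fc(3) by auto
  ultimately show ?thesis using N p(1) unfolding Coass_def by blast
qed

lemma coassociatedE:
  assumes "p \<in> Coass R M"
  obtains N where "submodule N R M" "artinian_module R (quotient_module M N)"
    "primeideal p R" "p = annihilator R (quotient_module M N)"
  using assms unfolding Coass_def by blast

lemma Coass_surjective:
  assumes L: "module R L" and f: "linear_map R M L f" and surj: "f ` carrier M = carrier L"
  shows "Coass R L \<subseteq> Coass R M"
proof
  fix p assume "p \<in> Coass R L"
  interpret L: module R L by fact
  note fc = linear_map_closed[OF f L]
  obtain N where N: "submodule N R L" "artinian_module R (quotient_module L N)"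
    "primeideal p R" "p = annihilator R (quotient_module L N)"
    using \<open>p \<in> Coass R L\<close> by (rule L.coassociatedE)
  note q = L.quotient_module_simps[OF N(1)]
  show "p \<in> Coass R M"
  proof (rule coassociated_via_linear_map[OF L.module_quotient[OF N(1)] _ _ N(3)])
    show "linear_map R M (quotient_module L N) (\<lambda>x. N +>\<^bsub>L\<^esub> f x)"
      using fc q by (auto simp: linear_map_def)
    have "(\<lambda>x. N +>\<^bsub>L\<^esub> f x) ` carrier M \<subseteq> carrier (quotient_module L N)" using fc(1) q(1) by auto
    then show "dcc_below R (quotient_module L N) ((\<lambda>x. N +>\<^bsub>L\<^esub> f x) ` carrier M)"
      using N(2) dcc_below_mono unfolding artinian_module_iff by blast
    have "carrier (quotient_module L N) = (\<lambda>x. N +>\<^bsub>L\<^esub> f x) ` carrier M"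
      unfolding q(1) surj[symmetric] by auto
    then show "p = {r \<in> carrier R. \<forall>x\<in>carrier M. r \<odot>\<^bsub>quotient_module L N\<^esub> (N +>\<^bsub>L\<^esub> f x) = \<zero>\<^bsub>quotient_module L N\<^esub>}"
      unfolding N(4) annihilator_def by auto
  qed
qed

lemma submodule_smult_image:
  assumes "r \<in> carrier R" "submodule T R M"
  shows "submodule ((\<lambda>v. r \<odot>\<^bsub>M\<^esub> v) ` T) R M"
  by (rule submodule_image[OF linear_map_smult[OF assms(1)] module_axioms assms(2)])

text \<open>Among the ideals \<open>(N : M)\<close> contained in \<open>p\<close> a maximal one is \<open>p\<close> itself: otherwise \<open>N\<close> can be
  enlarged by \<open>r M\<close> for some \<open>r \<in> p\<close>, and \<open>t M \<subseteq> N + r M\<close> implies \<open>t\<^sup>k M \<subseteq> N + r\<^sup>k M\<close>.\<close>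

lemma coassociated_radical_annihilator:
  assumes noeth: "noetherian_ring R" and art: "dcc_below R M (carrier M)" and p: "primeideal p R"
    and ann: "annihilator R M \<subseteq> p"
    and nil: "\<And>r. r \<in> p \<Longrightarrow> \<exists>k::nat. r [^] k \<in> annihilator R M"
  shows "p \<in> Coass R M"
proof -
  interpret N: noetherian_cring R
    by (intro noetherian_cring.intro R.is_cring noeth)
  note pi = R.primeideal_closed(1)[OF p]
  define colon where "colon N = {r \<in> carrier R. \<forall>x\<in>carrier M. r \<odot>\<^bsub>M\<^esub> x \<in> N}" for N
  have ideal_colon: "ideal (colon N) R" if N: "submodule N R M" for N
    using submodule_closed[OF N]
    by (intro R.idealI') (auto simp: colon_def smult_l_distr smult_assoc1)
  let ?F = "colon ` {N. submodule N R M \<and> colon N \<subseteq> p}"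
  have "annihilator R M = colon {\<zero>\<^bsub>M\<^esub>}" by (auto simp: annihilator_def colon_def)
  then have "colon {\<zero>\<^bsub>M\<^esub>} \<in> ?F" using ann submodule_zero by blast
  then have "\<exists>q\<in>?F. \<forall>I\<in>?F. q \<subseteq> I \<longrightarrow> I = q"
    by (intro N.exists_maximal_ideal_in) (use ideal_colon in auto)
  then obtain q where q: "q \<in> ?F" "\<forall>I\<in>?F. q \<subseteq> I \<longrightarrow> I = q" by (rule bexE)
  then obtain N where N: "submodule N R M" "colon N \<subseteq> p" "q = colon N" by blast
  note Nc = submodule_closed[OF N(1)]
  have "p \<subseteq> colon N"
  proof
    fix r assume r: "r \<in> p"
    have rc: "r \<in> carrier R" using R.ideal_closed(1)[OF pi r] .
    show "r \<in> colon N"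
    proof (rule ccontr)
      assume neg: "r \<notin> colon N"
      let ?U = "N <+>\<^bsub>M\<^esub> (\<lambda>v. r \<odot>\<^bsub>M\<^esub> v) ` carrier M"
      have rM: "submodule ((\<lambda>v. r \<odot>\<^bsub>M\<^esub> v) ` carrier M) R M"
        by (rule submodule_smult_image[OF rc carrier_is_submodule])
      have U: "submodule ?U R M" by (rule submodule_sum[OF N(1) rM])
      have sup: "N \<subseteq> ?U" "(\<lambda>v. r \<odot>\<^bsub>M\<^esub> v) ` carrier M \<subseteq> ?U" by (rule submodule_sum_superset[OF N(1) rM])+
      have "r \<in> colon ?U" using sup(2) rc unfolding colon_def by blast
      moreover have "q \<subseteq> colon ?U" using sup(1) unfolding N(3) colon_def by blast
      ultimately have "\<not> colon ?U \<subseteq> p" using q(2) U neg N(3) by blast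
      then obtain t where t: "t \<in> carrier R" "t \<notin> p" "\<And>x. x \<in> carrier M \<Longrightarrow> t \<odot>\<^bsub>M\<^esub> x \<in> ?U"
        unfolding colon_def by blast
      have pow: "\<forall>x\<in>carrier M. \<exists>n\<in>N. \<exists>v\<in>carrier M. (t [^] k) \<odot>\<^bsub>M\<^esub> x = n \<oplus>\<^bsub>M\<^esub> (r [^] k) \<odot>\<^bsub>M\<^esub> v" for k :: nat
      proof (induction k)
        case 0
        show ?case
        proof
          fix x assume x: "x \<in> carrier M"
          then have "(t [^] (0::nat)) \<odot>\<^bsub>M\<^esub> x = \<zero>\<^bsub>M\<^esub> \<oplus>\<^bsub>M\<^esub> (r [^] (0::nat)) \<odot>\<^bsub>M\<^esub> x" by simp
          then show "\<exists>n\<in>N. \<exists>v\<in>carrier M. (t [^] (0::nat)) \<odot>\<^bsub>M\<^esub> x = n \<oplus>\<^bsub>M\<^esub> (r [^] (0::nat)) \<odot>\<^bsub>M\<^esub> v"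
            using Nc(2) x by blast
        qed
      next
        case (Suc k)
        show ?case
        proof
          fix x assume x: "x \<in> carrier M"
          obtain n v where n: "n \<in> N" "v \<in> carrier M" "(t [^] k) \<odot>\<^bsub>M\<^esub> x = n \<oplus>\<^bsub>M\<^esub> (r [^] k) \<odot>\<^bsub>M\<^esub> v"
            using Suc.IH x by blast
          obtain m w where m: "m \<in> N" "w \<in> carrier M" "t \<odot>\<^bsub>M\<^esub> v = m \<oplus>\<^bsub>M\<^esub> r \<odot>\<^bsub>M\<^esub> w"
            using t(3)[OF n(2)] unfolding set_add_def' by blast
          have mem: "n \<in> carrier M" "m \<in> carrier M" using n m Nc(1) by auto
          have "(t [^] Suc k) \<odot>\<^bsub>M\<^esub> x = t \<odot>\<^bsub>M\<^esub> ((t [^] k) \<odot>\<^bsub>M\<^esub> x)"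
            using t(1) x by (simp add: smult_assoc1[symmetric] R.m_comm)
          also have "\<dots> = t \<odot>\<^bsub>M\<^esub> n \<oplus>\<^bsub>M\<^esub> (r [^] k) \<odot>\<^bsub>M\<^esub> (t \<odot>\<^bsub>M\<^esub> v)"
            unfolding n(3) using t(1) n mem rc by (simp add: smult_r_distr smult_assoc1[symmetric] R.m_comm)
          also have "\<dots> = (t \<odot>\<^bsub>M\<^esub> n \<oplus>\<^bsub>M\<^esub> (r [^] k) \<odot>\<^bsub>M\<^esub> m) \<oplus>\<^bsub>M\<^esub> (r [^] Suc k) \<odot>\<^bsub>M\<^esub> w"
            unfolding m(3) using t(1) m mem rc by (simp add: smult_r_distr smult_assoc1 M.a_assoc)
          finally show "\<exists>n\<in>N. \<exists>v\<in>carrier M. (t [^] Suc k) \<odot>\<^bsub>M\<^esub> x = n \<oplus>\<^bsub>M\<^esub> (r [^] Suc k) \<odot>\<^bsub>M\<^esub> v"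
            using Nc(3)[OF Nc(6)[OF t(1) n(1)] Nc(6)[OF R.nat_pow_closed[OF rc] m(1)]] m(2) by blast
        qed
      qed
      \<comment> \<open>For this k the remainder \<open>r^k M\<close> is zero, so \<open>t^k\<close>
        multiplies \<open>M\<close> into \<open>N\<close>; then \<open>t^k\<close>, and with it t,
        would be in p.\<close>
      obtain k :: nat where k: "r [^] k \<in> annihilator R M" using nil[OF r] by blast
      have "(t [^] k) \<odot>\<^bsub>M\<^esub> x \<in> N" if x: "x \<in> carrier M" for x
      proof -
        obtain n v where n: "n \<in> N" "v \<in> carrier M" "(t [^] k) \<odot>\<^bsub>M\<^esub> x = n \<oplus>\<^bsub>M\<^esub> (r [^] k) \<odot>\<^bsub>M\<^esub> v"
          using pow x by blast
        have "(r [^] k) \<odot>\<^bsub>M\<^esub> v = \<zero>\<^bsub>M\<^esub>" using k n(2) by (simp add: annihilator_def)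
        then show ?thesis using n Nc(1) by auto
      qed
      then have "t [^] k \<in> colon N" using t(1) by (simp add: colon_def)
      then show False using R.primeideal_pow[OF p t(1)] N(2) t(2) by blast
    qed
  qed
  then have "p = annihilator R (quotient_module M N)"
    using N(2) unfolding annihilator_quotient[OF N(1)] colon_def by blast
  moreover have "artinian_module R (quotient_module M N)"
  proof (rule artinian_quotient[OF N(1)])
    fix V :: "nat \<Rightarrow> 'c set"
    assume V: "\<And>i. submodule (V i) R M" "\<And>i. N \<subseteq> V i" "\<And>i. V (Suc i) \<subseteq> V i"
    show "\<exists>n. \<forall>i\<ge>n. V i = V n"
      by (rule dcc_belowD[OF art, of V]) (rule V submodule_closed(1)[OF V(1)])+
  qed
  ultimately show ?thesis using N(1) p unfolding Coass_def by blast
qed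

end

section \<open>Restriction of scalars of Artinian modules\<close>

context noetherian_local_ring
begin

text \<open>The cyclic submodules generated by the \<open>y^k v\<close> descend, so
  \<open>y^n v = r y y^n v\<close> for some n and r, and \<open>1 - r y\<close> is a unit.\<close>

lemma nilpotent_on_artinian:
  assumes L: "module R L" and dcc: "dcc_below R L (carrier L)" and y: "y \<in> \<mm>" and v: "v \<in> carrier L"
  shows "\<exists>k::nat. (y [^] k) \<odot>\<^bsub>L\<^esub> v = \<zero>\<^bsub>L\<^esub>"
proof -
  interpret L: module R L by fact
  have [simp]: "y \<in> carrier R" using ideal_closed(1)[OF is_ideal y] .
  define W where "W k = (\<lambda>r. r \<odot>\<^bsub>L\<^esub> ((y [^] k) \<odot>\<^bsub>L\<^esub> v)) ` carrier R" for k :: nat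
  have W: "submodule (W k) R L" "(y [^] k) \<odot>\<^bsub>L\<^esub> v \<in> W k" for k
    unfolding W_def using v by (simp_all add: L.submodule_cyclic)
  have "W (Suc k) \<subseteq> W k" for k
  proof
    fix w assume "w \<in> W (Suc k)"
    then obtain r where r: "r \<in> carrier R" "w = r \<odot>\<^bsub>L\<^esub> ((y [^] Suc k) \<odot>\<^bsub>L\<^esub> v)" unfolding W_def by blast
    have "w = (r \<otimes> y) \<odot>\<^bsub>L\<^esub> ((y [^] k) \<odot>\<^bsub>L\<^esub> v)"
      unfolding r(2) using r(1) v by (simp add: L.smult_assoc1[symmetric] m_ac)
    then show "w \<in> W k" using imageI[of "r \<otimes> y" "carrier R"] r(1) unfolding W_def by simp
  qed
  then have "\<exists>n. \<forall>i\<ge>n. W i = W n"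
    by (intro dcc_belowD[OF dcc, of W]) (rule W(1) L.submodule_closed(1)[OF W(1)] | assumption)+
  then obtain n where n: "\<forall>i\<ge>n. W i = W n" by (rule exE)
  have "W (Suc n) = W n" by (rule mp[OF spec[OF n]]) simp
  let ?w = "(y [^] n) \<odot>\<^bsub>L\<^esub> v"
  have wL: "?w \<in> carrier L" using v by simp
  obtain r where r: "r \<in> carrier R" "?w = r \<odot>\<^bsub>L\<^esub> ((y [^] Suc n) \<odot>\<^bsub>L\<^esub> v)"
  proof -
    have "?w \<in> W (Suc n)" using W(2)[of n] \<open>W (Suc n) = W n\<close> by simp
    then show ?thesis unfolding W_def by (rule imageE) (rule that)
  qed
  have "r \<odot>\<^bsub>L\<^esub> ((y [^] Suc n) \<odot>\<^bsub>L\<^esub> v) = (r \<otimes> y) \<odot>\<^bsub>L\<^esub> ?w"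
    using r(1) v by (simp add: L.smult_assoc1[symmetric] m_ac)
  then have e: "?w = (r \<otimes> y) \<odot>\<^bsub>L\<^esub> ?w" using r(2) by simp
  have "(\<one> \<ominus> r \<otimes> y) \<odot>\<^bsub>L\<^esub> ?w = ?w \<ominus>\<^bsub>L\<^esub> (r \<otimes> y) \<odot>\<^bsub>L\<^esub> ?w"
    using wL r(1) by (simp add: a_minus_def L.smult_l_distr L.smult_l_minus)
  also have "\<dots> = ?w \<ominus>\<^bsub>L\<^esub> ?w" using e by simp
  also have "\<dots> = \<zero>\<^bsub>L\<^esub>" using wL by (simp add: a_minus_def L.M.r_neg)
  finally have z: "(\<one> \<ominus> r \<otimes> y) \<odot>\<^bsub>L\<^esub> ?w = \<zero>\<^bsub>L\<^esub>" .
  have "\<one> \<ominus> r \<otimes> y \<notin> \<mm>"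
  proof
    note mc = ideal_closed[OF is_ideal]
    assume "\<one> \<ominus> r \<otimes> y \<in> \<mm>"
    then have "(\<one> \<ominus> r \<otimes> y) \<oplus> r \<otimes> y \<in> \<mm>" using mc(3) mc(6)[OF y r(1)] by blast
    moreover have "(\<one> \<ominus> r \<otimes> y) \<oplus> r \<otimes> y = \<one>" using r(1) by (simp add: a_minus_def a_assoc l_neg)
    ultimately show False using primeideal_closed(2)[OF prime_m] by simp
  qed
  then obtain t where t: "t \<in> carrier R" "t \<otimes> (\<one> \<ominus> r \<otimes> y) = \<one>"
    using invertible_outside[of "\<one> \<ominus> r \<otimes> y"] r(1) by auto
  have "?w = (t \<otimes> (\<one> \<ominus> r \<otimes> y)) \<odot>\<^bsub>L\<^esub> ?w" using t wL by simp
  also have "\<dots> = t \<odot>\<^bsub>L\<^esub> ((\<one> \<ominus> r \<otimes> y) \<odot>\<^bsub>L\<^esub> ?w)" using t(1) r(1) wL by (simp add: L.smult_assoc1)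
  also have "\<dots> = \<zero>\<^bsub>L\<^esub>" using z t(1) by simp
  finally show ?thesis by blast
qed

text \<open>\<open>T\<close> is a vector space over R/\<mm>, and a subspace maximal among those that
  miss v is a hyperplane complementary to v.\<close>

lemma exists_complement_of_line:
  assumes L: "module R L" and T: "submodule T R L" and v: "v \<in> T" "v \<noteq> \<zero>\<^bsub>L\<^esub>"
    and kill: "\<And>x w. \<lbrakk>x \<in> \<mm>; w \<in> T\<rbrakk> \<Longrightarrow> x \<odot>\<^bsub>L\<^esub> w = \<zero>\<^bsub>L\<^esub>"
  obtains U where "submodule U R L" "U \<subset> T" "T \<subseteq> U <+>\<^bsub>L\<^esub> (\<lambda>r. r \<odot>\<^bsub>L\<^esub> v) ` carrier R"
proof -
  interpret L: module R L by fact
  note Tc = L.submodule_closed[OF T]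
  let ?F = "{U. submodule U R L \<and> U \<subseteq> T \<and> v \<notin> U}"
  have "{\<zero>\<^bsub>L\<^esub>} \<in> ?F" using L.submodule_zero Tc v by auto
  then have "?F \<noteq> {}" by blast
  then have "\<exists>U\<in>?F. \<forall>V\<in>?F. U \<subseteq> V \<longrightarrow> V = U"
  proof (rule subset_Zorn_nonempty)
    fix C assume C: "C \<noteq> {}" "subset.chain ?F C"
    then have CF: "\<And>U. U \<in> C \<Longrightarrow> submodule U R L \<and> U \<subseteq> T \<and> v \<notin> U"
      and ch: "\<And>U V. U \<in> C \<Longrightarrow> V \<in> C \<Longrightarrow> U \<subseteq> V \<or> V \<subseteq> U"
      by (auto simp: subset_chain_def)
    have cl: "U \<subseteq> carrier L" "\<zero>\<^bsub>L\<^esub> \<in> U" "\<And>a b. \<lbrakk>a \<in> U; b \<in> U\<rbrakk> \<Longrightarrow> a \<oplus>\<^bsub>L\<^esub> b \<in> U"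
      "\<And>r a. \<lbrakk>r \<in> carrier R; a \<in> U\<rbrakk> \<Longrightarrow> r \<odot>\<^bsub>L\<^esub> a \<in> U" if "U \<in> C" for U
      using L.submodule_closed CF[OF that] by auto
    have "submodule (\<Union>C) R L"
    proof (rule L.submoduleI')
      show "\<Union>C \<subseteq> carrier L" using cl(1) by blast
      show "\<zero>\<^bsub>L\<^esub> \<in> \<Union>C" using C(1) cl(2) by blast
      show "a \<oplus>\<^bsub>L\<^esub> b \<in> \<Union>C" if "a \<in> \<Union>C" "b \<in> \<Union>C" for a b
      proof -
        obtain U V where "U \<in> C" "V \<in> C" "a \<in> U" "b \<in> V" using \<open>a \<in> \<Union>C\<close> \<open>b \<in> \<Union>C\<close> by blast
        then show ?thesis using ch[of U V] cl(3) by blast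
      qed
      show "r \<odot>\<^bsub>L\<^esub> a \<in> \<Union>C" if "r \<in> carrier R" "a \<in> \<Union>C" for r a using that cl(4) by blast
    qed
    then show "\<Union>C \<in> ?F" using CF by blast
  qed
  then obtain U where U: "U \<in> ?F" "\<forall>V\<in>?F. U \<subseteq> V \<longrightarrow> V = U" by (rule bexE)
  have sU: "submodule U R L" "U \<subseteq> T" "v \<notin> U" using U(1) by auto
  note Uc = L.submodule_closed[OF sU(1)]
  have vL: "v \<in> carrier L" using v(1) Tc(1) by blast
  have Rv: "submodule ((\<lambda>r. r \<odot>\<^bsub>L\<^esub> v) ` carrier R) R L" by (rule L.submodule_cyclic[OF vL])
  have "w \<in> U <+>\<^bsub>L\<^esub> (\<lambda>r. r \<odot>\<^bsub>L\<^esub> v) ` carrier R" if w: "w \<in> T" for w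
  proof (cases "w \<in> U")
    case True
    then show ?thesis using L.submodule_sum_superset(1)[OF sU(1) Rv] by blast
  next
    case False
    have wL: "w \<in> carrier L" using w Tc(1) by blast
    let ?Rw = "(\<lambda>r. r \<odot>\<^bsub>L\<^esub> w) ` carrier R"
    have Rw: "submodule ?Rw R L" "w \<in> ?Rw" by (rule L.submodule_cyclic[OF wL])+
    let ?V = "U <+>\<^bsub>L\<^esub> ?Rw"
    have V: "submodule ?V R L" "U \<subseteq> ?V" "w \<in> ?V"
      using L.submodule_sum[OF sU(1) Rw(1)] L.submodule_sum_superset[OF sU(1) Rw(1)] Rw(2) by auto
    have "?V \<subseteq> T" using sU(2) Tc(3,6) w unfolding set_add_def' by blast
    have "v \<in> ?V"
    proof (rule ccontr)
      assume "v \<notin> ?V"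
      then have "?V = U" using U(2) V(1,2) \<open>?V \<subseteq> T\<close> by blast
      then show False using V(3) False by blast
    qed
    then obtain u r where ur: "u \<in> U" "r \<in> carrier R" "v = u \<oplus>\<^bsub>L\<^esub> r \<odot>\<^bsub>L\<^esub> w" unfolding set_add_def' by blast
    have uL: "u \<in> carrier L" using ur(1) Uc(1) by blast
    \<comment> \<open>In \<open>v = u + r w\<close> the coefficient r is a unit, since \<mm> kills w
      and v is not in \<open>U\<close>; solving for w puts it into \<open>U + R v\<close>.\<close>
    have "r \<notin> \<mm>"
    proof
      assume "r \<in> \<mm>"
      then have "v = u" using kill[OF _ w] ur(3) uL by simp
      then show False using ur(1) sU(3) by simp
    qed
    then obtain t where t: "t \<in> carrier R" "t \<otimes> r = \<one>" by (rule invertible_outside[OF ur(2)])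
    have "(\<ominus>\<^bsub>L\<^esub> (t \<odot>\<^bsub>L\<^esub> u)) \<oplus>\<^bsub>L\<^esub> t \<odot>\<^bsub>L\<^esub> v = (\<ominus>\<^bsub>L\<^esub> (t \<odot>\<^bsub>L\<^esub> u)) \<oplus>\<^bsub>L\<^esub> (t \<odot>\<^bsub>L\<^esub> u \<oplus>\<^bsub>L\<^esub> (t \<otimes> r) \<odot>\<^bsub>L\<^esub> w)"
      unfolding ur(3) using t(1) ur(2) uL wL by (simp add: L.smult_r_distr L.smult_assoc1)
    also have "\<dots> = w" using t uL wL by (simp add: L.M.a_assoc[symmetric] L.M.l_neg)
    finally have we: "w = (\<ominus>\<^bsub>L\<^esub> (t \<odot>\<^bsub>L\<^esub> u)) \<oplus>\<^bsub>L\<^esub> t \<odot>\<^bsub>L\<^esub> v" ..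
    have "\<ominus>\<^bsub>L\<^esub> (t \<odot>\<^bsub>L\<^esub> u) \<in> U" using Uc(4)[OF Uc(6)[OF t(1) ur(1)]] .
    then show ?thesis using we t(1) unfolding set_add_def' by blast
  qed
  then show ?thesis using that[OF sU(1)] sU(2,3) v(1) by blast
qed

end

section \<open>The chain condition over the restricted scalars\<close>

context spec_fixing_endomorphism
begin

lemma endo_pow: "x \<in> carrier R \<Longrightarrow> \<phi> (x [^] (k::nat)) = \<phi> x [^] k"
  by (induction k) auto

lemma endo_m: "x \<in> \<mm> \<Longrightarrow> \<phi> x \<in> \<mm>"
  using spec_fixed[OF prime_m] ideal_closed(1)[OF is_ideal] by blast

text \<open>As \<open>\<phi>\<close> maps \<mm> into \<mm>, the line is a quotient of the residue
  field, hence simple or zero.\<close>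

lemma dcc_below_restrict_line:
  assumes L: "module R L" and w: "w \<in> carrier L" and kill: "\<And>x. x \<in> \<mm> \<Longrightarrow> x \<odot>\<^bsub>L\<^esub> w = \<zero>\<^bsub>L\<^esub>"
  shows "dcc_below R (restrict_scalars \<phi> L) ((\<lambda>r. \<phi> r \<odot>\<^bsub>L\<^esub> w) ` carrier R)"
proof (rule dcc_belowI)
  interpret L: module R L by fact
  let ?P = "restrict_scalars \<phi> L"
  interpret P: module R ?P by (rule module_restrict_scalars[OF L endo])
  let ?C = "(\<lambda>r. \<phi> r \<odot>\<^bsub>L\<^esub> w) ` carrier R"
  fix N :: "nat \<Rightarrow> _"
  assume N: "\<And>i. submodule (N i) R ?P" "\<And>i. N i \<subseteq> ?C" "\<And>i. N (Suc i) \<subseteq> N i" "\<And>i k. i \<le> k \<Longrightarrow> N k \<subseteq> N i"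
  show "\<exists>n. \<forall>i\<ge>n. N i = N n"
  proof (cases "\<forall>i. N i = ?C")
    case True
    then have "N i = N 0" for i using spec[OF True, of i] spec[OF True, of 0] by simp
    then show ?thesis by blast
  next
    case False
    then obtain n where n: "N n \<noteq> ?C" by blast
    have zero: "\<zero>\<^bsub>L\<^esub> \<in> N i" for i using P.submodule_closed(2)[OF N(1)] by simp
    have "z = \<zero>\<^bsub>L\<^esub>" if z: "z \<in> N n" for z
    proof (rule ccontr)
      assume nz: "z \<noteq> \<zero>\<^bsub>L\<^esub>"
      obtain c where c: "c \<in> carrier R" "z = \<phi> c \<odot>\<^bsub>L\<^esub> w" using z N(2) by blast
      have "c \<notin> \<mm>" using nz kill[OF endo_m, of c] c(2) by auto
      then obtain t where t: "t \<in> carrier R" "t \<otimes> c = \<one>" by (rule invertible_outside[OF c(1)])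
      have "\<phi> r \<odot>\<^bsub>L\<^esub> w \<in> N n" if r: "r \<in> carrier R" for r
      proof -
        have "(r \<otimes> t) \<odot>\<^bsub>?P\<^esub> z \<in> N n"
          by (rule P.submodule_closed(6)[OF N(1) _ z]) (simp add: r t(1))
        moreover have "(r \<otimes> t) \<odot>\<^bsub>?P\<^esub> z = (r \<otimes> (t \<otimes> c)) \<odot>\<^bsub>?P\<^esub> w"
          using P.smult_assoc1[of "r \<otimes> t" c w] r t(1) c w by (simp add: m_assoc)
        ultimately show ?thesis using r t(2) by simp
      qed
      then show False using n N(2)[of n] by blast
    qed
    then have "N i = N n" if "i \<ge> n" for i using N(4)[OF that] zero by blast
    then show ?thesis by blast
  qed
qed

text \<open>Restriction of scalars along the finite map \<open>\<phi>\<close> preserves the Artinian property. In a submodule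
  \<open>T\<close> minimal among those violating this, every element of \<open>R\<close> kills \<open>T\<close> or acts surjectively; this
  forces \<open>\<mm> T = 0\<close>, and splitting off a line from the vector space \<open>T\<close> contradicts minimality.\<close>

theorem artinian_restrict_scalars:
  assumes fin: "F_finite R \<phi>" and L: "module R L" and dcc: "dcc_below R L (carrier L)"
  shows "dcc_below R (restrict_scalars \<phi> L) (carrier L)"
proof (rule ccontr)
  let ?P = "restrict_scalars \<phi> L"
  assume neg: "\<not> dcc_below R ?P (carrier L)"
  interpret L: module R L by fact
  have P: "module R ?P" by (rule module_restrict_scalars[OF L endo])
  interpret P: module R ?P by (rule P)
  note toP = submodule_restrict_scalars[OF L endo]
  obtain T where T: "submodule T R L" "\<not> dcc_below R ?P T"
    and min: "\<And>U. \<lbrakk>submodule U R L; U \<subset> T\<rbrakk> \<Longrightarrow> \<not> \<not> dcc_below R ?P U"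
    by (rule L.exists_minimal_submodule[OF dcc, of "\<lambda>T. \<not> dcc_below R ?P T"])
      (use neg L.carrier_is_submodule in auto)
  note Tc = L.submodule_closed[OF T(1)]
  have kerL: "submodule {v \<in> T. r \<odot>\<^bsub>L\<^esub> v = \<zero>\<^bsub>L\<^esub>} R L" if "r \<in> carrier R" for r
  proof -
    have "submodule (T \<inter> {v \<in> carrier L. r \<odot>\<^bsub>L\<^esub> v \<in> {\<zero>\<^bsub>L\<^esub>}}) R L"
      by (intro L.submodule_Int T(1) L.submodule_preimage[OF L.linear_map_smult[OF that] L L.submodule_zero])
    moreover have "T \<inter> {v \<in> carrier L. r \<odot>\<^bsub>L\<^esub> v \<in> {\<zero>\<^bsub>L\<^esub>}} = {v \<in> T. r \<odot>\<^bsub>L\<^esub> v = \<zero>\<^bsub>L\<^esub>}"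
      using Tc(1) by auto
    ultimately show ?thesis by simp
  qed
  \<comment> \<open>On \<open>?P\<close> the element x acts as \<open>\<phi> x\<close>, nilpotently
    on each vector. If it did not kill \<open>T\<close>, its kernel in \<open>T\<close> would be a
    proper submodule, which satisfies the chain condition by minimality, and
    \<open>dcc_below_nilpotent\<close> would pass this on to \<open>T\<close>.\<close>
  have kill\<phi>: "\<phi> x \<odot>\<^bsub>L\<^esub> v = \<zero>\<^bsub>L\<^esub>" if x: "x \<in> \<mm>" and v: "v \<in> T" for x v
  proof (rule ccontr)
    assume nz: "\<phi> x \<odot>\<^bsub>L\<^esub> v \<noteq> \<zero>\<^bsub>L\<^esub>"
    have xc: "x \<in> carrier R" using ideal_closed(1)[OF is_ideal x] .
    have "dcc_below R ?P {v \<in> T. \<phi> x \<odot>\<^bsub>L\<^esub> v = \<zero>\<^bsub>L\<^esub>}"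
      using min[OF kerL[of "\<phi> x"]] xc nz v by auto
    then have "dcc_below R ?P T"
    proof (intro P.dcc_below_nilpotent[OF xc toP[OF T(1)]])
      fix u assume "u \<in> T"
      then have "u \<in> carrier L" using Tc(1) by blast
      then show "\<exists>k::nat. (x [^] k) \<odot>\<^bsub>?P\<^esub> u = \<zero>\<^bsub>?P\<^esub>"
        using nilpotent_on_artinian[OF L dcc endo_m[OF x]] by (simp add: endo_pow[OF xc])
    qed simp
    then show False using T(2) by simp
  qed
  have kill: "r \<odot>\<^bsub>L\<^esub> v = \<zero>\<^bsub>L\<^esub>" if r: "r \<in> \<mm>" and v: "v \<in> T" for r v
  proof (rule ccontr)
    assume nz: "r \<odot>\<^bsub>L\<^esub> v \<noteq> \<zero>\<^bsub>L\<^esub>"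
    have rc: "r \<in> carrier R" using ideal_closed(1)[OF is_ideal r] .
    \<comment> \<open>\<open>J\<close> contains \<open>\<phi> r\<close>, and a prime that contains
      \<open>\<phi> r\<close> contains r; so a power of r kills all of \<open>T\<close>.\<close>
    define J where "J = {s \<in> carrier R. \<forall>w\<in>T. s \<odot>\<^bsub>L\<^esub> w = \<zero>\<^bsub>L\<^esub>}"
    have J: "ideal J R"
      using Tc(1) by (intro idealI') (auto simp: J_def subset_iff L.smult_l_distr L.smult_assoc1)
    have "\<exists>n::nat. r [^] n \<in> J"
    proof (rule pow_mem_if_in_primes[OF J rc])
      fix q assume q: "primeideal q R" "J \<subseteq> q"
      have "\<phi> r \<in> J" using kill\<phi>[OF r] rc by (simp add: J_def)
      then show "r \<in> q" using spec_fixed[OF q(1) rc] q(2) by blast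
    qed
    then obtain n :: nat where n: "r [^] n \<in> J" by blast
    let ?rT = "(\<lambda>w. r \<odot>\<^bsub>L\<^esub> w) ` T"
    have sub: "?rT \<subseteq> T" using Tc(6)[OF rc] by blast
    \<comment> \<open>Surjectivity of r on \<open>T\<close> would be inherited by the power of r
      that kills \<open>T\<close>. So the kernel and the image of r are both proper, and minimality
      applies to each.\<close>
    have "?rT \<noteq> T"
    proof
      assume eq: "?rT = T"
      have "\<forall>w\<in>T. \<exists>u\<in>T. w = (r [^] k) \<odot>\<^bsub>L\<^esub> u" for k :: nat
      proof (induction k)
        case 0
        have "w = (r [^] (0::nat)) \<odot>\<^bsub>L\<^esub> w" if "w \<in> T" for w using that Tc(1) by auto
        then show ?case by blast
      next
        case (Suc k)
        show ?case
        proof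
          fix w assume "w \<in> T"
          then obtain u where u: "u \<in> T" "w = (r [^] k) \<odot>\<^bsub>L\<^esub> u" using Suc.IH by blast
          have "u \<in> ?rT" using u(1) eq by simp
          then obtain u' where u': "u' \<in> T" "u = r \<odot>\<^bsub>L\<^esub> u'" by blast
          have "w = (r [^] Suc k) \<odot>\<^bsub>L\<^esub> u'"
            unfolding u(2) u'(2) using u'(1) Tc(1) rc by (simp add: subset_iff L.smult_assoc1)
          then show "\<exists>u\<in>T. w = (r [^] Suc k) \<odot>\<^bsub>L\<^esub> u" using u'(1) by blast
        qed
      qed
      then obtain u where "u \<in> T" "r \<odot>\<^bsub>L\<^esub> v = (r [^] n) \<odot>\<^bsub>L\<^esub> u" using Tc(6)[OF rc v] by blast
      then show False using n nz by (simp add: J_def)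
    qed
    then have im: "dcc_below R ?P ?rT"
      using min[OF L.submodule_smult_image[OF rc T(1)]] sub by blast
    have ker: "dcc_below R ?P {w \<in> T. r \<odot>\<^bsub>L\<^esub> w = \<zero>\<^bsub>?P\<^esub>}"
      using min[OF kerL[OF rc]] nz v by auto
    have "linear_map R ?P ?P (\<lambda>w. r \<odot>\<^bsub>L\<^esub> w)"
      using rc by (auto simp: linear_map_def L.smult_r_distr L.smult_assoc1[symmetric] m_comm)
    then have "dcc_below R ?P T" by (rule P.dcc_below_extension[OF _ P toP[OF T(1)] ker im])
    then show False using T(2) by simp
  qed
  have zero: "dcc_below R ?P {\<zero>\<^bsub>L\<^esub>}" using P.dcc_below_zero by simp
  have "\<not> T \<subseteq> {\<zero>\<^bsub>L\<^esub>}" using dcc_below_mono[OF zero] T(2) by blast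
  then obtain v where v: "v \<in> T" "v \<noteq> \<zero>\<^bsub>L\<^esub>" by blast
  have vL: "v \<in> carrier L" using v(1) Tc(1) by blast
  obtain U where U: "submodule U R L" "U \<subset> T" "T \<subseteq> U <+>\<^bsub>L\<^esub> (\<lambda>r. r \<odot>\<^bsub>L\<^esub> v) ` carrier R"
    by (rule exists_complement_of_line[OF L T(1) v kill])
  obtain A where A: "spanning A" using spanning_exists[OF fin] by blast
  have finA: "finite A" and subA: "A \<subseteq> carrier R" using A by (auto simp: spanning_def)
  \<comment> \<open>Finiteness of \<open>\<phi>\<close> enters here: \<open>R v\<close> is the sum
    of the lines \<open>\<phi>(R) a v\<close> for a in the finite spanning set, and \<open>W\<close>
    collects them one at a time.\<close>
  have "\<exists>W. submodule W R ?P \<and> dcc_below R ?P W \<and> (\<forall>c\<in>B \<rightarrow> carrier R. lincomb B c \<odot>\<^bsub>L\<^esub> v \<in> W)" if "B \<subseteq> A" for B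
    using finite_subset[OF that finA] that
  proof (induction B rule: finite_induct)
    case empty
    show ?case
      using P.submodule_zero zero vL by (intro exI[of _ "{\<zero>\<^bsub>L\<^esub>}"]) (simp add: lincomb_def)
  next
    case (insert b B)
    then obtain W where W: "submodule W R ?P" "dcc_below R ?P W" "\<forall>c\<in>B \<rightarrow> carrier R. lincomb B c \<odot>\<^bsub>L\<^esub> v \<in> W"
      by auto
    have b: "b \<in> carrier R" and B: "B \<subseteq> carrier R" using insert.prems subA by auto
    let ?w = "b \<odot>\<^bsub>L\<^esub> v"
    let ?C = "(\<lambda>r. r \<odot>\<^bsub>?P\<^esub> ?w) ` carrier R"
    have w: "?w \<in> carrier L" "?w \<in> T" using b vL v(1) Tc(6) by auto
    have C: "submodule ?C R ?P" by (rule P.submodule_cyclic) (simp add: w)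
    have dC: "dcc_below R ?P ?C" using dcc_below_restrict_line[OF L w(1) kill[OF _ w(2)]] by simp
    have "lincomb (insert b B) c \<odot>\<^bsub>L\<^esub> v \<in> ?C <+>\<^bsub>?P\<^esub> W" if c: "c \<in> insert b B \<rightarrow> carrier R" for c
    proof -
      have c': "c b \<in> carrier R" "c \<in> B \<rightarrow> carrier R" using c by auto
      have "lincomb (insert b B) c = \<phi> (c b) \<otimes> b \<oplus> lincomb B c"
        unfolding lincomb_def using insert.hyps b c' lincomb_terms[OF B c'(2)] by (intro finsum_insert) auto
      then have "lincomb (insert b B) c \<odot>\<^bsub>L\<^esub> v = c b \<odot>\<^bsub>?P\<^esub> ?w \<oplus>\<^bsub>?P\<^esub> lincomb B c \<odot>\<^bsub>L\<^esub> v"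
        using b c' vL lincomb_closed[OF B c'(2)] by (simp add: L.smult_l_distr L.smult_assoc1)
      then show ?thesis using W(3) c' unfolding set_add_def' by blast
    qed
    then show ?case using P.submodule_sum[OF C W(1)] P.dcc_below_sum[OF C W(1) dC W(2)] by blast
  qed
  then obtain W where W: "submodule W R ?P" "dcc_below R ?P W" "\<forall>c\<in>A \<rightarrow> carrier R. lincomb A c \<odot>\<^bsub>L\<^esub> v \<in> W"
    by blast
  have "(\<lambda>r. r \<odot>\<^bsub>L\<^esub> v) ` carrier R \<subseteq> W" using A W(3) by (force simp: spanning_def)
  then have "U <+>\<^bsub>L\<^esub> (\<lambda>r. r \<odot>\<^bsub>L\<^esub> v) ` carrier R \<subseteq> U <+>\<^bsub>L\<^esub> W"
    unfolding set_add_def' by (intro UN_mono order_refl)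
  also have "U <+>\<^bsub>L\<^esub> W = U <+>\<^bsub>?P\<^esub> W" by (simp add: set_add_def')
  finally have "T \<subseteq> U <+>\<^bsub>?P\<^esub> W" using U(3) by (rule order_trans[rotated])
  moreover have "dcc_below R ?P (U <+>\<^bsub>?P\<^esub> W)"
    using P.dcc_below_sum[OF toP[OF U(1)] W(1) _ W(2)] min[OF U(1,2)] by blast
  ultimately show False using dcc_below_mono T(2) by blast
qed

end

section \<open>Homomorphisms from the twisted module\<close>

lemma F_tilde_carrier_iff:
  "\<theta> \<in> carrier (F_tilde R \<phi> M) \<longleftrightarrow> \<theta> \<in> carrier R \<rightarrow>\<^sub>E carrier M \<and>
    (\<forall>x\<in>carrier R. \<forall>y\<in>carrier R. \<theta> (x \<oplus>\<^bsub>R\<^esub> y) = \<theta> x \<oplus>\<^bsub>M\<^esub> \<theta> y) \<and>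
    (\<forall>r\<in>carrier R. \<forall>x\<in>carrier R. \<theta> (\<phi> r \<otimes>\<^bsub>R\<^esub> x) = r \<odot>\<^bsub>M\<^esub> \<theta> x)"
  by (simp add: F_tilde_def module_hom_def twisted_module_def)

lemma F_tilde_ops:
  "\<zero>\<^bsub>F_tilde R \<phi> M\<^esub> = (\<lambda>s\<in>carrier R. \<zero>\<^bsub>M\<^esub>)"
  "\<theta> \<oplus>\<^bsub>F_tilde R \<phi> M\<^esub> \<eta> = (\<lambda>s\<in>carrier R. \<theta> s \<oplus>\<^bsub>M\<^esub> \<eta> s)"
  "r \<odot>\<^bsub>F_tilde R \<phi> M\<^esub> \<theta> = (\<lambda>s\<in>carrier R. \<theta> (s \<otimes>\<^bsub>R\<^esub> r))"
  by (simp_all add: F_tilde_def)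

lemma F_tilde_eqI:
  assumes "\<theta> \<in> carrier (F_tilde R \<phi> M)" "\<eta> \<in> carrier (F_tilde R \<phi> M)" "\<And>s. s \<in> carrier R \<Longrightarrow> \<theta> s = \<eta> s"
  shows "\<theta> = \<eta>"
  by (rule PiE_ext[of _ "carrier R" "\<lambda>_. carrier M"]) (use assms in \<open>auto simp: F_tilde_carrier_iff\<close>)

context spec_fixing_endomorphism
begin

abbreviation F :: "('a, 'c, 'm) module_scheme \<Rightarrow> ('a, 'a \<Rightarrow> 'c) module"
  where "F M \<equiv> F_tilde R \<phi> M"

lemma F_tilde_apply:
  assumes "module R M" "\<theta> \<in> carrier (F M)"
  shows "\<And>s. s \<in> carrier R \<Longrightarrow> \<theta> s \<in> carrier M"
    and "\<And>s t. \<lbrakk>s \<in> carrier R; t \<in> carrier R\<rbrakk> \<Longrightarrow> \<theta> (s \<oplus> t) = \<theta> s \<oplus>\<^bsub>M\<^esub> \<theta> t"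
    and "\<And>r s. \<lbrakk>r \<in> carrier R; s \<in> carrier R\<rbrakk> \<Longrightarrow> \<theta> (\<phi> r \<otimes> s) = r \<odot>\<^bsub>M\<^esub> \<theta> s"
    and "\<theta> \<zero> = \<zero>\<^bsub>M\<^esub>"
proof -
  interpret M: module R M by fact
  show cl: "\<And>s. s \<in> carrier R \<Longrightarrow> \<theta> s \<in> carrier M"
    and "\<And>s t. \<lbrakk>s \<in> carrier R; t \<in> carrier R\<rbrakk> \<Longrightarrow> \<theta> (s \<oplus> t) = \<theta> s \<oplus>\<^bsub>M\<^esub> \<theta> t"
    and sm: "\<And>r s. \<lbrakk>r \<in> carrier R; s \<in> carrier R\<rbrakk> \<Longrightarrow> \<theta> (\<phi> r \<otimes> s) = r \<odot>\<^bsub>M\<^esub> \<theta> s"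
    using assms(2) by (auto simp: F_tilde_carrier_iff)
  show "\<theta> \<zero> = \<zero>\<^bsub>M\<^esub>" using sm[of \<zero> \<zero>] cl[of \<zero>] by simp
qed

lemma module_F_tilde:
  assumes "module R M"
  shows "module R (F M)"
proof -
  interpret M: module R M by fact
  note app = F_tilde_apply[OF assms]
  have add: "\<theta> \<oplus>\<^bsub>F M\<^esub> \<eta> \<in> carrier (F M)" if "\<theta> \<in> carrier (F M)" "\<eta> \<in> carrier (F M)" for \<theta> \<eta>
    using app[OF that(1)] app[OF that(2)]
    by (auto simp: F_tilde_carrier_iff F_tilde_ops M.smult_r_distr M.M.a_ac)
  have sm: "r \<odot>\<^bsub>F M\<^esub> \<theta> \<in> carrier (F M)" if "r \<in> carrier R" "\<theta> \<in> carrier (F M)" for r \<theta>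
    using app[OF that(2)] that(1) by (auto simp: F_tilde_carrier_iff F_tilde_ops l_distr m_assoc)
  have zero: "\<zero>\<^bsub>F M\<^esub> \<in> carrier (F M)"
    by (auto simp: F_tilde_carrier_iff F_tilde_ops)
  show ?thesis
  proof (rule moduleI)
    show "cring R" by (rule is_cring)
    show "abelian_group (F M)"
    proof (rule abelian_groupI)
      fix \<theta> assume t: "\<theta> \<in> carrier (F M)"
      show "\<zero>\<^bsub>F M\<^esub> \<oplus>\<^bsub>F M\<^esub> \<theta> = \<theta>"
        by (rule F_tilde_eqI[OF add[OF zero t] t]) (simp add: F_tilde_ops app(1)[OF t])
      show "\<exists>\<eta>\<in>carrier (F M). \<eta> \<oplus>\<^bsub>F M\<^esub> \<theta> = \<zero>\<^bsub>F M\<^esub>"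
      proof
        let ?n = "(\<ominus> \<one>) \<odot>\<^bsub>F M\<^esub> \<theta>"
        show n: "?n \<in> carrier (F M)" by (rule sm[OF _ t]) simp
        show "?n \<oplus>\<^bsub>F M\<^esub> \<theta> = \<zero>\<^bsub>F M\<^esub>"
        proof (rule F_tilde_eqI[OF add[OF n t] zero])
          fix s assume s: "s \<in> carrier R"
          have "\<theta> (s \<otimes> \<ominus> \<one>) \<oplus>\<^bsub>M\<^esub> \<theta> s = \<theta> ((s \<otimes> \<ominus> \<one>) \<oplus> s)" using app(2)[OF t] s by simp
          also have "(s \<otimes> \<ominus> \<one>) \<oplus> s = \<zero>" using s by (simp add: r_minus l_neg)
          finally show "(?n \<oplus>\<^bsub>F M\<^esub> \<theta>) s = \<zero>\<^bsub>F M\<^esub> s" using s app(4)[OF t] by (simp add: F_tilde_ops)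
        qed
      qed
    next
      fix \<theta> \<eta> \<zeta> assume t: "\<theta> \<in> carrier (F M)" "\<eta> \<in> carrier (F M)" "\<zeta> \<in> carrier (F M)"
      show "\<theta> \<oplus>\<^bsub>F M\<^esub> \<eta> \<oplus>\<^bsub>F M\<^esub> \<zeta> = \<theta> \<oplus>\<^bsub>F M\<^esub> (\<eta> \<oplus>\<^bsub>F M\<^esub> \<zeta>)"
        by (rule F_tilde_eqI[OF add[OF add[OF t(1,2)] t(3)] add[OF t(1) add[OF t(2,3)]]])
          (simp add: F_tilde_ops app(1)[OF t(1)] app(1)[OF t(2)] app(1)[OF t(3)] M.M.a_assoc)
    next
      fix \<theta> \<eta> assume t: "\<theta> \<in> carrier (F M)" "\<eta> \<in> carrier (F M)"
      show "\<theta> \<oplus>\<^bsub>F M\<^esub> \<eta> = \<eta> \<oplus>\<^bsub>F M\<^esub> \<theta>"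
        by (rule F_tilde_eqI[OF add[OF t] add[OF t(2,1)]])
          (simp add: F_tilde_ops app(1)[OF t(1)] app(1)[OF t(2)] M.M.a_comm)
    qed (use add zero in auto)
    show "a \<odot>\<^bsub>F M\<^esub> \<theta> \<in> carrier (F M)" if "a \<in> carrier R" "\<theta> \<in> carrier (F M)" for a \<theta>
      by (rule sm[OF that])
    show "(a \<oplus> b) \<odot>\<^bsub>F M\<^esub> \<theta> = a \<odot>\<^bsub>F M\<^esub> \<theta> \<oplus>\<^bsub>F M\<^esub> b \<odot>\<^bsub>F M\<^esub> \<theta>"
      if ab: "a \<in> carrier R" "b \<in> carrier R" and t: "\<theta> \<in> carrier (F M)" for a b \<theta>
      by (rule F_tilde_eqI[OF sm[OF add.m_closed[OF ab] t] add[OF sm[OF ab(1) t] sm[OF ab(2) t]]])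
        (simp add: F_tilde_ops ab r_distr app(2)[OF t])
    show "a \<odot>\<^bsub>F M\<^esub> (\<theta> \<oplus>\<^bsub>F M\<^esub> \<eta>) = a \<odot>\<^bsub>F M\<^esub> \<theta> \<oplus>\<^bsub>F M\<^esub> a \<odot>\<^bsub>F M\<^esub> \<eta>"
      if a: "a \<in> carrier R" and t: "\<theta> \<in> carrier (F M)" "\<eta> \<in> carrier (F M)" for a \<theta> \<eta>
      by (rule F_tilde_eqI[OF sm[OF a add[OF t]] add[OF sm[OF a t(1)] sm[OF a t(2)]]])
        (simp add: F_tilde_ops a)
    show "(a \<otimes> b) \<odot>\<^bsub>F M\<^esub> \<theta> = a \<odot>\<^bsub>F M\<^esub> (b \<odot>\<^bsub>F M\<^esub> \<theta>)"
      if ab: "a \<in> carrier R" "b \<in> carrier R" and t: "\<theta> \<in> carrier (F M)" for a b \<theta>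
      by (rule F_tilde_eqI[OF sm[OF m_closed[OF ab] t] sm[OF ab(1) sm[OF ab(2) t]]])
        (simp add: F_tilde_ops ab m_assoc)
    show "\<one> \<odot>\<^bsub>F M\<^esub> \<theta> = \<theta>" if t: "\<theta> \<in> carrier (F M)" for \<theta>
      by (rule F_tilde_eqI[OF sm[OF one_closed t] t]) (simp add: F_tilde_ops)
  qed
qed

text \<open>Restriction along \<open>\<phi>\<close> makes evaluation linear: \<open>\<phi> r\<close>
  acting on \<open>\<theta>\<close> gives the value \<open>\<theta> (s \<otimes> \<phi> r)\<close>
  at s, which is r times \<open>\<theta> s\<close>.\<close>

lemma linear_map_eval:
  assumes M: "module R M" and s: "s \<in> carrier R"
  shows "linear_map R (restrict_scalars \<phi> (F M)) M (\<lambda>\<theta>. \<theta> s)"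
  unfolding linear_map_def
proof (intro conjI ballI)
  fix r \<theta> assume r: "r \<in> carrier R" and "\<theta> \<in> carrier (restrict_scalars \<phi> (F M))"
  then have "\<theta> (\<phi> r \<otimes> s) = r \<odot>\<^bsub>M\<^esub> \<theta> s" using F_tilde_apply(3)[OF M _ r s] by simp
  then show "(r \<odot>\<^bsub>restrict_scalars \<phi> (F M)\<^esub> \<theta>) s = r \<odot>\<^bsub>M\<^esub> \<theta> s" using r s by (simp add: F_tilde_ops m_comm)
qed (use F_tilde_apply(1)[OF M] s in \<open>auto simp: F_tilde_ops\<close>)

lemma linear_map_F_tilde:
  assumes M: "module R M" and L: "module R L" and f: "linear_map R M L f"
  shows "linear_map R (F M) (F L) (\<lambda>\<theta>. \<lambda>s\<in>carrier R. f (\<theta> s))"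
proof -
  interpret M: module R M by fact
  note fc = M.linear_map_closed[OF f L] and app = F_tilde_apply[OF M]
  have closed: "(\<lambda>s\<in>carrier R. f (\<theta> s)) \<in> carrier (F L)" if "\<theta> \<in> carrier (F M)" for \<theta>
    using app[OF that] fc by (auto simp: F_tilde_carrier_iff)
  then show ?thesis
    using app(1) fc by (auto simp: linear_map_def F_tilde_ops fun_eq_iff restrict_def)
qed

end

section \<open>Homomorphisms in coordinates and the two inclusions\<close>

locale endomorphism_dual_basis = spec_fixing_endomorphism +
  fixes A :: "'a set" and \<alpha> :: "'a \<Rightarrow> 'a \<Rightarrow> 'a"
  assumes finite_A: "finite A" and A_subset: "A \<subseteq> carrier R"
    and \<alpha>_closed: "\<And>a s. \<lbrakk>a \<in> A; s \<in> carrier R\<rbrakk> \<Longrightarrow> \<alpha> a s \<in> carrier R"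
    and \<alpha>_add: "\<And>a s t. \<lbrakk>a \<in> A; s \<in> carrier R; t \<in> carrier R\<rbrakk> \<Longrightarrow> \<alpha> a (s \<oplus> t) = \<alpha> a s \<oplus> \<alpha> a t"
    and \<alpha>_smult: "\<And>a r s. \<lbrakk>a \<in> A; r \<in> carrier R; s \<in> carrier R\<rbrakk> \<Longrightarrow> \<alpha> a (\<phi> r \<otimes> s) = r \<otimes> \<alpha> a s"
    and expansion: "\<And>s. s \<in> carrier R \<Longrightarrow> s = (\<Oplus>a\<in>A. \<phi> (\<alpha> a s) \<otimes> a)"
    and \<alpha>_unit: "\<exists>a\<in>A. \<alpha> a \<one> \<notin> \<mm>"
begin

text \<open>The tensor of the functional \<open>\<alpha> a\<close> with y, read as a homomorphism
  from the twisted module to \<open>M\<close>.\<close>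

definition rank_one :: "('a, 'c, 'm) module_scheme \<Rightarrow> 'a \<Rightarrow> 'c \<Rightarrow> 'a \<Rightarrow> 'c"
  where "rank_one M a y = (\<lambda>s\<in>carrier R. \<alpha> a s \<odot>\<^bsub>M\<^esub> y)"

lemma linear_map_rank_one:
  assumes M: "module R M" and a: "a \<in> A"
  shows "linear_map R M (restrict_scalars \<phi> (F M)) (rank_one M a)"
proof -
  interpret M: module R M by fact
  have ac: "\<alpha> a s \<in> carrier R" if "s \<in> carrier R" for s by (rule \<alpha>_closed[OF a that])
  have closed: "rank_one M a y \<in> carrier (F M)" if "y \<in> carrier M" for y
    using that ac by (auto simp: F_tilde_carrier_iff rank_one_def \<alpha>_add[OF a] \<alpha>_smult[OF a] M.smult_l_distr M.smult_assoc1)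
  show ?thesis
    unfolding linear_map_def
  proof (intro conjI ballI)
    show "rank_one M a \<in> carrier M \<rightarrow> carrier (restrict_scalars \<phi> (F M))" using closed by simp
    fix x y assume "x \<in> carrier M" "y \<in> carrier M"
    then show "rank_one M a (x \<oplus>\<^bsub>M\<^esub> y) = rank_one M a x \<oplus>\<^bsub>restrict_scalars \<phi> (F M)\<^esub> rank_one M a y"
      using ac by (auto simp: rank_one_def F_tilde_ops M.smult_r_distr fun_eq_iff restrict_def)
  next
    fix r x assume r: "r \<in> carrier R" and x: "x \<in> carrier M"
    have "\<alpha> a (s \<otimes> \<phi> r) \<odot>\<^bsub>M\<^esub> x = \<alpha> a s \<odot>\<^bsub>M\<^esub> (r \<odot>\<^bsub>M\<^esub> x)" if s: "s \<in> carrier R" for s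
      using \<alpha>_smult[OF a r s] s r x ac[OF s] by (simp add: m_comm M.smult_assoc1[symmetric])
    then show "rank_one M a (r \<odot>\<^bsub>M\<^esub> x) = r \<odot>\<^bsub>restrict_scalars \<phi> (F M)\<^esub> rank_one M a x"
      using r by (auto simp: rank_one_def F_tilde_ops fun_eq_iff restrict_def)
  qed
qed

definition combination :: "('a, 'c, 'm) module_scheme \<Rightarrow> 'a set \<Rightarrow> ('a \<Rightarrow> 'c) \<Rightarrow> 'a \<Rightarrow> 'c"
  where "combination M B y = (\<lambda>s\<in>carrier R. \<Oplus>\<^bsub>M\<^esub>a\<in>B. \<alpha> a s \<odot>\<^bsub>M\<^esub> y a)"

lemma combination_empty:
  assumes "module R M"
  shows "combination M {} y = \<zero>\<^bsub>F M\<^esub>"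
proof -
  interpret M: module R M by fact
  show ?thesis by (simp add: combination_def F_tilde_ops)
qed

lemma combination_insert:
  assumes M: "module R M" and "finite B" "b \<notin> B" "insert b B \<subseteq> A" "y \<in> insert b B \<rightarrow> carrier M"
  shows "combination M (insert b B) y = rank_one M b (y b) \<oplus>\<^bsub>F M\<^esub> combination M B y"
proof -
  interpret M: module R M by fact
  have "(\<Oplus>\<^bsub>M\<^esub>a\<in>insert b B. \<alpha> a s \<odot>\<^bsub>M\<^esub> y a) = \<alpha> b s \<odot>\<^bsub>M\<^esub> y b \<oplus>\<^bsub>M\<^esub> (\<Oplus>\<^bsub>M\<^esub>a\<in>B. \<alpha> a s \<odot>\<^bsub>M\<^esub> y a)"
    if s: "s \<in> carrier R" for s
    using assms(2-) \<alpha>_closed[OF _ s] by (intro M.finsum_insert) (auto simp: Pi_iff subset_iff)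
  then show ?thesis by (auto simp: combination_def rank_one_def F_tilde_ops fun_eq_iff restrict_def)
qed

lemma combination_closed:
  assumes M: "module R M" and "B \<subseteq> A" "y \<in> B \<rightarrow> carrier M"
  shows "combination M B y \<in> carrier (F M)"
  using finite_subset[OF assms(2) finite_A] assms(2,3)
proof (induction B rule: finite_induct)
  case empty
  interpret FM: module R "F M" by (rule module_F_tilde[OF M])
  show ?case using combination_empty[OF M] by simp
next
  case (insert b B)
  interpret M: module R M by fact
  interpret FM: module R "F M" by (rule module_F_tilde[OF M])
  interpret P: module R "restrict_scalars \<phi> (F M)" by (rule module_restrict_scalars[OF FM.module_axioms endo])
  have "rank_one M b (y b) \<in> carrier (F M)"
    using M.linear_map_closed(1)[OF linear_map_rank_one[OF M] P.module_axioms, of b "y b"] insert.prems by simp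
  then show ?case
    using combination_insert[OF M insert.hyps insert.prems] insert.IH insert.prems by simp
qed

text \<open>\<open>\<theta>\<close> is applied to the expansion of s in \<open>A\<close>; by
  linearity over the twisted module the factor \<open>\<phi> (\<alpha> a s)\<close> comes out as
  \<open>\<alpha> a s\<close>.\<close>

lemma F_tilde_expand:
  assumes M: "module R M" and t: "\<theta> \<in> carrier (F M)"
  shows "\<theta> = combination M A \<theta>"
proof (rule F_tilde_eqI[OF t])
  interpret M: module R M by fact
  note app = F_tilde_apply[OF M t]
  have tA: "\<theta> \<in> A \<rightarrow> carrier M" using app(1) A_subset by auto
  show "combination M A \<theta> \<in> carrier (F M)" by (rule combination_closed[OF M order_refl tA])
  fix s assume s: "s \<in> carrier R"
  have "\<theta> (\<Oplus>a\<in>B. \<phi> (\<alpha> a s) \<otimes> a) = (\<Oplus>\<^bsub>M\<^esub>a\<in>B. \<alpha> a s \<odot>\<^bsub>M\<^esub> \<theta> a)" if "B \<subseteq> A" for B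
    using finite_subset[OF that finite_A] that
  proof (induction B rule: finite_induct)
    case empty
    show ?case by (simp add: app(4))
  next
    case (insert b B)
    have b: "b \<in> carrier R" "\<alpha> b s \<in> carrier R" and B: "(\<lambda>a. \<phi> (\<alpha> a s) \<otimes> a) \<in> B \<rightarrow> carrier R"
      using insert.prems A_subset \<alpha>_closed[OF _ s] by (auto simp: subset_iff)
    have BM: "(\<lambda>a. \<alpha> a s \<odot>\<^bsub>M\<^esub> \<theta> a) \<in> B \<rightarrow> carrier M"
      using insert.prems A_subset \<alpha>_closed[OF _ s] app(1) by (auto simp: subset_iff)
    have "(\<Oplus>a\<in>insert b B. \<phi> (\<alpha> a s) \<otimes> a) = \<phi> (\<alpha> b s) \<otimes> b \<oplus> (\<Oplus>a\<in>B. \<phi> (\<alpha> a s) \<otimes> a)"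
      using insert.hyps b B by (intro finsum_insert) auto
    then have "\<theta> (\<Oplus>a\<in>insert b B. \<phi> (\<alpha> a s) \<otimes> a) = \<alpha> b s \<odot>\<^bsub>M\<^esub> \<theta> b \<oplus>\<^bsub>M\<^esub> \<theta> (\<Oplus>a\<in>B. \<phi> (\<alpha> a s) \<otimes> a)"
      using app(2,3) b finsum_closed[OF B] by simp
    also have "\<dots> = \<alpha> b s \<odot>\<^bsub>M\<^esub> \<theta> b \<oplus>\<^bsub>M\<^esub> (\<Oplus>\<^bsub>M\<^esub>a\<in>B. \<alpha> a s \<odot>\<^bsub>M\<^esub> \<theta> a)"
      using insert.IH insert.prems by simp
    also have "\<dots> = (\<Oplus>\<^bsub>M\<^esub>a\<in>insert b B. \<alpha> a s \<odot>\<^bsub>M\<^esub> \<theta> a)"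
      using insert.hyps b BM app(1) by (intro M.finsum_insert[symmetric]) auto
    finally show ?case .
  qed
  from this[OF order_refl] have "\<theta> (\<Oplus>a\<in>A. \<phi> (\<alpha> a s) \<otimes> a) = combination M A \<theta> s"
    using s by (simp add: combination_def)
  then show "\<theta> s = combination M A \<theta> s" by (simp only: expansion[OF s, symmetric])
qed

lemma combination_image:
  assumes M: "module R M" and L: "module R L" and f: "linear_map R M L f" and y: "y \<in> A \<rightarrow> carrier M"
  shows "(\<lambda>s\<in>carrier R. f (combination M A y s)) = combination L A (\<lambda>a. f (y a))"
proof -
  interpret M: module R M by fact
  interpret L: module R L by fact
  note fc = M.linear_map_closed[OF f L]
  have "f (\<Oplus>\<^bsub>M\<^esub>a\<in>B. \<alpha> a s \<odot>\<^bsub>M\<^esub> y a) = (\<Oplus>\<^bsub>L\<^esub>a\<in>B. \<alpha> a s \<odot>\<^bsub>L\<^esub> f (y a))" if "B \<subseteq> A" and s: "s \<in> carrier R" for B s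
    using finite_subset[OF that(1) finite_A] that(1)
  proof (induction B rule: finite_induct)
    case empty
    show ?case by (simp add: fc(4))
  next
    case (insert b B)
    have b: "\<alpha> b s \<in> carrier R" "y b \<in> carrier M" and B: "(\<lambda>a. \<alpha> a s \<odot>\<^bsub>M\<^esub> y a) \<in> B \<rightarrow> carrier M"
      and BL: "(\<lambda>a. \<alpha> a s \<odot>\<^bsub>L\<^esub> f (y a)) \<in> B \<rightarrow> carrier L"
      using insert.prems \<alpha>_closed[OF _ s] y fc(1) by (auto simp: subset_iff Pi_iff)
    show ?case
      using insert b B BL fc M.finsum_closed[OF B] by simp
  qed
  then show ?thesis by (auto simp: combination_def fun_eq_iff restrict_def)
qed

text \<open>Restricted along \<open>\<phi>\<close>, the module embeds into a finite power of
  \<open>L\<close> by evaluation at the elements of \<open>A\<close>. The homomorphisms that vanish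
  on \<open>A - B\<close> form a filtration whose steps embed into \<open>L\<close>.\<close>

lemma dcc_below_F_tilde:
  assumes L: "module R L" and dcc: "dcc_below R L (carrier L)"
  shows "dcc_below R (F L) (carrier (F L))"
proof -
  interpret L: module R L by fact
  interpret FL: module R "F L" by (rule module_F_tilde[OF L])
  let ?P = "restrict_scalars \<phi> (F L)"
  have P: "module R ?P" by (rule module_restrict_scalars[OF FL.module_axioms endo])
  interpret P: module R ?P by (rule P)
  have "dcc_below R ?P {\<theta> \<in> carrier (F L). \<forall>a\<in>A - B. \<theta> a = \<zero>\<^bsub>L\<^esub>}" if "B \<subseteq> A" for B
    using finite_subset[OF that finite_A] that
  proof (induction B rule: finite_induct)
    case empty
    have sub: "{\<theta> \<in> carrier (F L). \<forall>a\<in>A - {}. \<theta> a = \<zero>\<^bsub>L\<^esub>} \<subseteq> {\<zero>\<^bsub>F L\<^esub>}"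
    proof
      fix \<theta> assume "\<theta> \<in> {\<theta> \<in> carrier (F L). \<forall>a\<in>A - {}. \<theta> a = \<zero>\<^bsub>L\<^esub>}"
      then have t: "\<theta> \<in> carrier (F L)" "\<forall>a\<in>A. \<theta> a = \<zero>\<^bsub>L\<^esub>" by auto
      have "\<theta> s = \<zero>\<^bsub>F L\<^esub> s" if s: "s \<in> carrier R" for s
      proof -
        have "\<theta> s = (\<Oplus>\<^bsub>L\<^esub>a\<in>A. \<alpha> a s \<odot>\<^bsub>L\<^esub> \<theta> a)"
          using fun_cong[OF F_tilde_expand[OF L t(1)], of s] s by (simp add: combination_def)
        also have "\<dots> = (\<Oplus>\<^bsub>L\<^esub>a\<in>A. \<zero>\<^bsub>L\<^esub>)"
          using t(2) \<alpha>_closed[OF _ s] by (intro L.M.finsum_cong') auto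
        finally show ?thesis using s by (simp add: F_tilde_ops)
      qed
      then have "\<theta> = \<zero>\<^bsub>F L\<^esub>" by (rule F_tilde_eqI[OF t(1) FL.M.zero_closed])
      then show "\<theta> \<in> {\<zero>\<^bsub>F L\<^esub>}" by simp
    qed
    have "dcc_below R ?P {\<zero>\<^bsub>F L\<^esub>}" using P.dcc_below_zero by simp
    then show ?case using sub by (rule dcc_below_mono)
  next
    case (insert b B)
    let ?T = "{\<theta> \<in> carrier (F L). \<forall>a\<in>A - insert b B. \<theta> a = \<zero>\<^bsub>L\<^esub>}"
    have b: "b \<in> carrier R" "b \<in> A" using insert.prems A_subset by auto
    have T: "submodule ?T R ?P"
    proof (rule P.submoduleI')
      have ac: "a \<in> carrier R" if "a \<in> A - insert b B" for a using that A_subset by auto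
      note ev = P.linear_map_closed[OF linear_map_eval[OF L ac] L]
      show "?T \<subseteq> carrier ?P" by auto
      show "\<zero>\<^bsub>?P\<^esub> \<in> ?T" using ev(4) P.M.zero_closed by simp
      fix \<theta> assume t: "\<theta> \<in> ?T"
      then have tc: "\<theta> \<in> carrier ?P" by simp
      show "\<theta> \<oplus>\<^bsub>?P\<^esub> \<eta> \<in> ?T" if e: "\<eta> \<in> ?T" for \<eta>
      proof -
        have ec: "\<eta> \<in> carrier ?P" using e by simp
        have "(\<theta> \<oplus>\<^bsub>?P\<^esub> \<eta>) a = \<zero>\<^bsub>L\<^esub>" if a: "a \<in> A - insert b B" for a
          using ev(2)[OF a tc ec] t e a by simp
        then show ?thesis using P.M.add.m_closed[OF tc ec] by simp
      qed
      show "r \<odot>\<^bsub>?P\<^esub> \<theta> \<in> ?T" if r: "r \<in> carrier R" for r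
      proof -
        have "(r \<odot>\<^bsub>?P\<^esub> \<theta>) a = \<zero>\<^bsub>L\<^esub>" if a: "a \<in> A - insert b B" for a
          using ev(3)[OF a r tc] t a r by simp
        then show ?thesis using P.smult_closed[OF r tc] by simp
      qed
    qed
    show ?case
    proof (rule P.dcc_below_extension[OF linear_map_eval[OF L b(1)] L T])
      have "{\<theta> \<in> ?T. \<theta> b = \<zero>\<^bsub>L\<^esub>} \<subseteq> {\<theta> \<in> carrier (F L). \<forall>a\<in>A - B. \<theta> a = \<zero>\<^bsub>L\<^esub>}" by auto
      then show "dcc_below R ?P {\<theta> \<in> ?T. \<theta> b = \<zero>\<^bsub>L\<^esub>}"
        using insert by (intro dcc_below_mono[OF insert.IH]) auto
      have "(\<lambda>\<theta>. \<theta> b) ` ?T \<subseteq> carrier L" using F_tilde_apply(1)[OF L _ b(1)] by auto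
      then show "dcc_below R L ((\<lambda>\<theta>. \<theta> b) ` ?T)" by (rule dcc_below_mono[OF dcc])
    qed
  qed
  from this[OF order_refl] have "dcc_below R ?P (carrier (F L))" by simp
  \<comment> \<open>A submodule for the original scalars is also one for the restricted scalars, so
    the chain condition passes back.\<close>
  then show ?thesis
    using submodule_restrict_scalars[OF FL.module_axioms endo] unfolding dcc_below_def by blast
qed

lemma Coass_F_tilde_superset:
  assumes M: "module R M"
  shows "Coass R M \<subseteq> Coass R (F M)"
proof
  fix p assume "p \<in> Coass R M"
  interpret M: module R M by fact
  interpret FM: module R "F M" by (rule module_F_tilde[OF M])
  obtain N where N: "submodule N R M" "artinian_module R (quotient_module M N)"
    "primeideal p R" "p = annihilator R (quotient_module M N)"
    using \<open>p \<in> Coass R M\<close> by (rule M.coassociatedE)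
  let ?L = "quotient_module M N"
  have L: "module R ?L" and dcc: "dcc_below R ?L (carrier ?L)"
    using N(2) by (auto simp: artinian_module_iff)
  interpret L: module R ?L by (rule L)
  interpret FL: module R "F ?L" by (rule module_F_tilde[OF L])
  note pi = M.linear_map_coset[OF N(1)]
  let ?\<pi> = "\<lambda>x. N +>\<^bsub>M\<^esub> x"
  let ?F\<pi> = "\<lambda>\<theta>. \<lambda>s\<in>carrier R. ?\<pi> (\<theta> s)"
  note Fpi = linear_map_F_tilde[OF M L pi]
  \<comment> \<open>Projectivity in terms of the dual basis: a homomorphism into \<open>?L\<close>
    is lifted by lifting its values on \<open>A\<close> and combining the lifts.\<close>
  have surj: "?F\<pi> ` carrier (F M) = carrier (F ?L)"
  proof
    show "?F\<pi> ` carrier (F M) \<subseteq> carrier (F ?L)" using FM.linear_map_closed(1)[OF Fpi FL.module_axioms] by blast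
    show "carrier (F ?L) \<subseteq> ?F\<pi> ` carrier (F M)"
    proof
      fix \<theta> assume t: "\<theta> \<in> carrier (F ?L)"
      have "\<theta> a \<in> ?\<pi> ` carrier M" if "a \<in> A" for a
        using F_tilde_apply(1)[OF L t, of a] that A_subset M.quotient_module_simps(1)[OF N(1)] by auto
      then have "\<forall>a\<in>A. \<exists>x\<in>carrier M. \<theta> a = ?\<pi> x" by blast
      then obtain y where y: "\<And>a. a \<in> A \<Longrightarrow> y a \<in> carrier M" "\<And>a. a \<in> A \<Longrightarrow> \<theta> a = ?\<pi> (y a)" by metis
      have yA: "y \<in> A \<rightarrow> carrier M" using y(1) by auto
      have "\<theta> = combination ?L A \<theta>" by (rule F_tilde_expand[OF L t])
      also have "\<dots> = combination ?L A (\<lambda>a. ?\<pi> (y a))"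
      proof -
        have "(\<Oplus>\<^bsub>?L\<^esub>a\<in>A. \<alpha> a s \<odot>\<^bsub>?L\<^esub> \<theta> a) = (\<Oplus>\<^bsub>?L\<^esub>a\<in>A. \<alpha> a s \<odot>\<^bsub>?L\<^esub> ?\<pi> (y a))" if s: "s \<in> carrier R" for s
          using y \<alpha>_closed[OF _ s] M.linear_map_closed(1)[OF pi L] by (intro L.M.finsum_cong') auto
        then show ?thesis by (auto simp: combination_def fun_eq_iff restrict_def)
      qed
      also have "\<dots> = ?F\<pi> (combination M A y)" by (rule combination_image[OF M L pi yA, symmetric])
      finally show "\<theta> \<in> ?F\<pi> ` carrier (F M)" using combination_closed[OF M order_refl yA] by blast
    qed
  qed
  let ?J = "annihilator R (F ?L)"
  have J: "ideal ?J R"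
    by (rule idealI') (auto simp: annihilator_def FL.smult_l_distr FL.smult_assoc1)
  have annJ: "\<phi> r \<in> ?J \<longleftrightarrow> r \<in> p" if r: "r \<in> carrier R" for r
  proof
    assume rp: "r \<in> p"
    have "\<phi> r \<odot>\<^bsub>F ?L\<^esub> \<theta> = \<zero>\<^bsub>F ?L\<^esub>" if t: "\<theta> \<in> carrier (F ?L)" for \<theta>
    proof (rule F_tilde_eqI)
      show "\<phi> r \<odot>\<^bsub>F ?L\<^esub> \<theta> \<in> carrier (F ?L)" using r t by simp
      fix s assume s: "s \<in> carrier R"
      have "\<theta> (s \<otimes> \<phi> r) = r \<odot>\<^bsub>?L\<^esub> \<theta> s" using F_tilde_apply(3)[OF L t r s] r s by (simp add: m_comm)
      also have "\<dots> = \<zero>\<^bsub>?L\<^esub>" using rp F_tilde_apply(1)[OF L t s] unfolding N(4) annihilator_def by blast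
      finally show "(\<phi> r \<odot>\<^bsub>F ?L\<^esub> \<theta>) s = \<zero>\<^bsub>F ?L\<^esub> s" using s by (simp add: F_tilde_ops)
    qed simp
    then show "\<phi> r \<in> ?J" using r by (simp add: annihilator_def)
  next
    assume rJ: "\<phi> r \<in> ?J"
    \<comment> \<open>The coordinate of \<one> at a is a unit, so evaluation of
      \<open>rank_one\<close> at \<one> recovers its vector up to that unit, and the annihilation of
      homomorphisms by \<open>\<phi> r\<close> becomes annihilation of \<open>?L\<close> by
      r.\<close>
    obtain a where a: "a \<in> A" "\<alpha> a \<one> \<notin> \<mm>" using \<alpha>_unit by blast
    obtain t where t: "t \<in> carrier R" "t \<otimes> \<alpha> a \<one> = \<one>"
      by (rule invertible_outside[OF \<alpha>_closed[OF a(1) one_closed] a(2)])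
    have P: "module R (restrict_scalars \<phi> (F ?L))" by (rule module_restrict_scalars[OF FL.module_axioms endo])
    have "r \<odot>\<^bsub>?L\<^esub> y = \<zero>\<^bsub>?L\<^esub>" if y: "y \<in> carrier ?L" for y
    proof -
      have "rank_one ?L a y \<in> carrier (F ?L)"
        using L.linear_map_closed(1)[OF linear_map_rank_one[OF L a(1)] P y] by simp
      then have "\<phi> r \<odot>\<^bsub>F ?L\<^esub> rank_one ?L a y = \<zero>\<^bsub>F ?L\<^esub>" using rJ by (simp add: annihilator_def)
      then have "rank_one ?L a (r \<odot>\<^bsub>?L\<^esub> y) = \<zero>\<^bsub>F ?L\<^esub>"
        using L.linear_map_closed(3)[OF linear_map_rank_one[OF L a(1)] P r y] by simp
      then have z: "\<alpha> a \<one> \<odot>\<^bsub>?L\<^esub> (r \<odot>\<^bsub>?L\<^esub> y) = \<zero>\<^bsub>?L\<^esub>"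
        by (simp add: rank_one_def F_tilde_ops fun_eq_iff restrict_def) (metis one_closed)
      have "r \<odot>\<^bsub>?L\<^esub> y = (t \<otimes> \<alpha> a \<one>) \<odot>\<^bsub>?L\<^esub> (r \<odot>\<^bsub>?L\<^esub> y)" using t(2) r y by simp
      also have "\<dots> = t \<odot>\<^bsub>?L\<^esub> (\<alpha> a \<one> \<odot>\<^bsub>?L\<^esub> (r \<odot>\<^bsub>?L\<^esub> y))"
        using t(1) r y \<alpha>_closed[OF a(1) one_closed] by (simp add: L.smult_assoc1)
      finally show ?thesis using z t(1) by simp
    qed
    then show "r \<in> p" unfolding N(4) annihilator_def using r by blast
  qed
  have "p \<in> Coass R (F ?L)"
  proof (rule FL.coassociated_radical_annihilator[OF noetherian_ring_axioms dcc_below_F_tilde[OF L dcc] N(3)])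
    note pc = ideal_closed[OF primeideal_closed(1)[OF N(3)]] and Jc = ideal_closed[OF J]
    show "?J \<subseteq> p"
    proof
      fix r assume r: "r \<in> ?J"
      have rc: "r \<in> carrier R" using Jc(1)[OF r] .
      \<comment> \<open>Every prime over \<open>?J\<close> contains r and hence
        \<open>\<phi> r\<close>. A power of \<open>\<phi> r\<close> in \<open>?J\<close> is the
        image of a power of r, to which \<open>annJ\<close> applies.\<close>
      have "\<exists>k::nat. \<phi> r [^] k \<in> ?J"
        by (rule pow_mem_if_in_primes[OF J]) (use rc r spec_fixed in auto)
      then obtain k :: nat where "\<phi> (r [^] k) \<in> ?J" using endo_pow[OF rc] by auto
      then have "r [^] k \<in> p" using annJ[of "r [^] k"] rc by simp
      then show "r \<in> p" by (rule primeideal_pow[OF N(3) rc])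
    qed
    fix r assume r: "r \<in> p"
    have rc: "r \<in> carrier R" using pc(1)[OF r] .
    show "\<exists>k::nat. r [^] k \<in> ?J"
    proof (rule pow_mem_if_in_primes[OF J rc])
      fix q assume q: "primeideal q R" "?J \<subseteq> q"
      then show "r \<in> q" using spec_fixed[OF q(1) rc] annJ[OF rc] r by blast
    qed
  qed
  then show "p \<in> Coass R (F M)"
    using FM.Coass_surjective[OF FL.module_axioms Fpi surj] by blast
qed

lemma Coass_F_tilde_subset:
  assumes M: "module R M" and fin: "F_finite R \<phi>"
  shows "Coass R (F M) \<subseteq> Coass R M"
proof
  fix p assume "p \<in> Coass R (F M)"
  interpret M: module R M by fact
  interpret FM: module R "F M" by (rule module_F_tilde[OF M])
  obtain N where N: "submodule N R (F M)" "artinian_module R (quotient_module (F M) N)"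
    "primeideal p R" "p = annihilator R (quotient_module (F M) N)"
    using \<open>p \<in> Coass R (F M)\<close> by (rule FM.coassociatedE)
  let ?L = "quotient_module (F M) N"
  have L: "module R ?L" and dcc: "dcc_below R ?L (carrier ?L)"
    using N(2) by (auto simp: artinian_module_iff)
  interpret L: module R ?L by (rule L)
  let ?P = "restrict_scalars \<phi> ?L" and ?FP = "restrict_scalars \<phi> (F M)"
  have P: "module R ?P" by (rule module_restrict_scalars[OF L endo])
  have FP: "module R ?FP" by (rule module_restrict_scalars[OF FM.module_axioms endo])
  have dccP: "dcc_below R ?P (carrier ?L)" by (rule artinian_restrict_scalars[OF fin L dcc])
  let ?\<pi> = "\<lambda>x. N +>\<^bsub>F M\<^esub> x"
  note pic = FM.linear_map_closed[OF FM.linear_map_coset[OF N(1)] L]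
  have rho: "rank_one M a y \<in> carrier (F M)" if "a \<in> A" "y \<in> carrier M" for a y
    using M.linear_map_closed(1)[OF linear_map_rank_one[OF M that(1)] FP that(2)] by simp
  have lin: "linear_map R M ?P (\<lambda>y. ?\<pi> (rank_one M a y))" if a: "a \<in> A" for a
    using M.linear_map_closed[OF linear_map_rank_one[OF M a] FP] pic by (auto simp: linear_map_def)
  have \<phi>p: "\<phi> r \<in> p \<longleftrightarrow> r \<in> p" if "r \<in> carrier R" for r by (rule spec_fixed[OF N(3) that])
  \<comment> \<open>The annihilator, over the restricted scalars, of the image in \<open>?L\<close>
    of the copy of \<open>M\<close> with index a.\<close>
  define K where "K a = {r \<in> carrier R. \<forall>y\<in>carrier M. r \<odot>\<^bsub>?P\<^esub> ?\<pi> (rank_one M a y) = \<zero>\<^bsub>?P\<^esub>}" for a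
  have pK: "p \<subseteq> K a" if a: "a \<in> A" for a
  proof
    fix r assume r: "r \<in> p"
    have rc: "r \<in> carrier R" using ideal_closed(1)[OF primeideal_closed(1)[OF N(3)] r] .
    have "\<phi> r \<in> annihilator R ?L" using \<phi>p[OF rc] r N(4) by simp
    then show "r \<in> K a" using rc pic(1)[OF rho[OF a]] by (auto simp: K_def annihilator_def)
  qed
  have "\<exists>a\<in>A. K a \<subseteq> p"
  proof (rule ccontr)
    assume neg: "\<not> (\<exists>a\<in>A. K a \<subseteq> p)"
    \<comment> \<open>If each \<open>K a\<close> had an element outside the prime p, the product of
      these elements would be outside p and in every \<open>K a\<close>; its image under
      \<open>\<phi>\<close> would then kill all of \<open>?L\<close>.\<close>
    have "\<exists>r\<in>carrier R - p. \<forall>a\<in>B. r \<in> K a" if "B \<subseteq> A" for B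
      using finite_subset[OF that finite_A] that
    proof (induction B rule: finite_induct)
      case empty
      show ?case using primeideal_closed(2)[OF N(3)] by auto
    next
      case (insert b B)
      then obtain r where r: "r \<in> carrier R" "r \<notin> p" "\<And>a. a \<in> B \<Longrightarrow> r \<in> K a" by auto
      obtain s where s: "s \<in> K b" "s \<notin> p" using neg insert.prems by blast
      have sc: "s \<in> carrier R" using s(1) by (simp add: K_def)
      have KI: "ideal (K a) R" if a: "a \<in> A" for a
      proof -
        interpret P: module R ?P by (rule P)
        have "?\<pi> (rank_one M a y) \<in> carrier ?P" if "y \<in> carrier M" for y using pic(1)[OF rho[OF a that]] by simp
        then show ?thesis
          by (intro idealI') (auto simp: K_def P.smult_l_distr P.smult_assoc1 simp del: restrict_scalars_simps)
      qed
      have "r \<otimes> s \<notin> p" using primeideal_closed(3)[OF N(3) r(1) sc] r(2) s(2) by blast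
      moreover have "r \<otimes> s \<in> K a" if a: "a \<in> insert b B" for a
      proof (cases "a = b")
        case True
        then show ?thesis using ideal_closed(6)[OF KI[of b] s(1) r(1)] insert.prems by simp
      next
        case False
        then have "a \<in> B" using a by simp
        then show ?thesis using ideal_closed(7)[OF KI[of a] r(3) sc] insert.prems by auto
      qed
      ultimately show ?case using r(1) sc by (intro bexI[of _ "r \<otimes> s"]) auto
    qed
    then obtain r where r: "r \<in> carrier R" "r \<notin> p" "\<And>a. a \<in> A \<Longrightarrow> r \<in> K a" by blast
    have "\<phi> r \<odot>\<^bsub>?L\<^esub> ?\<pi> (combination M B y) = \<zero>\<^bsub>?L\<^esub>" if "B \<subseteq> A" and y: "y \<in> A \<rightarrow> carrier M" for B y
      using finite_subset[OF that(1) finite_A] that(1)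
    proof (induction B rule: finite_induct)
      case empty
      show ?case using combination_empty[OF M, of y] pic(4) r(1) by simp
    next
      case (insert b B)
      have yb: "y b \<in> carrier M" "b \<in> A" and yB: "y \<in> insert b B \<rightarrow> carrier M" "y \<in> B \<rightarrow> carrier M"
        using y insert.prems by auto
      have BA: "B \<subseteq> A" using insert.prems by simp
      note c = combination_closed[OF M BA yB(2)] and rb = rho[OF yb(2,1)]
      have "\<phi> r \<odot>\<^bsub>?L\<^esub> ?\<pi> (rank_one M b (y b)) = \<zero>\<^bsub>?L\<^esub>" using r(3)[OF yb(2)] yb(1) by (simp add: K_def)
      then show ?case
        unfolding combination_insert[OF M insert.hyps insert.prems yB(1)] pic(2)[OF rb c]
        using insert.IH[OF BA] r(1) pic(1)[OF rb] pic(1)[OF c] by (simp add: L.smult_r_distr)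
    qed
    then have "\<phi> r \<odot>\<^bsub>?L\<^esub> ?\<pi> \<theta> = \<zero>\<^bsub>?L\<^esub>" if t: "\<theta> \<in> carrier (F M)" for \<theta>
    proof -
      have "\<theta> \<in> A \<rightarrow> carrier M" using F_tilde_apply(1)[OF M t] A_subset by auto
      then have "\<phi> r \<odot>\<^bsub>?L\<^esub> ?\<pi> (combination M A \<theta>) = \<zero>\<^bsub>?L\<^esub>"
        using \<open>\<And>y B. \<lbrakk>B \<subseteq> A; y \<in> A \<rightarrow> carrier M\<rbrakk> \<Longrightarrow> \<phi> r \<odot>\<^bsub>?L\<^esub> ?\<pi> (combination M B y) = \<zero>\<^bsub>?L\<^esub>\<close> by blast
      then show ?thesis using F_tilde_expand[OF M t] by simp
    qed
    then have "\<phi> r \<in> p"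
      unfolding N(4) annihilator_def using r(1) FM.quotient_module_simps(1)[OF N(1)] by auto
    then show False using \<phi>p[OF r(1)] r(2) by simp
  qed
  then obtain a where a: "a \<in> A" "K a \<subseteq> p" by blast
  show "p \<in> Coass R M"
  proof (rule M.coassociated_via_linear_map[OF P lin[OF a(1)] _ N(3)])
    show "dcc_below R ?P ((\<lambda>y. ?\<pi> (rank_one M a y)) ` carrier M)"
      by (rule dcc_below_mono[OF dccP]) (use pic(1)[OF rho[OF a(1)]] in auto)
    show "p = {r \<in> carrier R. \<forall>y\<in>carrier M. r \<odot>\<^bsub>?P\<^esub> ?\<pi> (rank_one M a y) = \<zero>\<^bsub>?P\<^esub>}"
      using pK[OF a(1)] a(2) unfolding K_def by blast
  qed
qed

end

theorem corollary5p8: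
  fixes R :: "('a, 'r) ring_scheme" and \<mm> :: "'a set"
    and \<phi> :: "'a \<Rightarrow> 'a" and M :: "('a, 'b, 'm) module_scheme"
  assumes "regular_local_ring \<mm> R"
    and "locally_contracting R \<phi>"
    and "module R M"
    and "F_finite R \<phi>"
  shows "Coass R (F_tilde R \<phi> M) = Coass R M"
proof -
  interpret regular_local_ring \<mm> R by fact
  interpret spec_fixing_endomorphism \<mm> R \<phi>
  proof
    show "\<phi> \<in> ring_hom R R" using assms(2) by (simp add: locally_contracting_def)
    show "\<phi> a \<in> P \<longleftrightarrow> a \<in> P" if "primeideal P R" "a \<in> carrier R" for P a
      by (rule locally_contracting_fixes_spec[OF assms(2) that])
  qed
  obtain xs where xs: "prime_flag {\<zero>\<^bsub>R\<^esub>} xs" using prime_flag_zero by blast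
  show ?thesis
  proof (rule dual_basis[OF xs assms(4)])
    fix A and \<alpha> :: "'a \<Rightarrow> 'a \<Rightarrow> 'a"
    assume "finite A" "A \<subseteq> carrier R"
      "\<And>a s. \<lbrakk>a \<in> A; s \<in> carrier R\<rbrakk> \<Longrightarrow> \<alpha> a s \<in> carrier R"
      "\<And>a s t. \<lbrakk>a \<in> A; s \<in> carrier R; t \<in> carrier R\<rbrakk> \<Longrightarrow> \<alpha> a (s \<oplus>\<^bsub>R\<^esub> t) = \<alpha> a s \<oplus>\<^bsub>R\<^esub> \<alpha> a t"
      "\<And>a r s. \<lbrakk>a \<in> A; r \<in> carrier R; s \<in> carrier R\<rbrakk> \<Longrightarrow> \<alpha> a (\<phi> r \<otimes>\<^bsub>R\<^esub> s) = r \<otimes>\<^bsub>R\<^esub> \<alpha> a s"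
      "\<And>s. s \<in> carrier R \<Longrightarrow> s = (\<Oplus>\<^bsub>R\<^esub>a\<in>A. \<phi> (\<alpha> a s) \<otimes>\<^bsub>R\<^esub> a)"
      "\<exists>a\<in>A. \<alpha> a \<one>\<^bsub>R\<^esub> \<notin> \<mm>"
    then interpret endomorphism_dual_basis \<mm> R \<phi> A \<alpha>
      by (intro endomorphism_dual_basis.intro spec_fixing_endomorphism_axioms endomorphism_dual_basis_axioms.intro)
    show ?thesis
      using Coass_F_tilde_subset[OF assms(3,4)] Coass_F_tilde_superset[OF assms(3)] by blast
  qed
qed

end
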